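(* Let $\mathcal{C}$ be a 2-Calabi-Yau category with cluster-tilting object, let $T=T_1\oplus\cdots\oplus T_n$ be a cluster-tilting object of $\mathcal{C}$ with $T_1,\ldots,T_n$ pairwise non-isomorphic indecomposables, let $B=\mathrm{End}_{\mathcal{C}}(T)$, and let $m\in K_0(\mathrm{mod}\,B)$. Assume that $\langle S_i,m\rangle_a\geq 0$ for each simple $B$-module $S_i$ ($1\leq i\leq n$). Then the function $f_{T,m}$ is a tropical frieze on $\mathcal{C}$.
   Context: Let $k$ be an algebraically closed field. A "2-Calabi-Yau category with cluster-tilting object" is a $k$-linear triangulated category $\mathcal{C}$ with suspension functor $\Sigma$ in which all idempotents split, such that: (a) all spaces $\mathcal{C}(X,Y)$ are finite-dimensional (so $\mathcal{C}$ is Krull-Schmidt); (b) there are bifunctorial isomorphisms $D\mathcal{C}(X,Y)\simeq \mathcal{C}(Y,\Sigma^2X)$, where $D=\mathrm{Hom}_k(?,k)$; (c) $\mathcal{C}$ admits a cluster-tilting object $T$, i.e. $\mathcal{C}(T,\Sigma T)=0$, the indecomposable direct summands of $T$ are pairwise non-isomorphic ($T$ is basic), and every object $X$ with $\mathcal{C}(T,\Sigma X)=0$ belongs to $\mathrm{add}\,T$. Write $\mathrm{Ext}^1_{\mathcal{C}}(X,Y)=\mathcal{C}(X,\Sigma Y)$. A tropical frieze on $\mathcal{C}$ is a map $f: obj(\mathcal{C})\to\mathbb{Z}$ such that: (d1) $f(X)=f(Y)$ if $X\simeq Y$; (d2) $f(X\oplus Y)=f(X)+f(Y)$ for all $X,Y$;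 (d3) for all objects $L,M$ with $\dim \mathrm{Ext}^1_{\mathcal{C}}(L,M)=1$, one has $f(L)+f(M)=\max\{f(E),f(E')\}$, where $E$ and $E'$ are the middle terms of the non-split triangles $L\to E\to M\to\Sigma L$ and $M\to E'\to L\to\Sigma M$. Index: for $X\in\mathcal{C}$ there is a triangle $T_1^X\to T_0^X\to X\to\Sigma T_1^X$ with $T_0^X,T_1^X\in\mathrm{add}\,T$, and $\mathrm{ind}_T(X)=[T_0^X]-[T_1^X]$ in the split Grothendieck group $K_0(\mathrm{add}\,T)$ (independent of the choice of triangle). Modules: $\mathrm{mod}\,B$ is the category of finite-dimensional right $B$-modules; $F=\mathcal{C}(T,?)$; $P_i=\mathcal{C}(T,T_i)$ is the indecomposable projective right $B$-module and $S_i$ its simple top. For finite-dimensional $B$-modules $X,Y$ put $\langle X,Y\rangle=\dim\mathrm{Hom}_B(X,Y)-\dim\mathrm{Ext}^1_B(X,Y)$ and $\langle X,Y\rangle_a=\langle X,Y\rangle-\langle Y,X\rangle$; by a result of Palu, $\langle\,,\rangle_a$ is a well-defined bilinear form on $K_0(\mathrm{mod}\,B)$. For $m\in K_0(\mathrm{mod}\,B)$ define $f_{T,m}(X)=\langle F(\mathrm{ind}_T(X)),m\rangle$ for $X\in\mathcal{C}$; here, if $\mathrm{ind}_T(X)=\sum_i g_i[T_i]$ then $F(\mathrm{ind}_T(X))=\sum_i g_i[P_i]$ and $\langle P_i,\cdot\rangle=\dim\mathrm{Hom}_B(P_i,\cdot)$ is extended additively to $K_0(\mathrm{mod}\,B)$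 (so if $m=\sum_i m_i[S_i]$ then $f_{T,m}(X)=\sum_i g_im_i$). *)

theory Defs
  imports
    "HOL-Computational_Algebra.Polynomial"
    "HOL-Library.Function_Algebras"
    "HOL-Algebra.Free_Abelian_Groups"
begin

section \<open>Linear algebra on subspaces\<close>

text \<open>
  Vector spaces are subspaces of an ambient type carrying a scalar multiplication. A linear map is
  represented by the function extended by \<open>0\<close> outside its domain, so that the set of linear maps is
  itself a subspace of the pointwise function space.
\<close>

definition linear_maps ::
  "('k \<Rightarrow> 'v \<Rightarrow> 'v) \<Rightarrow> ('k \<Rightarrow> 'w \<Rightarrow> 'w) \<Rightarrow> 'v set \<Rightarrow> 'w set \<Rightarrow> ('v::ab_group_add \<Rightarrow> 'w::ab_group_add) set"
  where "linear_maps s t V W =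
    {f. (\<forall>x\<in>V. f x \<in> W) \<and> (\<forall>x. x \<notin> V \<longrightarrow> f x = 0) \<and>
        (\<forall>x\<in>V. \<forall>y\<in>V. f (x + y) = f x + f y) \<and> (\<forall>c. \<forall>x\<in>V. f (s c x) = t c (f x))}"

definition fin_dim_subspace :: "('k::field \<Rightarrow> 'v::ab_group_add \<Rightarrow> 'v) \<Rightarrow> 'v set \<Rightarrow> bool"
  where "fin_dim_subspace s V \<longleftrightarrow> module.subspace s V \<and> (\<exists>A. finite A \<and> V = module.span s A)"


section \<open>Linear triangulated categories\<close>

text \<open>
  The objects are the elements of \<^typ>\<open>'o\<close>. All morphism spaces are subspaces of one vector space
  \<^typ>\<open>'m\<close>, and composition and the action of the suspension on morphisms are single operations on
  \<^typ>\<open>'m\<close> that are only constrained on composable morphisms. Every linear category whose objects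
  form a type is isomorphic to one of this shape, with \<^typ>\<open>'m\<close> the direct sum of all its
  morphism spaces. Here \<open>Tri C X Y Z u v w\<close> says that \<open>X \<rightarrow> Y \<rightarrow> Z \<rightarrow> \<Sigma>X\<close>, with maps
  \<open>u, v, w\<close>, is a distinguished triangle; \<open>susp\<close> and \<open>suspm\<close> are the suspension on objects and on
  morphisms.
\<close>

record ('k, 'o, 'm) tri_cat =
  smul  :: "'k \<Rightarrow> 'm \<Rightarrow> 'm"
  Hom   :: "'o \<Rightarrow> 'o \<Rightarrow> 'm set"
  Id    :: "'o \<Rightarrow> 'm"
  Cmp   :: "'m \<Rightarrow> 'm \<Rightarrow> 'm"  (infixl "\<cdot>\<index>" 70)
  susp  :: "'o \<Rightarrow> 'o"
  suspm :: "'m \<Rightarrow> 'm"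
  Tri   :: "'o \<Rightarrow> 'o \<Rightarrow> 'o \<Rightarrow> 'm \<Rightarrow> 'm \<Rightarrow> 'm \<Rightarrow> bool"

context
  fixes C :: "('k::field, 'o, 'm::ab_group_add) tri_cat" (structure)
begin

definition is_iso :: "'o \<Rightarrow> 'o \<Rightarrow> 'm \<Rightarrow> bool"
  where "is_iso X Y f \<longleftrightarrow> f \<in> Hom C X Y \<and> (\<exists>g\<in>Hom C Y X. g \<cdot> f = Id C X \<and> f \<cdot> g = Id C Y)"

definition isomorphic :: "'o \<Rightarrow> 'o \<Rightarrow> bool"
  where "isomorphic X Y \<longleftrightarrow> (\<exists>f. is_iso X Y f)"

definition is_zero :: "'o \<Rightarrow> bool"
  where "is_zero X \<longleftrightarrow> (\<forall>Y. Hom C X Y = {0} \<and> Hom C Y X = {0})"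

definition is_biproduct :: "'o \<Rightarrow> 'o \<Rightarrow> 'o \<Rightarrow> bool"
  where "is_biproduct X Y Z \<longleftrightarrow>
    (\<exists>i\<in>Hom C X Z. \<exists>j\<in>Hom C Y Z. \<exists>p\<in>Hom C Z X. \<exists>q\<in>Hom C Z Y.
       p \<cdot> i = Id C X \<and> q \<cdot> j = Id C Y \<and> q \<cdot> i = 0 \<and> p \<cdot> j = 0 \<and>
       i \<cdot> p + j \<cdot> q = Id C Z)"

definition is_direct_sum :: "nat set \<Rightarrow> (nat \<Rightarrow> 'o) \<Rightarrow> 'o \<Rightarrow> bool"
  where "is_direct_sum I X Z \<longleftrightarrow> finite I \<and>
    (\<exists>i p. (\<forall>a\<in>I. i a \<in> Hom C (X a) Z \<and> p a \<in> Hom C Z (X a)) \<and>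
       (\<forall>a\<in>I. \<forall>b\<in>I. p a \<cdot> i b = (if a = b then Id C (X a) else 0)) \<and>
       (\<Sum>a\<in>I. i a \<cdot> p a) = Id C Z)"

definition indecomposable :: "'o \<Rightarrow> bool"
  where "indecomposable X \<longleftrightarrow>
    \<not> is_zero X \<and> (\<forall>Y Z. is_biproduct Y Z X \<longrightarrow> is_zero Y \<or> is_zero Z)"

end

locale linear_category =
  fixes C :: "('k::field, 'o, 'm::ab_group_add) tri_cat" (structure)
  assumes ambient_vector_space: "vector_space (smul C)"
    and Hom_subspace: "module.subspace (smul C) (Hom C X Y)"
    and Id_in_Hom: "Id C X \<in> Hom C X X"
    and Cmp_in_Hom: "f \<in> Hom C X Y \<Longrightarrow> g \<in> Hom C Y Z \<Longrightarrow> g \<cdot> f \<in> Hom C X Z"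
    and Cmp_assoc: "f \<in> Hom C X Y \<Longrightarrow> g \<in> Hom C Y Z \<Longrightarrow> h \<in> Hom C Z W \<Longrightarrow>
          h \<cdot> (g \<cdot> f) = h \<cdot> g \<cdot> f"
    and Cmp_Id_right: "f \<in> Hom C X Y \<Longrightarrow> f \<cdot> Id C X = f"
    and Cmp_Id_left: "f \<in> Hom C X Y \<Longrightarrow> Id C Y \<cdot> f = f"
    and Cmp_add_left: "f \<in> Hom C X Y \<Longrightarrow> g \<in> Hom C Y Z \<Longrightarrow> g' \<in> Hom C Y Z \<Longrightarrow>
          (g + g') \<cdot> f = g \<cdot> f + g' \<cdot> f"
    and Cmp_add_right: "f \<in> Hom C X Y \<Longrightarrow> f' \<in> Hom C X Y \<Longrightarrow> g \<in> Hom C Y Z \<Longrightarrow>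
          g \<cdot> (f + f') = g \<cdot> f + g \<cdot> f'"
    and Cmp_smul_left: "f \<in> Hom C X Y \<Longrightarrow> g \<in> Hom C Y Z \<Longrightarrow> smul C r g \<cdot> f = smul C r (g \<cdot> f)"
    and Cmp_smul_right: "f \<in> Hom C X Y \<Longrightarrow> g \<in> Hom C Y Z \<Longrightarrow> g \<cdot> smul C r f = smul C r (g \<cdot> f)"

locale additive_linear_category = linear_category +
  assumes zero_object: "\<exists>X. is_zero C X"
    and biproducts: "\<exists>Z. is_biproduct C X Y Z"

text \<open>The suspension is a linear autoequivalence, not necessarily an automorphism.\<close>

locale triangulated_category = additive_linear_category +
  assumes suspm_in_Hom: "f \<in> Hom C X Y \<Longrightarrow> suspm C f \<in> Hom C (susp C X) (susp C Y)"
    and suspm_add: "f \<in> Hom C X Y \<Longrightarrow> f' \<in> Hom C X Y \<Longrightarrow> suspm C (f + f') = suspm C f + suspm C f'"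
    and suspm_smul: "f \<in> Hom C X Y \<Longrightarrow> suspm C (smul C r f) = smul C r (suspm C f)"
    and suspm_Id: "suspm C (Id C X) = Id C (susp C X)"
    and suspm_Cmp: "f \<in> Hom C X Y \<Longrightarrow> g \<in> Hom C Y Z \<Longrightarrow> suspm C (g \<cdot> f) = suspm C g \<cdot> suspm C f"
    and susp_fully_faithful: "bij_betw (suspm C) (Hom C X Y) (Hom C (susp C X) (susp C Y))"
    and susp_ess_surj: "\<exists>X. isomorphic C (susp C X) Y"
    and Tri_in_Hom: "Tri C X Y Z u v w \<Longrightarrow>
          u \<in> Hom C X Y \<and> v \<in> Hom C Y Z \<and> w \<in> Hom C Z (susp C X)"
    and Tri_iso: "Tri C X Y Z u v w \<Longrightarrow>
          u' \<in> Hom C X' Y' \<Longrightarrow> v' \<in> Hom C Y' Z' \<Longrightarrow> w' \<in> Hom C Z' (susp C X') \<Longrightarrow>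
          is_iso C X X' a \<Longrightarrow> is_iso C Y Y' b \<Longrightarrow> is_iso C Z Z' c \<Longrightarrow>
          b \<cdot> u = u' \<cdot> a \<Longrightarrow> c \<cdot> v = v' \<cdot> b \<Longrightarrow> suspm C a \<cdot> w = w' \<cdot> c \<Longrightarrow>
          Tri C X' Y' Z' u' v' w'"
    and Tri_Id: "is_zero C Z \<Longrightarrow> Tri C X X Z (Id C X) 0 0"
    and Tri_complete: "u \<in> Hom C X Y \<Longrightarrow> \<exists>Z v w. Tri C X Y Z u v w"
    and Tri_rotate: "u \<in> Hom C X Y \<Longrightarrow> v \<in> Hom C Y Z \<Longrightarrow> w \<in> Hom C Z (susp C X) \<Longrightarrow>
          Tri C X Y Z u v w \<longleftrightarrow> Tri C Y Z (susp C X) v w (- suspm C u)"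
    and Tri_morphism: "Tri C X Y Z u v w \<Longrightarrow> Tri C X' Y' Z' u' v' w' \<Longrightarrow>
          a \<in> Hom C X X' \<Longrightarrow> b \<in> Hom C Y Y' \<Longrightarrow> b \<cdot> u = u' \<cdot> a \<Longrightarrow>
          \<exists>c\<in>Hom C Z Z'. c \<cdot> v = v' \<cdot> b \<and> suspm C a \<cdot> w = w' \<cdot> c"
    and octahedral: "Tri C X Y Z' u i i' \<Longrightarrow> Tri C Y Z X' v j j' \<Longrightarrow> Tri C X Z Y' (v \<cdot> u) k k' \<Longrightarrow>
          \<exists>f g. Tri C Z' Y' X' f g (suspm C i \<cdot> j') \<and>
            f \<cdot> i = k \<cdot> v \<and> k' \<cdot> f = i' \<and> g \<cdot> k = j \<and> j' \<cdot> g = suspm C u \<cdot> k'"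

context
  fixes C :: "('k::field, 'o, 'm::ab_group_add) tri_cat" (structure)
begin

definition idempotents_split :: bool
  where "idempotents_split \<longleftrightarrow>
    (\<forall>X. \<forall>e\<in>Hom C X X. e \<cdot> e = e \<longrightarrow>
       (\<exists>Y. \<exists>p\<in>Hom C X Y. \<exists>i\<in>Hom C Y X. p \<cdot> i = Id C Y \<and> i \<cdot> p = e))"

definition Hom_dual :: "'o \<Rightarrow> 'o \<Rightarrow> ('m \<Rightarrow> 'k) set"
  where "Hom_dual X Y = linear_maps (smul C) (*) (Hom C X Y) UNIV"

text \<open>
  The functor \<open>D Hom(?, ?)\<close> on morphisms: for \<open>a : X \<rightarrow> X'\<close> and \<open>b : Y' \<rightarrow> Y\<close> it sends a functional
  on \<open>Hom X Y\<close> to one on \<open>Hom X' Y'\<close>.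
\<close>

definition Hom_dual_map :: "'o \<Rightarrow> 'o \<Rightarrow> 'm \<Rightarrow> 'm \<Rightarrow> ('m \<Rightarrow> 'k) \<Rightarrow> 'm \<Rightarrow> 'k"
  where "Hom_dual_map X' Y' a b \<xi> = (\<lambda>f. if f \<in> Hom C X' Y' then \<xi> (b \<cdot> f \<cdot> a) else 0)"

definition two_Calabi_Yau :: bool
  where "two_Calabi_Yau \<longleftrightarrow>
    (\<exists>\<Psi> :: 'o \<Rightarrow> 'o \<Rightarrow> ('m \<Rightarrow> 'k) \<Rightarrow> 'm.
       (\<forall>X Y. bij_betw (\<Psi> X Y) (Hom_dual X Y) (Hom C Y (susp C (susp C X)))) \<and>
       (\<forall>X Y. \<forall>\<xi>\<in>Hom_dual X Y. \<forall>\<eta>\<in>Hom_dual X Y. \<Psi> X Y (\<xi> + \<eta>) = \<Psi> X Y \<xi> + \<Psi> X Y \<eta>) \<and>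
       (\<forall>X Y c. \<forall>\<xi>\<in>Hom_dual X Y. \<Psi> X Y (\<lambda>f. c * \<xi> f) = smul C c (\<Psi> X Y \<xi>)) \<and>
       (\<forall>X X' Y Y'. \<forall>a\<in>Hom C X X'. \<forall>b\<in>Hom C Y' Y. \<forall>\<xi>\<in>Hom_dual X Y.
          \<Psi> X' Y' (Hom_dual_map X' Y' a b \<xi>) = suspm C (suspm C a) \<cdot> \<Psi> X Y \<xi> \<cdot> b))"

definition in_add :: "'o \<Rightarrow> 'o \<Rightarrow> bool"
  where "in_add T X \<longleftrightarrow> (\<exists>n Y W. is_direct_sum C {..<n} (\<lambda>_. T) W \<and> is_biproduct C X Y W)"

text \<open>The indecomposable direct summands of \<open>T\<close> are pairwise non-isomorphic.\<close>

definition basic_object :: "'o \<Rightarrow> bool"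
  where "basic_object T \<longleftrightarrow>
    (\<forall>n X. is_direct_sum C {1..n} X T \<and> (\<forall>i\<in>{1..n}. indecomposable C (X i)) \<longrightarrow>
       (\<forall>i\<in>{1..n}. \<forall>j\<in>{1..n}. i \<noteq> j \<longrightarrow> \<not> isomorphic C (X i) (X j)))"

definition cluster_tilting :: "'o \<Rightarrow> bool"
  where "cluster_tilting T \<longleftrightarrow> Hom C T (susp C T) = {0} \<and> basic_object T \<and>
    (\<forall>X. Hom C T (susp C X) = {0} \<longrightarrow> in_add T X)"

definition dim_Ext1 :: "'o \<Rightarrow> 'o \<Rightarrow> nat"
  where "dim_Ext1 X Y = vector_space.dim (smul C) (Hom C X (susp C Y))"

text \<open>A triangle splits iff its third morphism vanishes.\<close>

definition non_split_Tri :: "'o \<Rightarrow> 'o \<Rightarrow> 'o \<Rightarrow> 'm \<Rightarrow> 'm \<Rightarrow> 'm \<Rightarrow> bool"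
  where "non_split_Tri X Y Z u v w \<longleftrightarrow> Tri C X Y Z u v w \<and> w \<noteq> 0"

definition tropical_frieze :: "('o \<Rightarrow> int) \<Rightarrow> bool"
  where "tropical_frieze f \<longleftrightarrow>
    (\<forall>X Y. isomorphic C X Y \<longrightarrow> f X = f Y) \<and>
    (\<forall>X Y Z. is_biproduct C X Y Z \<longrightarrow> f Z = f X + f Y) \<and>
    (\<forall>L M. dim_Ext1 L M = 1 \<longrightarrow>
       (\<forall>E E' u v w u' v' w'. non_split_Tri L E M u v w \<longrightarrow> non_split_Tri M E' L u' v' w' \<longrightarrow>
          f L + f M = max (f E) (f E')))"

end

locale two_CY_category =
  triangulated_category C for C :: "('k::alg_closed_field, 'o, 'm::ab_group_add) tri_cat" (structure) +
  assumes idempotents: "idempotents_split C"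
    and Hom_finite: "fin_dim_subspace (smul C) (Hom C X Y)"
    and two_CY: "two_Calabi_Yau C"
    and has_cluster_tilting: "\<exists>T. cluster_tilting C T"


section \<open>Finite-dimensional right modules over an algebra\<close>

record ('k, 'b) kalgebra =
  acarr  :: "'b set"
  ascale :: "'k \<Rightarrow> 'b \<Rightarrow> 'b"
  amult  :: "'b \<Rightarrow> 'b \<Rightarrow> 'b"
  aunit  :: "'b"

definition End_alg :: "('k, 'o, 'm) tri_cat \<Rightarrow> 'o \<Rightarrow> ('k, 'm) kalgebra"
  where "End_alg C T = \<lparr>acarr = Hom C T T, ascale = smul C, amult = Cmp C, aunit = Id C T\<rparr>"

record ('k, 'v, 'b) rmod =
  mcarr  :: "'v set"
  mscale :: "'k \<Rightarrow> 'v \<Rightarrow> 'v"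
  mact   :: "'v \<Rightarrow> 'b \<Rightarrow> 'v"

text \<open>
  The objects of \<open>mod B\<close> are realised on finite-dimensional subspaces of \<^typ>\<open>'k poly\<close>, used only as
  a vector space of countably infinite dimension over \<^typ>\<open>'k\<close>; every finite-dimensional module is
  isomorphic to such a module.
\<close>

type_synonym ('k, 'b) fmod = "('k, 'k poly, 'b) rmod"

context
  fixes B :: "('k::field, 'b::ab_group_add) kalgebra"
begin

definition fd_module :: "('k, 'v::ab_group_add, 'b) rmod \<Rightarrow> bool"
  where "fd_module M \<longleftrightarrow>
    vector_space (mscale M) \<and> fin_dim_subspace (mscale M) (mcarr M) \<and>
    (\<forall>x\<in>mcarr M. \<forall>b\<in>acarr B. mact M x b \<in> mcarr M) \<and>
    (\<forall>x\<in>mcarr M. \<forall>y\<in>mcarr M. \<forall>b\<in>acarr B. mact M (x + y) b = mact M x b + mact M y b) \<and>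
    (\<forall>x\<in>mcarr M. \<forall>b\<in>acarr B. \<forall>b'\<in>acarr B. mact M x (b + b') = mact M x b + mact M x b') \<and>
    (\<forall>c. \<forall>x\<in>mcarr M. \<forall>b\<in>acarr B. mact M (mscale M c x) b = mscale M c (mact M x b)) \<and>
    (\<forall>c. \<forall>x\<in>mcarr M. \<forall>b\<in>acarr B. mact M x (ascale B c b) = mscale M c (mact M x b)) \<and>
    (\<forall>x\<in>mcarr M. \<forall>b\<in>acarr B. \<forall>b'\<in>acarr B. mact M x (amult B b b') = mact M (mact M x b) b') \<and>
    (\<forall>x\<in>mcarr M. mact M x (aunit B) = x)"

definition Hom_mod ::
  "('k, 'v::ab_group_add, 'b) rmod \<Rightarrow> ('k, 'w::ab_group_add, 'b) rmod \<Rightarrow> ('v \<Rightarrow> 'w) set"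
  where "Hom_mod M N =
    {f \<in> linear_maps (mscale M) (mscale N) (mcarr M) (mcarr N).
       \<forall>x\<in>mcarr M. \<forall>b\<in>acarr B. f (mact M x b) = mact N (f x) b}"

definition maps_dim :: "('k, 'w::ab_group_add, 'b) rmod \<Rightarrow> ('v \<Rightarrow> 'w) set \<Rightarrow> nat"
  where "maps_dim N H = vector_space.dim (\<lambda>c f x. mscale N c (f x)) H"

definition dim_Hom_mod :: "('k, 'v::ab_group_add, 'b) rmod \<Rightarrow> ('k, 'w::ab_group_add, 'b) rmod \<Rightarrow> nat"
  where "dim_Hom_mod M N = maps_dim N (Hom_mod M N)"

definition map_kernel :: "('k, 'v, 'b) rmod \<Rightarrow> ('v \<Rightarrow> 'w::zero) \<Rightarrow> 'v set"
  where "map_kernel M f = {x \<in> mcarr M. f x = 0}"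

definition short_exact :: "('k, 'b) fmod \<Rightarrow> ('k, 'b) fmod \<Rightarrow> ('k, 'b) fmod \<Rightarrow> bool"
  where "short_exact L M N \<longleftrightarrow>
    (\<exists>i\<in>Hom_mod L M. \<exists>p\<in>Hom_mod M N.
       inj_on i (mcarr L) \<and> i ` mcarr L = map_kernel M p \<and> p ` mcarr M = mcarr N)"

definition projective_mod :: "('k, 'b) fmod \<Rightarrow> bool"
  where "projective_mod P \<longleftrightarrow> fd_module P \<and>
    (\<forall>(M :: ('k, 'b) fmod) (N :: ('k, 'b) fmod). fd_module M \<longrightarrow> fd_module N \<longrightarrow>
       (\<forall>g\<in>Hom_mod M N. g ` mcarr M = mcarr N \<longrightarrow>
          (\<forall>f\<in>Hom_mod P N. \<exists>h\<in>Hom_mod P M. \<forall>x\<in>mcarr P. g (h x) = f x)))"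

text \<open>The start \<open>P2 \<rightarrow> P1 \<rightarrow> P0 \<rightarrow> X \<rightarrow> 0\<close> of a projective resolution.\<close>

definition proj_resolution ::
  "('k, 'b) fmod \<Rightarrow> ('k, 'b) fmod \<Rightarrow> ('k, 'b) fmod \<Rightarrow> ('k, 'b) fmod \<Rightarrow>
   ('k poly \<Rightarrow> 'k poly) \<Rightarrow> ('k poly \<Rightarrow> 'k poly) \<Rightarrow> ('k poly \<Rightarrow> 'k poly) \<Rightarrow> bool"
  where "proj_resolution X P0 P1 P2 \<epsilon> d1 d2 \<longleftrightarrow>
    projective_mod P0 \<and> projective_mod P1 \<and> projective_mod P2 \<and>
    \<epsilon> \<in> Hom_mod P0 X \<and> d1 \<in> Hom_mod P1 P0 \<and> d2 \<in> Hom_mod P2 P1 \<and>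
    \<epsilon> ` mcarr P0 = mcarr X \<and> map_kernel P0 \<epsilon> = d1 ` mcarr P1 \<and> map_kernel P1 d1 = d2 ` mcarr P2"

text \<open>
  \<open>Ext\<^sup>1(X, Y)\<close> is the first cohomology (cocycles modulo coboundaries) of \<open>Hom(P, Y)\<close> for a projective
  resolution \<open>P\<close> of \<open>X\<close>; its dimension does not depend on the resolution. The natural number
  subtraction does not truncate, as coboundaries are cocycles.
\<close>

definition dim_Ext1_mod :: "('k, 'b) fmod \<Rightarrow> ('k, 'b) fmod \<Rightarrow> nat"
  where "dim_Ext1_mod X Y =
    (THE n. \<exists>P0 P1 P2 \<epsilon> d1 d2. proj_resolution X P0 P1 P2 \<epsilon> d1 d2 \<and>
       n = maps_dim Y {h \<in> Hom_mod P1 Y. \<forall>x\<in>mcarr P2. h (d2 x) = 0}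
         - maps_dim Y ((\<lambda>h. h \<circ> d1) ` Hom_mod P0 Y))"

definition euler_form :: "('k, 'b) fmod \<Rightarrow> ('k, 'b) fmod \<Rightarrow> int"
  where "euler_form X Y = int (dim_Hom_mod X Y) - int (dim_Ext1_mod X Y)"

definition submodule_of :: "('k, 'v::ab_group_add, 'b) rmod \<Rightarrow> 'v set \<Rightarrow> bool"
  where "submodule_of M N \<longleftrightarrow> N \<subseteq> mcarr M \<and> module.subspace (mscale M) N \<and>
    (\<forall>x\<in>N. \<forall>b\<in>acarr B. mact M x b \<in> N)"

definition maximal_submodule :: "('k, 'v::ab_group_add, 'b) rmod \<Rightarrow> 'v set \<Rightarrow> bool"
  where "maximal_submodule M N \<longleftrightarrow> submodule_of M N \<and> N \<noteq> mcarr M \<and>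
    (\<forall>K. submodule_of M K \<and> N \<subseteq> K \<longrightarrow> K = N \<or> K = mcarr M)"

definition rad :: "('k, 'v::ab_group_add, 'b) rmod \<Rightarrow> 'v set"
  where "rad M = mcarr M \<inter> \<Inter>{N. maximal_submodule M N}"

definition simple_mod :: "('k, 'v::ab_group_add, 'b) rmod \<Rightarrow> bool"
  where "simple_mod S \<longleftrightarrow> fd_module S \<and> mcarr S \<noteq> {0} \<and>
    (\<forall>N. submodule_of S N \<longrightarrow> N = {0} \<or> N = mcarr S)"

text \<open>\<open>S\<close> is isomorphic to \<open>P / rad P\<close> and simple.\<close>

definition is_simple_top :: "('k, 'v::ab_group_add, 'b) rmod \<Rightarrow> ('k, 'b) fmod \<Rightarrow> bool"
  where "is_simple_top P S \<longleftrightarrow> simple_mod S \<and>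
    (\<exists>p\<in>Hom_mod P S. p ` mcarr P = mcarr S \<and> map_kernel P p = rad P)"

definition simple_top :: "('k, 'v::ab_group_add, 'b) rmod \<Rightarrow> ('k, 'b) fmod"
  where "simple_top P = (SOME S. is_simple_top P S)"

end


section \<open>Grothendieck groups\<close>

text \<open>
  The free abelian group on \<open>S\<close> modulo \<open>[y] - [x] - [z]\<close> for all \<open>(x, y, z) \<in> R\<close>. The group
  operation of the quotient is written multiplicatively.
\<close>

definition groth_relations :: "'a set \<Rightarrow> ('a \<times> 'a \<times> 'a) set \<Rightarrow> ('a \<Rightarrow>\<^sub>0 int) set"
  where "groth_relations S R =
    generate (free_Abelian_group S) {frag_of y - frag_of x - frag_of z | x y z. (x, y, z) \<in> R}"

definition groth_group :: "'a set \<Rightarrow> ('a \<times> 'a \<times> 'a) set \<Rightarrow> ('a \<Rightarrow>\<^sub>0 int) set monoid"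
  where "groth_group S R = free_Abelian_group S Mod groth_relations S R"

definition groth_class :: "'a set \<Rightarrow> ('a \<times> 'a \<times> 'a) set \<Rightarrow> 'a \<Rightarrow> ('a \<Rightarrow>\<^sub>0 int) set"
  where "groth_class S R x = groth_relations S R #>\<^bsub>free_Abelian_group S\<^esub> frag_of x"

text \<open>
  \<open>biadditive \<phi>\<close> is the biadditive extension of \<open>\<phi>\<close> to free abelian groups and \<open>groth_pairing \<phi>\<close> the
  form it induces on classes; the latter is meaningful when the value does not depend on the
  representatives.
\<close>

definition biadditive :: "('a \<Rightarrow> 'b \<Rightarrow> int) \<Rightarrow> ('a \<Rightarrow>\<^sub>0 int) \<Rightarrow> ('b \<Rightarrow>\<^sub>0 int) \<Rightarrow> int"
  where "biadditive \<phi> u v = (\<Sum>x\<in>Poly_Mapping.keys u. \<Sum>y\<in>Poly_Mapping.keys v.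
    Poly_Mapping.lookup u x * Poly_Mapping.lookup v y * \<phi> x y)"

definition groth_pairing :: "('a \<Rightarrow> 'b \<Rightarrow> int) \<Rightarrow> ('a \<Rightarrow>\<^sub>0 int) set \<Rightarrow> ('b \<Rightarrow>\<^sub>0 int) set \<Rightarrow> int"
  where "groth_pairing \<phi> c d = the_elem {biadditive \<phi> u v | u v. u \<in> c \<and> v \<in> d}"

definition mod_ses ::
  "('k::field, 'b::ab_group_add) kalgebra \<Rightarrow> (('k, 'b) fmod \<times> ('k, 'b) fmod \<times> ('k, 'b) fmod) set"
  where "mod_ses B =
    {(L, M, N). fd_module B L \<and> fd_module B M \<and> fd_module B N \<and> short_exact B L M N}"

definition K0_mod :: "('k::field, 'b::ab_group_add) kalgebra \<Rightarrow> (('k, 'b) fmod \<Rightarrow>\<^sub>0 int) set monoid"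
  where "K0_mod B = groth_group (Collect (fd_module B)) (mod_ses B)"

definition K0_mod_class ::
  "('k::field, 'b::ab_group_add) kalgebra \<Rightarrow> ('k, 'b) fmod \<Rightarrow> (('k, 'b) fmod \<Rightarrow>\<^sub>0 int) set"
  where "K0_mod_class B = groth_class (Collect (fd_module B)) (mod_ses B)"

definition antisym_form ::
  "('k::field, 'b::ab_group_add) kalgebra \<Rightarrow>
   (('k, 'b) fmod \<Rightarrow>\<^sub>0 int) set \<Rightarrow> (('k, 'b) fmod \<Rightarrow>\<^sub>0 int) set \<Rightarrow> int"
  where "antisym_form B = groth_pairing (\<lambda>X Y. euler_form B X Y - euler_form B Y X)"

context
  fixes C :: "('k::field, 'o, 'm::ab_group_add) tri_cat" (structure)
begin

definition add_split :: "'o \<Rightarrow> ('o \<times> 'o \<times> 'o) set"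
  where "add_split T =
    {(X, Z, Y). in_add C T X \<and> in_add C T Z \<and> in_add C T Y \<and> is_biproduct C X Y Z}"

definition K0_add :: "'o \<Rightarrow> ('o \<Rightarrow>\<^sub>0 int) set monoid"
  where "K0_add T = groth_group (Collect (in_add C T)) (add_split T)"

definition K0_add_class :: "'o \<Rightarrow> 'o \<Rightarrow> ('o \<Rightarrow>\<^sub>0 int) set"
  where "K0_add_class T = groth_class (Collect (in_add C T)) (add_split T)"


section \<open>The index and the function attached to a class of modules\<close>

definition index :: "'o \<Rightarrow> 'o \<Rightarrow> ('o \<Rightarrow>\<^sub>0 int) set"
  where "index T X =
    (THE g. \<exists>T1 T0 u v w. in_add C T T1 \<and> in_add C T T0 \<and> Tri C T1 T0 X u v w \<and>
       g = K0_add_class T T0 \<otimes>\<^bsub>K0_add T\<^esub> inv\<^bsub>K0_add T\<^esub> K0_add_class T T1)"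

text \<open>The functor \<open>C(T, ?)\<close> with values in right modules over \<open>End(T)\<close>.\<close>

definition F_mod :: "'o \<Rightarrow> 'o \<Rightarrow> ('k, 'm, 'm) rmod"
  where "F_mod T X = \<lparr>mcarr = Hom C T X, mscale = smul C, mact = Cmp C\<rparr>"

text \<open>
  \<open>\<langle>F(index T X), m\<rangle>\<close>: as \<open>F_mod T U\<close> is projective for \<open>U\<close> in \<open>add T\<close>, the pairing of its class with
  that of a module \<open>M\<close> is the dimension of the space of homomorphisms.
\<close>

definition frieze_fun :: "'o \<Rightarrow> (('k, 'm) fmod \<Rightarrow>\<^sub>0 int) set \<Rightarrow> 'o \<Rightarrow> int"
  where "frieze_fun T m X =
    groth_pairing (\<lambda>U M. int (dim_Hom_mod (End_alg C T) (F_mod T U) M)) (index T X) m"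

end

end

theory Submission
  imports Defs
begin

text \<open>
  Write \<open>F = C(T, ?)\<close> and call a map a ghost if \<open>F\<close> kills it, that is, if it factors through
  \<open>add \<Sigma>T\<close>. If \<open>m\<close> is the class of \<open>F Z\<close>, then the value of \<open>f = f\<^sub>T\<^sub>,\<^sub>m\<close> at \<open>X\<close> is
  \<open>dim Hom\<^sub>B(F X, F Z) - dim ghost(X, \<Sigma>Z)\<close>, and diagram chases show that \<open>f(E) = f(L) + f(M)\<close> for a
  triangle \<open>L \<rightarrow> E \<rightarrow> M \<rightarrow> \<Sigma>L\<close> whose connecting map is a ghost. For any other connecting map, factor
  it as \<open>M \<rightarrow> \<Sigma>W \<rightarrow> \<Sigma>L\<close> so that \<open>F\<close> makes the first map surjective and the second injective; the
  octahedral axiom then gives \<open>f(L) + f(M) - f(E) = f(\<Sigma>W) + f(W)\<close>. By Calabi-Yau duality the ghosts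
  \<open>L \<rightarrow> \<Sigma>M\<close> form the annihilator of the ghosts \<open>M \<rightarrow> \<Sigma>L\<close>. This has two consequences:
  \<open>f(\<Sigma>W) + f(W) = \<langle>F \<Sigma>W, m\<rangle>\<^sub>a\<close>, which is nonnegative because \<open>F \<Sigma>W\<close> has a composition series with
  factors among the \<open>S\<^sub>i\<close>; and if \<open>Ext\<^sup>1(L, M)\<close> is one-dimensional then one of the two connecting maps
  is a ghost, so that one of \<open>f(E), f(E')\<close> attains the upper bound \<open>f(L) + f(M)\<close>.
\<close>

section \<open>Linear algebra on finite-dimensional subspaces\<close>

text \<open>F turns a triangle only into a long exact sequence, so the index is not additive on
  triangles. Two facts make modules accessible from C: F is full with the ghosts as its kernel, and
  every finite-dimensional module is some F Z. The correction term ghost(X, \<Sigma>Z) is the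
  cokernel of Hom(U0, Z) -> Hom(U1, Z) for a triangle U1 -> U0 -> X -> \<Sigma>U1 with U0, U1 in add
  T, so it restores the alternating sum that defines the index. The class m is an integer
  combination of modules, and the positivity assumption says nothing about its single terms.
  Inequalities cannot be checked one Z at a time: all formulas are equalities valid for every Z,
  with an object W independent of Z, and only their sum over m is compared with 0. Ext^1(F
  \<Sigma>W, F Z) has the dimension of the space of maps W -> Z that factor both through add T and
  through add \<Sigma>T. Annihilators turn sums into intersections, and this is how duality produces
  the antisymmetrised form. Modules are written F \<Sigma>V to match this shape.\<close>

definition lin_on ::
  "('k \<Rightarrow> 'v \<Rightarrow> 'v) \<Rightarrow> ('k \<Rightarrow> 'w \<Rightarrow> 'w) \<Rightarrow> 'v set \<Rightarrow> ('v::ab_group_add \<Rightarrow> 'w::ab_group_add) \<Rightarrow> bool"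
  where "lin_on s t V f \<longleftrightarrow>
    (\<forall>x\<in>V. \<forall>y\<in>V. f (x + y) = f x + f y) \<and> (\<forall>c. \<forall>x\<in>V. f (s c x) = t c (f x))"

lemma lin_onI:
  assumes "\<And>x y. x \<in> V \<Longrightarrow> y \<in> V \<Longrightarrow> f (x + y) = f x + f y"
    and "\<And>c x. x \<in> V \<Longrightarrow> f (s c x) = t c (f x)"
  shows "lin_on s t V f"
  using assms by (auto simp: lin_on_def)

lemma lin_on_add: "lin_on s t V f \<Longrightarrow> x \<in> V \<Longrightarrow> y \<in> V \<Longrightarrow> f (x + y) = f x + f y"
  and lin_on_scale: "lin_on s t V f \<Longrightarrow> x \<in> V \<Longrightarrow> f (s c x) = t c (f x)"
  by (auto simp: lin_on_def)

lemma lin_on_mono: "lin_on s t V f \<Longrightarrow> W \<subseteq> V \<Longrightarrow> lin_on s t W f"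
  by (auto simp: lin_on_def subset_iff)

lemma lin_on_comp:
  assumes "lin_on s t V f" "lin_on t r W g" "f ` V \<subseteq> W"
  shows "lin_on s r V (\<lambda>x. g (f x))"
  using assms by (auto simp: lin_on_def image_subset_iff)

context vector_space
begin

lemma fin_dim_subspaceI:
  assumes "subspace W" "finite A" "W \<subseteq> span A"
  shows "fin_dim_subspace scale W"
proof -
  obtain B where B: "B \<subseteq> W" "independent B" "W \<subseteq> span B"
    using maximal_independent_subset[of W] by auto
  have "finite B"
    using independent_span_bound[OF assms(2) B(2)] B(1) assms(3) by auto
  moreover have "W = span B"
    using B assms(1) span_subspace by blast
  ultimately show ?thesis
    using assms(1) by (auto simp: fin_dim_subspace_def)
qed

lemma fin_dim_subspaceD: "fin_dim_subspace scale V \<Longrightarrow> subspace V"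
  by (simp add: fin_dim_subspace_def)

lemma fin_dim_subset:
  assumes "fin_dim_subspace scale V" "subspace W" "W \<subseteq> V"
  shows "fin_dim_subspace scale W"
  using assms fin_dim_subspaceI by (metis fin_dim_subspace_def)

lemma basis_extension:
  assumes V: "fin_dim_subspace scale V" and W: "subspace W" "W \<subseteq> V"
  obtains A B where "A \<subseteq> B" "finite B" "independent B" "span B = V" "span A = W"
    "card A = dim W" "card B = dim V"
proof -
  obtain S where S: "finite S" "V = span S" and sV: "subspace V"
    using V by (auto simp: fin_dim_subspace_def)
  obtain A where A: "A \<subseteq> W" "independent A" "W \<subseteq> span A" "card A = dim W"
    using basis_exists[of W] by auto
  obtain B where B: "A \<subseteq> B" "B \<subseteq> V" "independent B" "V \<subseteq> span B"
    using maximal_independent_subset_extend[of A V] A W(2) by (metis subset_trans)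
  have "finite B"
    using independent_span_bound[OF S(1) B(3)] B(2) S(2) by auto
  moreover have "span A = W"
    using A W(1) span_subspace by blast
  moreover have "span B = V"
    using B sV span_subspace by blast
  moreover have "card B = dim V"
    using basis_card_eq_dim[OF B(2) B(4) B(3)] .
  ultimately show ?thesis
    using that A(4) B(1,3) by blast
qed

lemma fin_dim_basis:
  assumes V: "fin_dim_subspace scale V"
  obtains B where "finite B" "independent B" "span B = V" "card B = dim V"
  using basis_extension[OF V fin_dim_subspaceD[OF V] subset_refl] by metis

lemma dim_mono_fin:
  assumes V: "fin_dim_subspace scale V" and W: "subspace W" "W \<subseteq> V"
  shows "dim W \<le> dim V"
  using basis_extension[OF V W] by (metis card_mono)

lemma dim_eq_imp_eq:
  assumes V: "fin_dim_subspace scale V" and W: "subspace W" "W \<subseteq> V" and "dim V \<le> dim W"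
  shows "W = V"
proof -
  obtain A B where AB: "A \<subseteq> B" "finite B" "independent B" "span B = V" "span A = W"
    "card A = dim W" "card B = dim V" using basis_extension[OF V W] by metis
  have "A = B" using AB assms(4) by (metis card_seteq)
  then show ?thesis using AB by simp
qed

lemma dim_zero_subspace [simp]: "dim {0} = 0"
  using dim_span_eq_card_independent[OF independent_empty] by (simp only: span_empty card.empty)

lemma dim_eq_0_imp:
  assumes "fin_dim_subspace scale V" "dim V = 0"
  shows "V = {0}"
  using dim_eq_imp_eq[OF assms(1), of "{0}"] subspace_0[OF fin_dim_subspaceD[OF assms(1)]] assms(2)
  by auto

lemma lin_on_zero:
  assumes "lin_on scale t V f" "subspace V"
  shows "f 0 = 0"
proof -
  have "f (0 + 0) = f 0 + f 0"
    using assms by (intro lin_on_add) (auto intro: subspace_0)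
  then show ?thesis by simp
qed

lemma lin_on_minus:
  assumes "lin_on scale t V f" "subspace V" "x \<in> V"
  shows "f (- x) = - f x"
proof -
  have "f (x + - x) = f x + f (- x)"
    by (intro lin_on_add[OF assms(1)] assms subspace_neg)
  then show ?thesis
    using lin_on_zero[OF assms(1,2)] by (simp add: eq_neg_iff_add_eq_0 add.commute)
qed

lemma lin_on_diff:
  assumes "lin_on scale t V f" "subspace V" "x \<in> V" "y \<in> V"
  shows "f (x - y) = f x - f y"
  using lin_on_add[OF assms(1), of x "- y"] lin_on_minus[OF assms(1,2,4)] assms
  by (simp add: subspace_neg)

lemma lin_on_sum:
  assumes f: "lin_on scale t V f" and V: "subspace V" and "\<And>i. i \<in> I \<Longrightarrow> g i \<in> V"
  shows "f (\<Sum>i\<in>I. g i) = (\<Sum>i\<in>I. f (g i))"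
  using assms(3)
proof (induction I rule: infinite_finite_induct)
  case (insert i I)
  have "f (g i + sum g I) = f (g i) + f (sum g I)"
    using insert by (intro lin_on_add[OF f]) (auto intro!: subspace_sum[OF V])
  then show ?case using insert by auto
qed (auto simp: lin_on_zero[OF f V])

lemma lin_on_inj:
  assumes "lin_on scale t V f" "subspace V" "\<And>x. x \<in> V \<Longrightarrow> f x = 0 \<Longrightarrow> x = 0"
  shows "inj_on f V"
proof (rule inj_onI)
  fix x y assume "x \<in> V" "y \<in> V" "f x = f y"
  then have "f (x - y) = 0" using lin_on_diff[OF assms(1,2)] by auto
  then have "x - y = 0"
    using assms(3) \<open>x \<in> V\<close> \<open>y \<in> V\<close> subspace_diff[OF assms(2)] by blast
  then show "x = y" by simp
qed

end

section \<open>Kernels, images and rank-nullity for maps linear on a subspace\<close>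

lemma subspace_kernel_on:
  assumes "vector_space s" "lin_on s t V f" "module.subspace s V" "vector_space t"
  shows "module.subspace s {x \<in> V. f x = 0}"
proof -
  interpret s: vector_space s by fact
  interpret t: vector_space t by fact
  show ?thesis
    using assms s.lin_on_zero[OF assms(2,3)]
    by (auto intro!: s.subspaceI simp: lin_on_add lin_on_scale s.subspace_0 s.subspace_add s.subspace_scale)
qed

lemma subspace_preimage_on:
  assumes "vector_space s" "lin_on s t V f" "module.subspace s V" "vector_space t" "module.subspace t W"
  shows "module.subspace s {x \<in> V. f x \<in> W}"
proof -
  interpret s: vector_space s by fact
  interpret t: vector_space t by fact
  show ?thesis
    using assms s.lin_on_zero[OF assms(2,3)]
    by (auto intro!: s.subspaceI simp: lin_on_add lin_on_scale s.subspace_0 s.subspace_add s.subspace_scale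
        t.subspace_0 t.subspace_add t.subspace_scale)
qed

lemma subspace_image_on:
  assumes "vector_space s" "lin_on s t V f" "module.subspace s V" "vector_space t"
  shows "module.subspace t (f ` V)"
proof -
  interpret s: vector_space s by fact
  interpret t: vector_space t by fact
  show ?thesis
  proof (rule t.subspaceI)
    show "0 \<in> f ` V"
      using s.lin_on_zero[OF assms(2,3)] s.subspace_0[OF assms(3)] by force
    show "x + y \<in> f ` V" if "x \<in> f ` V" "y \<in> f ` V" for x y
      using that lin_on_add[OF assms(2)] s.subspace_add[OF assms(3)] by (auto simp: image_iff) metis
    show "t c x \<in> f ` V" if "x \<in> f ` V" for c x
      using that lin_on_scale[OF assms(2)] s.subspace_scale[OF assms(3)] by (auto simp: image_iff) metis
  qed
qed

text \<open>Composition in C is only constrained on composable morphisms, so the maps met below are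
  linear on a subspace and arbitrary elsewhere. Extending from a basis of V gives a genuine linear
  map with the same values on V, to which basis arguments apply.\<close>

lemma lin_on_extend:
  assumes "vector_space s" "vector_space t" "lin_on s t V f" "fin_dim_subspace s V"
  obtains g where "Vector_Spaces.linear s t g" "\<And>x. x \<in> V \<Longrightarrow> g x = f x"
proof -
  interpret vector_space_pair s t
    using assms by (simp add: vector_space_pair_def)
  obtain B where B: "finite B" "vs1.independent B" "vs1.span B = V"
    using vs1.fin_dim_basis[OF assms(4)] by metis
  obtain g where g: "Vector_Spaces.linear s t g" "\<forall>x\<in>B. g x = f x"
    using linear_independent_extend[OF B(2)] by blast
  interpret g: Vector_Spaces.linear s t g by fact
  have sV: "vs1.subspace V" using vs1.fin_dim_subspaceD[OF assms(4)] .
  have "vs1.subspace {x \<in> V. g x = f x}"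
    using vs1.lin_on_zero[OF assms(3) sV]
    by (auto intro!: vs1.subspaceI
        simp: lin_on_add[OF assms(3)] lin_on_scale[OF assms(3)] vs1.subspace_0[OF sV]
        vs1.subspace_add[OF sV] vs1.subspace_scale[OF sV] g.add g.scale)
  moreover have "B \<subseteq> {x \<in> V. g x = f x}"
    using B(3) g(2) vs1.span_base by auto
  ultimately have "V \<subseteq> {x \<in> V. g x = f x}"
    using vs1.span_minimal B(3) by metis
  then show ?thesis using that g(1) by blast
qed

text \<open>Complete a basis A of the kernel to a basis B of V; the images of the vectors in B - A
  form a basis of the image.\<close>

lemma rank_nullity:
  assumes s: "vector_space s" and t: "vector_space t" and f: "lin_on s t V f"
    and V: "fin_dim_subspace s V"
  shows "fin_dim_subspace t (f ` V)"
    and "vector_space.dim s V =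
      vector_space.dim s {x \<in> V. f x = 0} + vector_space.dim t (f ` V)"
proof -
  interpret vector_space_pair s t
    using assms by (simp add: vector_space_pair_def)
  have sV: "vs1.subspace V" using vs1.fin_dim_subspaceD[OF V] .
  obtain g where g: "Vector_Spaces.linear s t g" and gf: "\<And>x. x \<in> V \<Longrightarrow> g x = f x"
    using lin_on_extend[OF s t f V] by metis
  interpret g: Vector_Spaces.linear s t g by fact
  have K: "{x \<in> V. f x = 0} = {x \<in> V. g x = 0}" using gf by auto
  obtain A B where AB: "A \<subseteq> B" "finite B" "vs1.independent B" "vs1.span B = V"
    "vs1.span A = {x \<in> V. f x = 0}" "card A = vs1.dim {x \<in> V. f x = 0}" "card B = vs1.dim V"
    using vs1.basis_extension[OF V subspace_kernel_on[OF s f sV t]] by blast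
  \<comment> \<open>The coordinates of x with respect to B are supported in A, because x lies in the
    kernel, and also in B - A; so all of them vanish.\<close>
  have disj: "x = 0" if x: "x \<in> vs1.span (B - A)" "g x = 0" for x
  proof -
    have "x \<in> V" using x(1) AB vs1.span_mono[of "B - A" B] by auto
    then have xA: "x \<in> vs1.span A" using AB(5) x(2) K by auto
    have iA: "vs1.independent A" and iBA: "vs1.independent (B - A)"
      using AB(3) AB(1) vs1.independent_mono by auto
    have "vs1.representation B x = vs1.representation A x"
      using vs1.representation_extend[OF AB(3) xA AB(1)] .
    moreover have "vs1.representation B x = vs1.representation (B - A) x"
      using vs1.representation_extend[OF AB(3) x(1)] by auto
    ultimately have "vs1.representation B x b = 0" for b
      using vs1.representation_ne_zero[of A x b] vs1.representation_ne_zero[of "B - A" x b] by auto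
    then show "x = 0"
      using vs1.sum_nonzero_representation_eq[OF AB(3), of x] \<open>x \<in> V\<close> AB(4) by simp
  qed
  have inj: "inj_on g (vs1.span (B - A))"
    by (rule vs1.lin_on_inj[of t]) (use disj in \<open>auto simp: lin_on_def g.add g.scale\<close>)
  have ind: "vs2.independent (g ` (B - A))"
    using inj AB(3) vs1.independent_mono[of B "B - A"] by (intro g.independent_injective_image) auto
  have img: "f ` V = g ` V" using gf by auto
  have "g ` B \<subseteq> vs2.span (g ` (B - A))"
  proof
    fix y assume "y \<in> g ` B"
    then obtain b where b: "b \<in> B" "y = g b" by auto
    show "y \<in> vs2.span (g ` (B - A))"
    proof (cases "b \<in> A")
      case True
      then have "g b = 0" using AB(5) K vs1.span_base[of b A] by auto
      then show ?thesis using b vs2.span_zero by simp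
    next
      case False
      then show ?thesis using b vs2.span_base by auto
    qed
  qed
  then have "vs2.span (g ` B) = vs2.span (g ` (B - A))"
    by (metis Diff_subset image_mono vs2.span_eq vs2.span_superset subset_trans)
  moreover have "g ` V = vs2.span (g ` B)"
    using g.span_image AB(4) by metis
  ultimately have im: "f ` V = vs2.span (g ` (B - A))" using img by simp
  show "fin_dim_subspace t (f ` V)"
    unfolding im by (rule vs2.fin_dim_subspaceI[of _ "g ` (B - A)"]) (use AB(2) in auto)
  have "vs2.dim (f ` V) = card (g ` (B - A))"
    unfolding im using vs2.dim_span_eq_card_independent[OF ind] .
  also have "\<dots> = card (B - A)"
    using inj vs1.span_superset by (intro card_image) (meson inj_on_subset)
  also have "\<dots> = card B - card A"
    using AB(1,2) finite_subset by (intro card_Diff_subset) auto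
  finally show "vs1.dim V = vs1.dim {x \<in> V. f x = 0} + vs2.dim (f ` V)"
    using AB(1,2,6,7) card_mono[OF AB(2,1)] by simp
qed

lemma dim_inj_image:
  assumes "vector_space s" "vector_space t" "lin_on s t V f" "fin_dim_subspace s V" "inj_on f V"
  shows "vector_space.dim t (f ` V) = vector_space.dim s V"
proof -
  interpret s: vector_space s by fact
  have V: "s.subspace V" using s.fin_dim_subspaceD[OF assms(4)] .
  have "f 0 = 0" using s.lin_on_zero[OF assms(3) V] .
  then have "{x \<in> V. f x = 0} = {0}"
    using inj_on_eq_iff[OF assms(5) _ s.subspace_0[OF V]] s.subspace_0[OF V] by auto
  then show ?thesis using rank_nullity(2)[OF assms(1-4)] by simp
qed

text \<open>The map \<open>p\<close> is a model of the quotient map \<open>V \<rightarrow> V / W\<close>.\<close>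

lemma (in vector_space) projection_exists:
  assumes V: "fin_dim_subspace scale V" and W: "subspace W" "W \<subseteq> V"
  obtains p where "lin_on scale scale V p" "\<And>x. x \<in> V \<Longrightarrow> p x \<in> V" "\<And>x. x \<in> V \<Longrightarrow> x - p x \<in> W"
    "\<And>x. x \<in> V \<Longrightarrow> p x = 0 \<longleftrightarrow> x \<in> W" "\<And>x. x \<in> V \<Longrightarrow> p (p x) = p x"
proof -
  obtain A B where AB: "A \<subseteq> B" "finite B" "independent B" "span B = V" "span A = W"
    using basis_extension[OF V W] by metis
  interpret vector_space_pair scale scale by unfold_locales
  define p where "p = construct B (\<lambda>b. if b \<in> A then 0 else b)"
  have lp: "Vector_Spaces.linear scale scale p" unfolding p_def by (rule linear_construct[OF AB(3)])
  interpret p: Vector_Spaces.linear scale scale p by fact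
  have pb: "p b = (if b \<in> A then 0 else b)" if "b \<in> B" for b
    unfolding p_def using construct_basis[OF AB(3) that] .
  have pV: "p x \<in> span (B - A) \<and> x - p x \<in> W" if "x \<in> V" for x
    using that unfolding AB(4)[symmetric]
  proof (induction x rule: span_induct)
    case base
    show ?case
      by (rule subspaceI)
        (auto simp: p.add p.scale p.zero AB(5)[symmetric] add_diff_add scale_right_diff_distrib[symmetric]
          intro: span_zero span_add span_scale)
  next
    case (step x)
    then show ?case using pb[of x] AB(5) span_base[of x A] span_base[of x "B - A"]
      by (auto simp: span_zero subspace_0[OF W(1)])
  qed
  have pW: "p x = 0" if "x \<in> W" for x
    using that unfolding AB(5)[symmetric]
    by (rule p.eq_0_on_span[rotated]) (use pb AB(1) in auto)
  have BV: "span (B - A) \<subseteq> V" using span_mono[of "B - A" B] AB(4) by auto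
  have sV: "subspace V" using fin_dim_subspaceD[OF V] .
  have pi: "p x = 0 \<longleftrightarrow> x \<in> W" if "x \<in> V" for x
    using pW pV[OF that] by auto
  show ?thesis
  proof
    show "lin_on scale scale V p" by (simp add: lin_on_def p.add p.scale)
    show "p x \<in> V" "x - p x \<in> W" "p x = 0 \<longleftrightarrow> x \<in> W" if "x \<in> V" for x
      using that pV BV pi by auto
    show "p (p x) = p x" if "x \<in> V" for x
      using pW[of "x - p x"] pV[OF that] by (simp add: p.diff)
  qed
qed

text \<open>Compare ranks of the projection p with kernel W: on U + W it has kernel W, on U it has
  kernel U \<inter> W, and the two images agree.\<close>

lemma (in vector_space) dim_sum_Int:
  assumes V: "fin_dim_subspace scale V" and U: "subspace U" "U \<subseteq> V" and W: "subspace W" "W \<subseteq> V"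
  shows "dim {x + y |x y. x \<in> U \<and> y \<in> W} + dim (U \<inter> W) = dim U + dim W"
proof -
  let ?S = "{x + y |x y. x \<in> U \<and> y \<in> W}"
  have S: "subspace ?S" using subspace_sums U W by blast
  have SV: "?S \<subseteq> V" using U(2) W(2) subspace_add[OF fin_dim_subspaceD[OF V]] by blast
  have fS: "fin_dim_subspace scale ?S" "fin_dim_subspace scale U"
    using fin_dim_subset[OF V] S SV U by auto
  obtain p where p: "lin_on scale scale V p" "\<And>x. x \<in> V \<Longrightarrow> p x = 0 \<longleftrightarrow> x \<in> W"
    using projection_exists[OF V W] by metis
  have WS: "W \<subseteq> ?S" using subspace_0[OF U(1)] by force
  have US: "U \<subseteq> ?S" using subspace_0[OF W(1)] by force
  have "p ` ?S = p ` U"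
  proof
    show "p ` U \<subseteq> p ` ?S" using US by blast
    show "p ` ?S \<subseteq> p ` U"
    proof safe
      fix x y assume "x \<in> U" "y \<in> W"
      then have "p (x + y) = p x" using lin_on_add[OF p(1), of x y] p(2)[of y] U(2) W(2) by auto
      then show "p (x + y) \<in> p ` U" using \<open>x \<in> U\<close> by auto
    qed
  qed
  moreover have "{x \<in> ?S. p x = 0} = W" using p(2) SV WS by blast
  moreover have "{x \<in> U. p x = 0} = U \<inter> W" using p(2) U(2) by blast
  ultimately show ?thesis
    using rank_nullity(2)[OF vector_space_axioms vector_space_axioms lin_on_mono[OF p(1) SV] fS(1)]
      rank_nullity(2)[OF vector_space_axioms vector_space_axioms lin_on_mono[OF p(1) U(2)] fS(2)]
    by simp
qed

text \<open>Rank-nullity for the induced map V -> W / W0, with dim W0 added to both sides so that no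
  quotient appears. In \<open>ev_additive\<close>, W0 is a space of ghosts.\<close>

lemma relative_rank_nullity:
  assumes s: "vector_space s" and t: "vector_space t" and f: "lin_on s t V f"
    and V: "fin_dim_subspace s V" and W: "fin_dim_subspace t W"
    and fV: "f ` V \<subseteq> W" and W0: "module.subspace t W0" "W0 \<subseteq> W"
  shows "vector_space.dim s V + vector_space.dim t W0 =
    vector_space.dim s {x \<in> V. f x \<in> W0} + vector_space.dim t {x + y |x y. x \<in> f ` V \<and> y \<in> W0}"
proof -
  interpret s: vector_space s by fact
  interpret t: vector_space t by fact
  have sV: "s.subspace V" using s.fin_dim_subspaceD[OF V] .
  let ?K = "{x \<in> V. f x \<in> W0}"
  have K: "s.subspace ?K" using subspace_preimage_on[OF s f sV t W0(1)] .
  have fK: "fin_dim_subspace s ?K" using s.fin_dim_subset[OF V K] by auto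
  have I: "f ` ?K = f ` V \<inter> W0" by auto
  have K0: "{x \<in> ?K. f x = 0} = {x \<in> V. f x = 0}" using t.subspace_0[OF W0(1)] by auto
  have "t.subspace (f ` V)" using subspace_image_on[OF s f sV t] .
  from t.dim_sum_Int[OF W this fV W0] rank_nullity(2)[OF s t f V]
    rank_nullity(2)[OF s t lin_on_mono[OF f] fK]
  show ?thesis unfolding I K0 by auto
qed

text \<open>Functionals on \<open>V\<close> vanishing on \<open>W\<close> correspond to arbitrary values on the vectors that complete
  a basis of \<open>W\<close> to one of \<open>V\<close>.\<close>

lemma dim_annihilator:
  fixes s :: "'k::field \<Rightarrow> 'v::ab_group_add \<Rightarrow> 'v"
  assumes s: "vector_space s" and V: "fin_dim_subspace s V" and W: "module.subspace s W" "W \<subseteq> V"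
  shows "vector_space (\<lambda>c (f :: 'v \<Rightarrow> 'k) x. c * f x)"
    and "fin_dim_subspace (\<lambda>c f x. c * f x) {f \<in> linear_maps s (*) V UNIV. \<forall>x\<in>W. f x = 0}"
    and "vector_space.dim (\<lambda>c f x. c * f x) {f \<in> linear_maps s (*) V UNIV. \<forall>x\<in>W. f x = 0}
      + vector_space.dim s W = vector_space.dim s V"
proof -
  let ?sc = "\<lambda>c (f :: 'v \<Rightarrow> 'k) x. c * f x"
  let ?A = "{f \<in> linear_maps s (*) V UNIV. \<forall>x\<in>W. f x = 0}"
  show vs: "vector_space ?sc"
    by unfold_locales (auto simp: fun_eq_iff algebra_simps)
  interpret s: vector_space s by fact
  interpret F: vector_space ?sc by fact
  have k: "vector_space ((*) :: 'k \<Rightarrow> 'k \<Rightarrow> 'k)"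
    by unfold_locales (auto simp: algebra_simps)
  interpret sk: vector_space_pair s "(*) :: 'k \<Rightarrow> 'k \<Rightarrow> 'k"
    using s k by (simp add: vector_space_pair_def)
  obtain A B where AB: "A \<subseteq> B" "finite B" "s.independent B" "s.span B = V" "s.span A = W"
    "card A = s.dim W" "card B = s.dim V"
    using s.basis_extension[OF V W] by metis
  have sV: "s.subspace V" using s.fin_dim_subspaceD[OF V] .
  \<comment> \<open>The coordinate functionals of B; those belonging to B - A vanish on W and form a
    basis of the annihilator.\<close>
  define e :: "'v \<Rightarrow> 'v \<Rightarrow> 'k" where "e b = (\<lambda>x. if x \<in> V then s.representation B x b else 0)" for b
  have zero_eq: "g x = 0" if g: "g \<in> ?A" "\<And>b. b \<in> B - A \<Longrightarrow> g b = 0" for g x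
  proof (cases "x \<in> V")
    case True
    have "s.subspace {x \<in> V. g x = 0}"
    proof (rule subspace_kernel_on[OF s _ sV k])
      show "lin_on s (*) V g" using g(1) by (auto simp: linear_maps_def lin_on_def)
    qed
    moreover have "B \<subseteq> {x \<in> V. g x = 0}"
      using g AB(4,5) s.span_base[of _ B] s.span_base[of _ A] by auto
    ultimately show ?thesis using s.span_minimal[of B "{x \<in> V. g x = 0}"] AB(4) True by auto
  next
    case False
    then show ?thesis using g by (simp add: linear_maps_def)
  qed
  have rep0: "s.representation B x b = 0" if "x \<in> W" "b \<in> B - A" for x b
  proof -
    have "s.representation B x = s.representation A x"
      using s.representation_extend[OF AB(3) _ AB(1)] that(1) AB(5) by auto
    then show ?thesis using s.representation_ne_zero[of A x b] that by auto
  qed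
  have eA: "e b \<in> ?A" if "b \<in> B - A" for b
    using that rep0 W(2) AB(3,4)
    by (auto simp: linear_maps_def e_def s.representation_add s.representation_scale
        s.subspace_add[OF sV] s.subspace_scale[OF sV])
  have eb: "e b b' = (if b' = b then 1 else 0)" if "b \<in> B" "b' \<in> B" for b b'
    using that AB(3,4) s.span_base[of b' B] by (auto simp: e_def s.representation_basis)
  have subA: "F.subspace ?A"
  proof (rule F.subspaceI)
    show "0 \<in> ?A" by (simp add: linear_maps_def)
    show "f + g \<in> ?A" if "f \<in> ?A" "g \<in> ?A" for f g
      using that by (simp add: linear_maps_def distrib_left add_ac)
    show "?sc c f \<in> ?A" if "f \<in> ?A" for c f
      using that by (simp add: linear_maps_def distrib_left mult.left_commute)
  qed
  have inj: "inj_on e (B - A)"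
    by (rule inj_onI) (metis DiffD1 eb zero_neq_one)
  have ind: "F.independent (e ` (B - A))"
  proof (rule F.independent_if_scalars_zero)
    show "finite (e ` (B - A))" using AB(2) by auto
    fix u x assume sum0: "(\<Sum>x\<in>e ` (B - A). ?sc (u x) x) = 0" and x: "x \<in> e ` (B - A)"
    then obtain b where b: "b \<in> B - A" "x = e b" by auto
    have sum_ap: "(\<Sum>i\<in>I. h i) y = (\<Sum>i\<in>I. h i y)" for I and h :: "'v \<Rightarrow> 'v \<Rightarrow> 'k" and y
      by (induction I rule: infinite_finite_induct) auto
    have "(\<Sum>x\<in>e ` (B - A). ?sc (u x) x) = (\<Sum>c\<in>B - A. ?sc (u (e c)) (e c))"
      using inj by (simp add: sum.reindex)
    then have "0 = (\<Sum>c\<in>B - A. u (e c) * e c b)"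
      using sum0 sum_ap[of "\<lambda>c. ?sc (u (e c)) (e c)" "B - A" b] by (simp add: fun_eq_iff)
    also have "\<dots> = (\<Sum>c\<in>B - A. if c = b then u (e c) else 0)"
      using b by (intro sum.cong) (auto simp: eb)
    also have "\<dots> = u (e b)" using b AB(2) by simp
    finally show "u x = 0" using b by simp
  qed
  have span: "?A \<subseteq> F.span (e ` (B - A))"
  proof
    fix g assume g: "g \<in> ?A"
    have sum_ap: "(\<Sum>i\<in>I. h i) y = (\<Sum>i\<in>I. h i y)" for I and h :: "'v \<Rightarrow> 'v \<Rightarrow> 'k" and y
      by (induction I rule: infinite_finite_induct) auto
    let ?g = "\<Sum>c\<in>B - A. ?sc (g c) (e c)"
    have sp: "?g \<in> F.span (e ` (B - A))"
      by (intro F.span_sum F.span_scale F.span_base) auto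
    have gA: "?g \<in> ?A"
      using eA by (intro F.subspace_sum[OF subA] F.subspace_scale[OF subA]) auto
    have "g - ?g \<in> ?A" using F.subspace_diff[OF subA g gA] .
    moreover have "(g - ?g) b = 0" if b: "b \<in> B - A" for b
    proof -
      have "?g b = (\<Sum>c\<in>B - A. if c = b then g c else 0)"
        unfolding sum_ap using b by (intro sum.cong) (auto simp: eb)
      then show ?thesis using b AB(2) by simp
    qed
    ultimately have "(g - ?g) x = 0" for x
      using zero_eq[of "g - ?g" x] by blast
    then have "g - ?g = 0" by (intro ext) (simp only: zero_fun_apply)
    then have "g = ?g" by (simp only: right_minus_eq)
    then show "g \<in> F.span (e ` (B - A))" using sp by simp
  qed
  show "fin_dim_subspace ?sc ?A"
    using F.fin_dim_subspaceI[OF subA _ span] AB(2) by blast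
  have "F.dim ?A = card (e ` (B - A))"
    using F.basis_card_eq_dim[OF image_subsetI[OF eA] span ind] by simp
  also have "\<dots> = card B - card A"
    using card_image[OF inj] card_Diff_subset[of A B] AB(1,2) finite_subset by metis
  finally show "F.dim ?A + s.dim W = s.dim V"
    using AB(1,2,6,7) card_mono[OF AB(2,1)] by simp
qed

section \<open>Triangulated categories\<close>

sublocale linear_category \<subseteq> hom: vector_space "smul C"
  by (rule ambient_vector_space)

context linear_category
begin

lemma Hom_0 [simp]: "0 \<in> Hom C X Y"
  and Hom_add: "f \<in> Hom C X Y \<Longrightarrow> g \<in> Hom C X Y \<Longrightarrow> f + g \<in> Hom C X Y"
  and Hom_minus: "f \<in> Hom C X Y \<Longrightarrow> - f \<in> Hom C X Y"
  and Hom_diff: "f \<in> Hom C X Y \<Longrightarrow> g \<in> Hom C X Y \<Longrightarrow> f - g \<in> Hom C X Y"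
  and Hom_smul: "f \<in> Hom C X Y \<Longrightarrow> smul C c f \<in> Hom C X Y"
  and Hom_sum: "(\<And>i. i \<in> I \<Longrightarrow> h i \<in> Hom C X Y) \<Longrightarrow> (\<Sum>i\<in>I. h i) \<in> Hom C X Y"
  using Hom_subspace[of X Y]
  by (auto simp: hom.subspace_0 hom.subspace_add hom.subspace_neg hom.subspace_diff
      hom.subspace_scale hom.subspace_sum)

lemma Hom_minus_iff [simp]: "- f \<in> Hom C X Y \<longleftrightarrow> f \<in> Hom C X Y"
  using Hom_minus[of f] Hom_minus[of "- f"] by auto

lemma lin_on_post: "g \<in> Hom C Y Z \<Longrightarrow> lin_on (smul C) (smul C) (Hom C X Y) (\<lambda>f. g \<cdot> f)"
  by (auto intro!: lin_onI simp: Cmp_add_right Cmp_smul_right)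

lemma lin_on_pre: "f \<in> Hom C X Y \<Longrightarrow> lin_on (smul C) (smul C) (Hom C Y Z) (\<lambda>g. g \<cdot> f)"
  by (auto intro!: lin_onI simp: Cmp_add_left Cmp_smul_left)

lemma Cmp_0_right: "g \<in> Hom C Y Z \<Longrightarrow> g \<cdot> 0 = 0"
  using hom.lin_on_zero[OF lin_on_post Hom_subspace] by blast

lemma Cmp_0_left: "f \<in> Hom C X Y \<Longrightarrow> 0 \<cdot> f = 0"
  using hom.lin_on_zero[OF lin_on_pre Hom_subspace] by blast

lemma Cmp_minus_right: "f \<in> Hom C X Y \<Longrightarrow> g \<in> Hom C Y Z \<Longrightarrow> g \<cdot> (- f) = - (g \<cdot> f)"
  by (rule hom.lin_on_minus[OF lin_on_post Hom_subspace])

lemma Cmp_minus_left: "f \<in> Hom C X Y \<Longrightarrow> g \<in> Hom C Y Z \<Longrightarrow> (- g) \<cdot> f = - (g \<cdot> f)"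
  by (rule hom.lin_on_minus[OF lin_on_pre Hom_subspace])

lemma Cmp_diff_right:
  "f \<in> Hom C X Y \<Longrightarrow> f' \<in> Hom C X Y \<Longrightarrow> g \<in> Hom C Y Z \<Longrightarrow> g \<cdot> (f - f') = g \<cdot> f - g \<cdot> f'"
  by (rule hom.lin_on_diff[OF lin_on_post Hom_subspace])

lemma Cmp_diff_left:
  "f \<in> Hom C X Y \<Longrightarrow> g \<in> Hom C Y Z \<Longrightarrow> g' \<in> Hom C Y Z \<Longrightarrow> (g - g') \<cdot> f = g \<cdot> f - g' \<cdot> f"
  by (rule hom.lin_on_diff[OF lin_on_pre Hom_subspace])

lemma Cmp_sum_right:
  "g \<in> Hom C Y Z \<Longrightarrow> (\<And>i. i \<in> I \<Longrightarrow> h i \<in> Hom C X Y) \<Longrightarrow> g \<cdot> (\<Sum>i\<in>I. h i) = (\<Sum>i\<in>I. g \<cdot> h i)"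
  by (rule hom.lin_on_sum[OF lin_on_post Hom_subspace])

lemma Cmp_sum_left:
  "f \<in> Hom C X Y \<Longrightarrow> (\<And>i. i \<in> I \<Longrightarrow> h i \<in> Hom C Y Z) \<Longrightarrow> (\<Sum>i\<in>I. h i) \<cdot> f = (\<Sum>i\<in>I. h i \<cdot> f)"
  by (rule hom.lin_on_sum[OF lin_on_pre Hom_subspace])

lemma is_zero_iff_Id: "is_zero C X \<longleftrightarrow> Id C X = 0"
proof
  assume "is_zero C X"
  then show "Id C X = 0" using Id_in_Hom[of X] by (auto simp: is_zero_def)
next
  assume I: "Id C X = 0"
  have "f = 0" if "f \<in> Hom C X Y" for f Y
    using Cmp_Id_right[OF that] Cmp_0_right[OF that] I by simp
  moreover have "f = 0" if "f \<in> Hom C Y X" for f Y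
    using Cmp_Id_left[OF that] Cmp_0_left[OF that] I by simp
  ultimately show "is_zero C X"
    unfolding is_zero_def using Hom_0 by blast
qed

lemma Hom_zero_target: "is_zero C X \<Longrightarrow> f \<in> Hom C Y X \<Longrightarrow> f = 0"
  by (auto simp: is_zero_def)

lemma is_isoE:
  assumes "is_iso C X Y f"
  obtains g where "f \<in> Hom C X Y" "g \<in> Hom C Y X" "g \<cdot> f = Id C X" "f \<cdot> g = Id C Y"
    "is_iso C Y X g"
  using assms by (auto simp: is_iso_def)

lemma is_iso_Id: "is_iso C X X (Id C X)"
  using Id_in_Hom Cmp_Id_left by (auto simp: is_iso_def)

lemma is_biproductE:
  assumes "is_biproduct C X Y Z"
  obtains i j p q where "i \<in> Hom C X Z" "j \<in> Hom C Y Z" "p \<in> Hom C Z X" "q \<in> Hom C Z Y"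
    "p \<cdot> i = Id C X" "q \<cdot> j = Id C Y" "q \<cdot> i = 0" "p \<cdot> j = 0" "i \<cdot> p + j \<cdot> q = Id C Z"
  using assms by (auto simp: is_biproduct_def)

lemma is_biproductI:
  assumes "i \<in> Hom C X Z" "j \<in> Hom C Y Z" "p \<in> Hom C Z X" "q \<in> Hom C Z Y"
    "p \<cdot> i = Id C X" "q \<cdot> j = Id C Y" "q \<cdot> i = 0" "p \<cdot> j = 0" "i \<cdot> p + j \<cdot> q = Id C Z"
  shows "is_biproduct C X Y Z"
  using assms by (auto simp: is_biproduct_def)

lemma is_biproduct_iso:
  assumes "is_biproduct C X Y Z" "is_iso C Z Z' f"
  shows "is_biproduct C X Y Z'"
proof -
  obtain i j p q where ij: "i \<in> Hom C X Z" "j \<in> Hom C Y Z" "p \<in> Hom C Z X" "q \<in> Hom C Z Y"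
    "p \<cdot> i = Id C X" "q \<cdot> j = Id C Y" "q \<cdot> i = 0" "p \<cdot> j = 0" "i \<cdot> p + j \<cdot> q = Id C Z"
    by (rule is_biproductE[OF assms(1)])
  obtain g where fg: "f \<in> Hom C Z Z'" "g \<in> Hom C Z' Z" "g \<cdot> f = Id C Z" "f \<cdot> g = Id C Z'"
    by (rule is_isoE[OF assms(2)])
  have c: "(a \<cdot> g) \<cdot> (f \<cdot> b) = a \<cdot> b" if "a \<in> Hom C Z A" "b \<in> Hom C B Z" for a b A B
  proof -
    have "(a \<cdot> g) \<cdot> (f \<cdot> b) = a \<cdot> (g \<cdot> (f \<cdot> b))"
      using Cmp_assoc[OF Cmp_in_Hom[OF that(2) fg(1)] fg(2) that(1)] by simp
    also have "g \<cdot> (f \<cdot> b) = b"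
      using Cmp_assoc[OF that(2) fg(1,2)] fg(3) Cmp_Id_left[OF that(2)] by simp
    finally show ?thesis .
  qed
  have d: "(f \<cdot> b) \<cdot> (a \<cdot> g) = f \<cdot> ((b \<cdot> a) \<cdot> g)" if "a \<in> Hom C Z A" "b \<in> Hom C A Z" for a b A
    using Cmp_assoc[OF Cmp_in_Hom[OF fg(2) that(1)] that(2) fg(1)] Cmp_assoc[OF fg(2) that] by simp
  have "f \<cdot> ((i \<cdot> p) \<cdot> g) + f \<cdot> ((j \<cdot> q) \<cdot> g) = f \<cdot> ((i \<cdot> p) \<cdot> g + (j \<cdot> q) \<cdot> g)"
    using ij fg by (intro Cmp_add_right[symmetric] Cmp_in_Hom)
  also have "\<dots> = f \<cdot> ((i \<cdot> p + j \<cdot> q) \<cdot> g)"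
    using Cmp_add_left[OF fg(2) Cmp_in_Hom[OF ij(3,1)] Cmp_in_Hom[OF ij(4,2)]] by simp
  also have "\<dots> = Id C Z'" using ij(9) Cmp_Id_left[OF fg(2)] fg(4) by simp
  finally show ?thesis
    using ij fg c d
    by (intro is_biproductI[of "f \<cdot> i" _ _ "f \<cdot> j" _ "p \<cdot> g" "q \<cdot> g"]) (auto intro: Cmp_in_Hom)
qed

end

section \<open>Direct sums and direct powers\<close>

context additive_linear_category
begin

text \<open>An isomorphism is viewed as a direct sum with a zero object, so invariance under
  isomorphism becomes a special case of additivity on biproducts, as in
  \<open>ev_iso\<close>.\<close>

lemma is_biproduct_zero:
  assumes O: "is_zero C O'" and "is_iso C X Y f"
  shows "is_biproduct C X O' Y"
proof -
  obtain g where f: "f \<in> Hom C X Y" "g \<in> Hom C Y X" "g \<cdot> f = Id C X" "f \<cdot> g = Id C Y"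
    using assms(2) by (rule is_isoE)
  have "0 \<cdot> 0 = Id C O'" "0 \<cdot> f = 0" "g \<cdot> 0 = 0" "f \<cdot> g + 0 \<cdot> 0 = Id C Y"
    using O f(4) Cmp_0_left[OF f(1)] Cmp_0_right[OF f(2)] Cmp_0_right[OF Hom_0]
    by (simp_all add: is_zero_iff_Id)
  then show ?thesis
    using f by (intro is_biproductI[OF f(1) Hom_0 f(2) Hom_0])
qed

lemma direct_power_exists: "\<exists>W. is_direct_sum C {..<n::nat} (\<lambda>_. X) W"
proof (induction n)
  case 0
  obtain O' where "is_zero C O'" using zero_object by blast
  then show ?case by (auto simp: is_direct_sum_def is_zero_iff_Id)
next
  case (Suc n)
  then obtain W where "is_direct_sum C {..<n} (\<lambda>_. X) W" by blast
  then obtain i p where Wi: "\<forall>a\<in>{..<n}. i a \<in> Hom C X W \<and> p a \<in> Hom C W X"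
    "\<forall>a\<in>{..<n}. \<forall>b\<in>{..<n}. p a \<cdot> i b = (if a = b then Id C X else 0)"
    and Ws: "(\<Sum>a<n. i a \<cdot> p a) = Id C W"
    unfolding is_direct_sum_def by blast
  have W: "a < n \<Longrightarrow> i a \<in> Hom C X W \<and> p a \<in> Hom C W X"
    "a < n \<Longrightarrow> b < n \<Longrightarrow> p a \<cdot> i b = (if a = b then Id C X else 0)" for a b
    using Wi by auto
  obtain Z where "is_biproduct C W X Z" using biproducts by blast
  then obtain k j r q where Z: "k \<in> Hom C W Z" "j \<in> Hom C X Z" "r \<in> Hom C Z W" "q \<in> Hom C Z X"
    "r \<cdot> k = Id C W" "q \<cdot> j = Id C X" "q \<cdot> k = 0" "r \<cdot> j = 0" "k \<cdot> r + j \<cdot> q = Id C Z"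
    by (rule is_biproductE)
  let ?i = "\<lambda>a. if a < n then k \<cdot> i a else j" and ?p = "\<lambda>a. if a < n then p a \<cdot> r else q"
  have ip: "?i a \<in> Hom C X Z" "?p a \<in> Hom C Z X" for a
    using W(1)[of a] Z(2,4) Cmp_in_Hom[OF _ Z(1), of "i a" X] Cmp_in_Hom[OF Z(3), of "p a" X] by auto
  have 1: "(p a \<cdot> r) \<cdot> (k \<cdot> i b) = p a \<cdot> i b" if "a < n" "b < n" for a b
  proof -
    have "(p a \<cdot> r) \<cdot> (k \<cdot> i b) = p a \<cdot> (r \<cdot> (k \<cdot> i b))"
      using Cmp_assoc[OF Cmp_in_Hom[OF _ Z(1)] Z(3)] W(1)[of a] W(1)[of b] that by metis
    also have "r \<cdot> (k \<cdot> i b) = i b"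
      using that W(1)[of b] Z(5) Cmp_assoc[OF _ Z(1,3), of "i b" X] Cmp_Id_left[of "i b" X W] by simp
    finally show ?thesis .
  qed
  have 2: "(p a \<cdot> r) \<cdot> j = 0" if "a < n" for a
    using that W(1)[of a] Z(8) Cmp_assoc[OF Z(2,3), of "p a" X] Cmp_0_right[of "p a" W X] by simp
  have 3: "q \<cdot> (k \<cdot> i b) = 0" if "b < n" for b
    using that W(1)[of b] Z(7) Cmp_assoc[OF _ Z(1,4), of "i b" X] Cmp_0_left[of "i b" X W] by simp
  have orth: "?p a \<cdot> ?i b = (if a = b then Id C X else 0)" if "a < Suc n" "b < Suc n" for a b
    using that W(2) 1 2 3 Z(6) by (auto simp: less_Suc_eq)
  have "(\<Sum>a<n. (k \<cdot> i a) \<cdot> (p a \<cdot> r)) = (\<Sum>a<n. k \<cdot> ((i a \<cdot> p a) \<cdot> r))"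
  proof (rule sum.cong)
    fix a assume "a \<in> {..<n}"
    then have ia: "i a \<in> Hom C X W" "p a \<in> Hom C W X" using W by auto
    show "(k \<cdot> i a) \<cdot> (p a \<cdot> r) = k \<cdot> ((i a \<cdot> p a) \<cdot> r)"
      using Cmp_assoc[OF Cmp_in_Hom[OF Z(3) ia(2)] ia(1) Z(1)] Cmp_assoc[OF Z(3) ia(2,1)] by simp
  qed simp
  also have "\<dots> = k \<cdot> (\<Sum>a<n. (i a \<cdot> p a) \<cdot> r)"
    using W(1) Z by (intro Cmp_sum_right[symmetric]) (auto intro!: Cmp_in_Hom)
  also have "(\<Sum>a<n. (i a \<cdot> p a) \<cdot> r) = (\<Sum>a<n. i a \<cdot> p a) \<cdot> r"
    using W(1) Z by (intro Cmp_sum_left[symmetric]) (auto intro!: Cmp_in_Hom)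
  finally have "(\<Sum>a<n. (k \<cdot> i a) \<cdot> (p a \<cdot> r)) = k \<cdot> r"
    using Ws Cmp_Id_left[OF Z(3)] by simp
  then have "(\<Sum>a<Suc n. ?i a \<cdot> ?p a) = Id C Z"
    using Z(9) by simp
  then show ?case
    using ip orth unfolding is_direct_sum_def
    by (intro exI[of _ Z] conjI exI[of _ ?i] exI[of _ ?p]) auto
qed

end

section \<open>Long exact sequences, splitting and rotation of triangles\<close>

context triangulated_category
begin

lemma lin_on_suspm: "lin_on (smul C) (smul C) (Hom C X Y) (suspm C)"
  by (auto intro!: lin_onI simp: suspm_add suspm_smul)

lemma suspm_0: "suspm C 0 = 0"
  using hom.lin_on_zero[OF lin_on_suspm Hom_subspace] .

lemma suspm_minus: "f \<in> Hom C X Y \<Longrightarrow> suspm C (- f) = - suspm C f"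
  by (rule hom.lin_on_minus[OF lin_on_suspm Hom_subspace])

lemma suspm_inj: "f \<in> Hom C X Y \<Longrightarrow> g \<in> Hom C X Y \<Longrightarrow> suspm C f = suspm C g \<Longrightarrow> f = g"
  using susp_fully_faithful[of X Y] by (auto simp: bij_betw_def inj_on_def)

lemma suspm_eq_0: "f \<in> Hom C X Y \<Longrightarrow> suspm C f = 0 \<longleftrightarrow> f = 0"
  using suspm_inj[of f X Y 0] suspm_0 by auto

lemma suspm_fullE:
  assumes "g \<in> Hom C (susp C X) (susp C Y)"
  obtains f where "f \<in> Hom C X Y" "g = suspm C f"
  using assms susp_fully_faithful[of X Y] by (auto simp: bij_betw_def)

lemma is_zero_susp: "is_zero C X \<Longrightarrow> is_zero C (susp C X)"
  using suspm_Id[of X] suspm_0 by (simp add: is_zero_iff_Id)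

lemma ess_surjE:
  obtains X f g where "f \<in> Hom C (susp C X) Y" "g \<in> Hom C Y (susp C X)"
    "g \<cdot> f = Id C (susp C X)" "f \<cdot> g = Id C Y"
  using susp_ess_surj[of Y] by (auto simp: isomorphic_def is_iso_def)

lemma Tri_rot: "Tri C X Y Z u v w \<Longrightarrow> Tri C Y Z (susp C X) v w (- suspm C u)"
  using Tri_rotate Tri_in_Hom by blast

lemma Tri_rot2: "Tri C X Y Z u v w \<Longrightarrow> Tri C Z (susp C X) (susp C Y) w (- suspm C u) (- suspm C v)"
  using Tri_rot Tri_rot by blast

text \<open>The square with sides Id and u extends to a morphism from the triangle X -> X -> 0 to
  the given one, and its third component shows that \<open>v \<cdot> u\<close> passes through
  0.\<close>

lemma Tri_comp_uv:
  assumes T: "Tri C X Y Z u v w"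
  shows "v \<cdot> u = 0"
proof -
  obtain O' where O: "is_zero C O'" using zero_object by blast
  have u: "u \<in> Hom C X Y" using Tri_in_Hom[OF T] by simp
  obtain c where "c \<in> Hom C O' Z" "c \<cdot> 0 = v \<cdot> u"
    using Tri_morphism[OF Tri_Id[OF O] T Id_in_Hom u] by auto
  then show ?thesis using Cmp_0_right by metis
qed

lemma Tri_comp_vw: "Tri C X Y Z u v w \<Longrightarrow> w \<cdot> v = 0"
  using Tri_comp_uv[OF Tri_rot] .

lemma Tri_comp_wu:
  assumes "Tri C X Y Z u v w"
  shows "suspm C u \<cdot> w = 0"
proof -
  have h: "u \<in> Hom C X Y" "w \<in> Hom C Z (susp C X)" using Tri_in_Hom[OF assms] by auto
  then have "- suspm C u \<cdot> w = - (suspm C u \<cdot> w)"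
    by (intro Cmp_minus_left[OF h(2) suspm_in_Hom[OF h(1)]])
  then show ?thesis using Tri_comp_uv[OF Tri_rot2[OF assms]] by simp
qed

text \<open>The axiom on morphisms of triangles only supplies a third component. To obtain a map
  into the first vertex, A -> 0 -> \<Sigma>A is mapped to the rotated triangle and the resulting
  \<Sigma>A -> \<Sigma>X is desuspended; the signs of the two rotations cancel.\<close>

lemma Tri_lift_u:
  assumes T: "Tri C X Y Z u v w" and f: "f \<in> Hom C A Y" "v \<cdot> f = 0"
  obtains g where "g \<in> Hom C A X" "f = u \<cdot> g"
proof -
  obtain O' where O: "is_zero C O'" using zero_object by blast
  have u: "u \<in> Hom C X Y" using Tri_in_Hom[OF T] by simp
  have TA: "Tri C A O' (susp C A) 0 0 (- Id C (susp C A))"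
    using Tri_rot[OF Tri_Id[OF O, of A]] suspm_Id by simp
  obtain c where c: "c \<in> Hom C (susp C A) (susp C X)"
    "suspm C f \<cdot> (- Id C (susp C A)) = (- suspm C u) \<cdot> c"
    using Tri_morphism[OF TA Tri_rot[OF T] f(1) Hom_0] f(2) Cmp_0_right[OF Hom_0] by auto
  obtain g where g: "g \<in> Hom C A X" "c = suspm C g" using c(1) by (rule suspm_fullE)
  have "- suspm C f = - (suspm C u \<cdot> suspm C g)"
    using c(2) g suspm_in_Hom[OF f(1)] suspm_in_Hom[OF u] suspm_in_Hom[OF g(1)]
    by (simp add: Cmp_minus_right[OF Id_in_Hom] Cmp_Id_right Cmp_minus_left)
  then have "suspm C f = suspm C (u \<cdot> g)" using suspm_Cmp[OF g(1) u] by simp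
  then have "f = u \<cdot> g" using suspm_inj[OF f(1) Cmp_in_Hom[OF g(1) u]] by simp
  then show ?thesis using that g(1) by blast
qed

lemma Tri_lift_v:
  assumes "Tri C X Y Z u v w" "f \<in> Hom C A Z" "w \<cdot> f = 0"
  obtains g where "g \<in> Hom C A Y" "f = v \<cdot> g"
  using Tri_lift_u[OF Tri_rot[OF assms(1)] assms(2,3)] .

lemma Tri_lift_w:
  assumes T: "Tri C X Y Z u v w" and f: "f \<in> Hom C A (susp C X)" "suspm C u \<cdot> f = 0"
  obtains g where "g \<in> Hom C A Z" "f = w \<cdot> g"
proof -
  have "u \<in> Hom C X Y" using Tri_in_Hom[OF T] by simp
  then have "(- suspm C u) \<cdot> f = 0"
    using Cmp_minus_left[OF f(1) suspm_in_Hom] f(2) by simp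
  then show ?thesis using Tri_lift_u[OF Tri_rot2[OF T] f(1)] that by blast
qed

text \<open>Dual to \<open>Tri_lift_u\<close>, with 0 -> A -> A as the second triangle.\<close>

lemma Tri_factor_v:
  assumes T: "Tri C X Y Z u v w" and f: "f \<in> Hom C Y A" "f \<cdot> u = 0"
  obtains g where "g \<in> Hom C Z A" "f = g \<cdot> v"
proof -
  obtain O' where O: "is_zero C O'" using zero_object by blast
  \<comment> \<open>The zero object is taken in the form \<Sigma>O' so that this triangle is a
    rotation of one that starts at O'.\<close>
  have "Tri C A A (susp C O') (Id C A) 0 0"
    by (rule Tri_Id) (rule is_zero_susp[OF O])
  then have TA: "Tri C O' A A 0 (Id C A) 0"
    using Tri_rotate[OF Hom_0 Id_in_Hom Hom_0, of O' A] suspm_0 by simp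
  obtain c where c: "c \<in> Hom C Z A" "c \<cdot> v = Id C A \<cdot> f"
    using Tri_morphism[OF T TA Hom_0 f(1)] f(2) Cmp_0_right[OF Hom_0] by auto
  then show ?thesis using that Cmp_Id_left[OF f(1)] by simp
qed

lemma Tri_factor_w:
  assumes "Tri C X Y Z u v w" "f \<in> Hom C Z A" "f \<cdot> v = 0"
  obtains g where "g \<in> Hom C (susp C X) A" "f = g \<cdot> w"
  using Tri_factor_v[OF Tri_rot[OF assms(1)] assms(2,3)] .

lemma Tri_factor_u:
  assumes T: "Tri C X Y Z u v w" and f: "f \<in> Hom C X A" "suspm C f \<cdot> w = 0"
  obtains g where "g \<in> Hom C Y A" "f = g \<cdot> u"
proof -
  have u: "u \<in> Hom C X Y" using Tri_in_Hom[OF T] by simp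
  obtain g' where g': "g' \<in> Hom C (susp C Y) (susp C A)" "suspm C f = g' \<cdot> (- suspm C u)"
    using Tri_factor_v[OF Tri_rot2[OF T] suspm_in_Hom[OF f(1)] f(2)] .
  obtain g where g: "g \<in> Hom C Y A" "g' = suspm C g" using g'(1) by (rule suspm_fullE)
  have "suspm C f = - suspm C (g \<cdot> u)"
    using g' g suspm_in_Hom[OF u] by (simp add: Cmp_minus_right[OF suspm_in_Hom[OF u]] suspm_Cmp[OF u g(1)])
  also have "\<dots> = suspm C ((- g) \<cdot> u)"
    using suspm_minus[OF Cmp_in_Hom[OF u g(1)]] Cmp_minus_left[OF u g(1)] by simp
  finally have "f = (- g) \<cdot> u"
    using suspm_inj[OF f(1) Cmp_in_Hom[OF u Hom_minus[OF g(1)]]] by simp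
  then show ?thesis using that g(1) Hom_minus by blast
qed

text \<open>Since w = 0, the map v has a section s and u has a retraction r0. The latter need not
  vanish on s; it only shows that u is a monomorphism, and the projection r of the biproduct is read
  off from \<open>Id C Y - s \<cdot> v = u \<cdot> r\<close>.\<close>

lemma Tri_split:
  assumes T: "Tri C X Y Z u v 0"
  shows "is_biproduct C X Z Y"
proof -
  have u: "u \<in> Hom C X Y" and v: "v \<in> Hom C Y Z" using Tri_in_Hom[OF T] by auto
  obtain s where s: "s \<in> Hom C Z Y" "v \<cdot> s = Id C Z"
    using Tri_lift_v[OF T Id_in_Hom] Cmp_0_left[OF Id_in_Hom] by metis
  obtain r0 where r0: "r0 \<in> Hom C Y X" "r0 \<cdot> u = Id C X"
    using Tri_factor_u[OF T Id_in_Hom] Cmp_0_right[OF suspm_in_Hom[OF Id_in_Hom]] by metis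
  have sv: "s \<cdot> v \<in> Hom C Y Y" using Cmp_in_Hom v s by blast
  have "v \<cdot> (Id C Y - s \<cdot> v) = 0"
    using Cmp_diff_right[OF Id_in_Hom sv v] Cmp_Id_right[OF v] Cmp_assoc[OF v s(1) v] s(2)
      Cmp_Id_left[OF v] by simp
  then obtain r where r: "r \<in> Hom C Y X" "Id C Y - s \<cdot> v = u \<cdot> r"
    using Tri_lift_u[OF T Hom_diff[OF Id_in_Hom sv]] by metis
  have mono: "x = 0" if "x \<in> Hom C A X" "u \<cdot> x = 0" for x A
  proof -
    have "r0 \<cdot> (u \<cdot> x) = x" using Cmp_assoc[OF that(1) u r0(1)] r0(2) Cmp_Id_left[OF that(1)] by simp
    then show ?thesis using that(2) Cmp_0_right[OF r0(1)] by simp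
  qed
  have "u \<cdot> (r \<cdot> u) = u"
    using Cmp_assoc[OF u r(1) u] r(2)[symmetric] Cmp_diff_left[OF u Id_in_Hom sv]
      Cmp_Id_left[OF u] Cmp_assoc[OF u v s(1)] Tri_comp_uv[OF T] Cmp_0_right[OF s(1)] by simp
  then have "u \<cdot> (r \<cdot> u - Id C X) = 0"
    using Cmp_diff_right[OF Cmp_in_Hom[OF u r(1)] Id_in_Hom u] Cmp_Id_right[OF u] by simp
  then have ru: "r \<cdot> u = Id C X"
    using mono[OF Hom_diff[OF Cmp_in_Hom[OF u r(1)] Id_in_Hom]] by simp
  have "u \<cdot> (r \<cdot> s) = 0"
    using Cmp_assoc[OF s(1) r(1) u] r(2)[symmetric] Cmp_diff_left[OF s(1) Id_in_Hom sv]
      Cmp_Id_left[OF s(1)] Cmp_assoc[OF s(1) v s(1)] s(2) Cmp_Id_right[OF s(1)] by simp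
  then have rs: "r \<cdot> s = 0" using mono[OF Cmp_in_Hom[OF s(1) r(1)]] by simp
  show ?thesis
    by (rule is_biproductI[OF u s(1) r(1) v ru s(2) Tri_comp_uv[OF T] rs])
      (simp add: r(2)[symmetric])
qed

lemma Tri_iso3:
  assumes T: "Tri C X Y Z u v w" and f: "f \<in> Hom C Z Z'" "g \<in> Hom C Z' Z"
    "g \<cdot> f = Id C Z" "f \<cdot> g = Id C Z'"
  shows "Tri C X Y Z' u (f \<cdot> v) (w \<cdot> g)"
proof (rule Tri_iso[OF T])
  have h: "u \<in> Hom C X Y" "v \<in> Hom C Y Z" "w \<in> Hom C Z (susp C X)" using Tri_in_Hom[OF T] by auto
  show "u \<in> Hom C X Y" "f \<cdot> v \<in> Hom C Y Z'" "w \<cdot> g \<in> Hom C Z' (susp C X)"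
    using h f Cmp_in_Hom by auto
  show "is_iso C X X (Id C X)" "is_iso C Y Y (Id C Y)" by (rule is_iso_Id)+
  show "is_iso C Z Z' f" using f by (auto simp: is_iso_def)
  show "Id C Y \<cdot> u = u \<cdot> Id C X" using h by (simp add: Cmp_Id_left Cmp_Id_right)
  show "f \<cdot> v = f \<cdot> v \<cdot> Id C Y" using Cmp_Id_right[OF Cmp_in_Hom[OF h(2) f(1)]] by simp
  show "suspm C (Id C X) \<cdot> w = w \<cdot> g \<cdot> f"
    using suspm_Id Cmp_Id_left[OF h(3)] Cmp_assoc[OF f(1,2) h(3)] f(3) Cmp_Id_right[OF h(3)] by simp
qed

text \<open>As the suspension is only essentially surjective, rotating back replaces Z by an
  isomorphic \<Sigma>Z'; f and g are the two directions of that isomorphism.\<close>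

lemma Tri_rotate_back:
  assumes T: "Tri C X Y Z u v w"
  obtains Z' u' f g where "Tri C Z' X Y u' u (g \<cdot> v)" "f \<in> Hom C (susp C Z') Z" "g \<in> Hom C Z (susp C Z')"
    "g \<cdot> f = Id C (susp C Z')" "f \<cdot> g = Id C Z" "w \<cdot> f = - suspm C u'"
proof -
  obtain Z' f g where f: "f \<in> Hom C (susp C Z') Z" "g \<in> Hom C Z (susp C Z')"
    "g \<cdot> f = Id C (susp C Z')" "f \<cdot> g = Id C Z" by (rule ess_surjE)
  have h: "u \<in> Hom C X Y" "v \<in> Hom C Y Z" "w \<in> Hom C Z (susp C X)" using Tri_in_Hom[OF T] by auto
  have T': "Tri C X Y (susp C Z') u (g \<cdot> v) (w \<cdot> f)"
    using Tri_iso3[OF T f(2,1,4,3)] .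
  obtain a where a: "a \<in> Hom C Z' X" "w \<cdot> f = suspm C a"
    by (rule suspm_fullE[OF Cmp_in_Hom[OF f(1) h(3)]])
  have e: "- suspm C (- a) = w \<cdot> f" using a suspm_minus[OF a(1)] by simp
  have "Tri C Z' X Y (- a) u (g \<cdot> v)"
    using T' unfolding e[symmetric]
    by (subst Tri_rotate) (use a h f Cmp_in_Hom in auto)
  then show ?thesis using that f e by metis
qed

lemma is_biproduct_susp:
  assumes "is_biproduct C X Y Z"
  shows "is_biproduct C (susp C X) (susp C Y) (susp C Z)"
proof -
  obtain i j p q where ij: "i \<in> Hom C X Z" "j \<in> Hom C Y Z" "p \<in> Hom C Z X" "q \<in> Hom C Z Y"
    "p \<cdot> i = Id C X" "q \<cdot> j = Id C Y" "q \<cdot> i = 0" "p \<cdot> j = 0" "i \<cdot> p + j \<cdot> q = Id C Z"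
    by (rule is_biproductE[OF assms(1)])
  show ?thesis
    by (rule is_biproductI[OF ij(1-4)[THEN suspm_in_Hom]])
      (simp_all add: ij(5-9) suspm_Id suspm_0 suspm_Cmp[OF ij(1,3), symmetric]
        suspm_Cmp[OF ij(2,4), symmetric] suspm_Cmp[OF ij(1,4), symmetric] suspm_Cmp[OF ij(2,3), symmetric]
        suspm_Cmp[OF ij(3,1), symmetric] suspm_Cmp[OF ij(4,2), symmetric]
        suspm_add[OF Cmp_in_Hom[OF ij(3,1)] Cmp_in_Hom[OF ij(4,2)], symmetric])
qed

lemma is_biproduct_desusp:
  assumes "is_biproduct C (susp C X) (susp C Y) (susp C Z)"
  shows "is_biproduct C X Y Z"
proof -
  obtain i' j' p' q' where ij': "i' \<in> Hom C (susp C X) (susp C Z)" "j' \<in> Hom C (susp C Y) (susp C Z)"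
    "p' \<in> Hom C (susp C Z) (susp C X)" "q' \<in> Hom C (susp C Z) (susp C Y)"
    "p' \<cdot> i' = Id C (susp C X)" "q' \<cdot> j' = Id C (susp C Y)" "q' \<cdot> i' = 0" "p' \<cdot> j' = 0"
    "i' \<cdot> p' + j' \<cdot> q' = Id C (susp C Z)"
    by (rule is_biproductE[OF assms(1)])
  obtain i j p q where ij: "i \<in> Hom C X Z" "j \<in> Hom C Y Z" "p \<in> Hom C Z X" "q \<in> Hom C Z Y"
    "i' = suspm C i" "j' = suspm C j" "p' = suspm C p" "q' = suspm C q"
    using suspm_fullE ij'(1-4) by metis
  have c: "suspm C (p \<cdot> i) = suspm C (Id C X)" "suspm C (q \<cdot> j) = suspm C (Id C Y)"
    "suspm C (q \<cdot> i) = suspm C 0" "suspm C (p \<cdot> j) = suspm C 0"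
    "suspm C (i \<cdot> p + j \<cdot> q) = suspm C (Id C Z)"
    using ij'(5-9) unfolding ij(5-8)
    by (simp_all add: suspm_Id suspm_0 suspm_Cmp[OF ij(1,3)] suspm_Cmp[OF ij(2,4)]
        suspm_Cmp[OF ij(1,4)] suspm_Cmp[OF ij(2,3)] suspm_Cmp[OF ij(3,1)] suspm_Cmp[OF ij(4,2)]
        suspm_add[OF Cmp_in_Hom[OF ij(3,1)] Cmp_in_Hom[OF ij(4,2)]])
  show ?thesis
  proof (rule is_biproductI[OF ij(1-4)])
    show "p \<cdot> i = Id C X" by (rule suspm_inj[OF Cmp_in_Hom[OF ij(1,3)] Id_in_Hom c(1)])
    show "q \<cdot> j = Id C Y" by (rule suspm_inj[OF Cmp_in_Hom[OF ij(2,4)] Id_in_Hom c(2)])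
    show "q \<cdot> i = 0" by (rule suspm_inj[OF Cmp_in_Hom[OF ij(1,4)] Hom_0 c(3)])
    show "p \<cdot> j = 0" by (rule suspm_inj[OF Cmp_in_Hom[OF ij(2,3)] Hom_0 c(4)])
    show "i \<cdot> p + j \<cdot> q = Id C Z"
      by (rule suspm_inj[OF Hom_add[OF Cmp_in_Hom[OF ij(3,1)] Cmp_in_Hom[OF ij(4,2)]] Id_in_Hom c(5)])
  qed
qed

text \<open>The third triangle of the octahedron splits once its connecting map vanishes.\<close>

lemma octahedral_split:
  assumes "Tri C X Y Z' u i i'" "Tri C Y Z X' v j j'" "Tri C X Z Y' (v \<cdot> u) k k'"
    and "suspm C i \<cdot> j' = 0"
  shows "is_biproduct C Z' X' Y'"
  using octahedral[OF assms(1-3)] assms(4) Tri_split by metis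

end

section \<open>Cluster-tilting objects\<close>

locale cluster_tilted = two_CY_category C for C :: "('k::alg_closed_field, 'o, 'm::ab_group_add) tri_cat" (structure) +
  fixes T :: 'o
  assumes cluster_tilting_T: "cluster_tilting C T"
begin

lemma T_rigid: "h \<in> Hom C T (susp C T) \<Longrightarrow> h = 0"
  using cluster_tilting_T by (auto simp: cluster_tilting_def)

text \<open>The identity of a summand of T^n is cut along the n projections. As with the dual basis
  of a projective module, statements about U are thereby reduced to maps T -> U and U -> T.\<close>

lemma in_add_dual_basis:
  assumes "in_add C T U"
  obtains n :: nat and r c where "\<And>a. a < n \<Longrightarrow> r a \<in> Hom C T U" "\<And>a. a < n \<Longrightarrow> c a \<in> Hom C U T"
    "(\<Sum>a<n. r a \<cdot> c a) = Id C U"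
proof -
  obtain n Y W where "is_direct_sum C {..<n} (\<lambda>_. T) W" and b: "is_biproduct C U Y W"
    using assms by (auto simp: in_add_def)
  then obtain i p where ip: "\<forall>a\<in>{..<n}. i a \<in> Hom C T W \<and> p a \<in> Hom C W T"
    "(\<Sum>a<n. i a \<cdot> p a) = Id C W"
    unfolding is_direct_sum_def by blast
  obtain k r where k: "k \<in> Hom C U W" "r \<in> Hom C W U" "r \<cdot> k = Id C U"
    using b by (rule is_biproductE)
  have ipa: "i a \<in> Hom C T W" "p a \<in> Hom C W T" if "a < n" for a using ip that by auto
  have "(\<Sum>a<n. (r \<cdot> i a) \<cdot> (p a \<cdot> k)) = (\<Sum>a<n. r \<cdot> ((i a \<cdot> p a) \<cdot> k))"
  proof (rule sum.cong)
    fix a assume "a \<in> {..<n}"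
    then have a: "i a \<in> Hom C T W" "p a \<in> Hom C W T" using ipa by auto
    show "(r \<cdot> i a) \<cdot> (p a \<cdot> k) = r \<cdot> ((i a \<cdot> p a) \<cdot> k)"
      using Cmp_assoc[OF Cmp_in_Hom[OF k(1) a(2)] a(1) k(2)] Cmp_assoc[OF k(1) a(2,1)] by simp
  qed simp
  also have "\<dots> = r \<cdot> (\<Sum>a<n. (i a \<cdot> p a) \<cdot> k)"
    using ipa k by (intro Cmp_sum_right[OF k(2), symmetric]) (auto intro!: Cmp_in_Hom)
  also have "(\<Sum>a<n. (i a \<cdot> p a) \<cdot> k) = (\<Sum>a<n. i a \<cdot> p a) \<cdot> k"
    using ipa k by (intro Cmp_sum_left[OF k(1), symmetric]) (auto intro!: Cmp_in_Hom)
  finally have "(\<Sum>a<n. (r \<cdot> i a) \<cdot> (p a \<cdot> k)) = Id C U"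
    using ip(2) k Cmp_Id_left[OF k(1)] by simp
  then show ?thesis
    using that[of n "\<lambda>a. r \<cdot> i a" "\<lambda>a. p a \<cdot> k"] Cmp_in_Hom[OF ipa(1) k(2)] Cmp_in_Hom[OF k(1) ipa(2)]
    by blast
qed

text \<open>F is faithful on maps leaving add T: such a map is recovered from its composites with
  the first half of a dual basis.\<close>

lemma in_add_eqI:
  assumes U: "in_add C T U" and f: "f \<in> Hom C U Z" "g \<in> Hom C U Z"
    and eq: "\<And>h. h \<in> Hom C T U \<Longrightarrow> f \<cdot> h = g \<cdot> h"
  shows "f = g"
proof -
  obtain n :: nat and r c where d: "\<And>a. a < n \<Longrightarrow> r a \<in> Hom C T U" "\<And>a. a < n \<Longrightarrow> c a \<in> Hom C U T"
    "(\<Sum>a<n. r a \<cdot> c a) = Id C U" using in_add_dual_basis[OF U] by metis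
  have rc: "r a \<cdot> c a \<in> Hom C U U" if "a < n" for a using Cmp_in_Hom[OF d(2,1)] that by blast
  have e: "x = (\<Sum>a<n. (x \<cdot> r a) \<cdot> c a)" if "x \<in> Hom C U Z" for x
  proof -
    have "x = x \<cdot> (\<Sum>a<n. r a \<cdot> c a)" using d(3) Cmp_Id_right[OF that] by simp
    also have "\<dots> = (\<Sum>a<n. x \<cdot> (r a \<cdot> c a))"
      using rc by (intro Cmp_sum_right[OF that]) auto
    also have "\<dots> = (\<Sum>a<n. (x \<cdot> r a) \<cdot> c a)"
      using Cmp_assoc[OF d(2,1) that] by (intro sum.cong) auto
    finally show ?thesis .
  qed
  have "(\<Sum>a<n. (f \<cdot> r a) \<cdot> c a) = (\<Sum>a<n. (g \<cdot> r a) \<cdot> c a)"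
    using eq d(1) by (intro sum.cong) auto
  then show ?thesis using e[OF f(1)] e[OF f(2)] by simp
qed

text \<open>Membership becomes the vanishing of a Hom space, which exact sequences can test. One
  direction spreads the rigidity of T along a dual basis, the other is the maximality clause of
  \<open>cluster_tilting\<close>.\<close>

lemma in_add_iff: "in_add C T U \<longleftrightarrow> Hom C T (susp C U) = {0}"
proof
  assume U: "in_add C T U"
  obtain n :: nat and r c where d: "\<And>a. a < n \<Longrightarrow> r a \<in> Hom C T U" "\<And>a. a < n \<Longrightarrow> c a \<in> Hom C U T"
    "(\<Sum>a<n. r a \<cdot> c a) = Id C U" using in_add_dual_basis[OF U] by metis
  have rc: "r a \<cdot> c a \<in> Hom C U U" if "a < n" for a using Cmp_in_Hom[OF d(2,1)] that by blast
  have "h = 0" if h: "h \<in> Hom C T (susp C U)" for h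
  proof -
    have "Id C (susp C U) = suspm C (\<Sum>a<n. r a \<cdot> c a)" using d(3) suspm_Id by simp
    also have "\<dots> = (\<Sum>a<n. suspm C (r a \<cdot> c a))"
      using rc by (intro hom.lin_on_sum[OF lin_on_suspm Hom_subspace]) auto
    finally have "h = (\<Sum>a<n. suspm C (r a \<cdot> c a)) \<cdot> h" using Cmp_Id_left[OF h] by simp
    also have "\<dots> = (\<Sum>a<n. suspm C (r a \<cdot> c a) \<cdot> h)"
      using rc suspm_in_Hom by (intro Cmp_sum_left[OF h]) auto
    also have "\<dots> = (\<Sum>a<n. 0)"
    proof (rule sum.cong)
      fix a assume a: "a \<in> {..<n}"
      then have "c a \<in> Hom C U T" and ra: "r a \<in> Hom C T U" using d by auto
      then have sc: "suspm C (c a) \<in> Hom C (susp C U) (susp C T)" by (simp add: suspm_in_Hom)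
      have "suspm C (r a \<cdot> c a) \<cdot> h = suspm C (r a) \<cdot> (suspm C (c a) \<cdot> h)"
        using Cmp_assoc[OF h sc suspm_in_Hom[OF ra]] suspm_Cmp[OF d(2) ra] a by simp
      also have "suspm C (c a) \<cdot> h = 0" using T_rigid[OF Cmp_in_Hom[OF h sc]] .
      finally show "suspm C (r a \<cdot> c a) \<cdot> h = 0" using Cmp_0_right[OF suspm_in_Hom[OF ra]] by simp
    qed simp
    finally show ?thesis by simp
  qed
  then show "Hom C T (susp C U) = {0}" using Hom_0 by blast
next
  assume "Hom C T (susp C U) = {0}"
  then show "in_add C T U" using cluster_tilting_T by (auto simp: cluster_tilting_def)
qed

lemma add_rigid:
  assumes "in_add C T U" "in_add C T V" "h \<in> Hom C U (susp C V)"
  shows "h = 0"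
proof (rule in_add_eqI[OF assms(1,3) Hom_0])
  fix g assume g: "g \<in> Hom C T U"
  have "h \<cdot> g = 0" using Cmp_in_Hom[OF g assms(3)] assms(2) in_add_iff by auto
  then show "h \<cdot> g = 0 \<cdot> g" using Cmp_0_left[OF g] by simp
qed

lemma add_rigid_susp:
  assumes "in_add C T U" "in_add C T V" "h \<in> Hom C (susp C U) (susp C (susp C V))"
  shows "h = 0"
  using assms(3) suspm_0 add_rigid[OF assms(1,2)] by (metis suspm_fullE)

lemma in_add_biproduct:
  assumes "in_add C T U" "in_add C T V" "is_biproduct C U V W"
  shows "in_add C T W"
proof -
  obtain i j p q where b: "i \<in> Hom C (susp C U) (susp C W)" "j \<in> Hom C (susp C V) (susp C W)"
    "p \<in> Hom C (susp C W) (susp C U)" "q \<in> Hom C (susp C W) (susp C V)"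
    "i \<cdot> p + j \<cdot> q = Id C (susp C W)"
    using is_biproduct_susp[OF assms(3)] by (rule is_biproductE)
  have "h = 0" if h: "h \<in> Hom C T (susp C W)" for h
  proof -
    have "h = (i \<cdot> p) \<cdot> h + (j \<cdot> q) \<cdot> h"
      using Cmp_Id_left[OF h] b(5) Cmp_add_left[OF h Cmp_in_Hom[OF b(3,1)] Cmp_in_Hom[OF b(4,2)]] by simp
    moreover have "p \<cdot> h = 0" "q \<cdot> h = 0"
      using Cmp_in_Hom[OF h b(3)] Cmp_in_Hom[OF h b(4)] assms(1,2) in_add_iff by auto
    ultimately show ?thesis
      using Cmp_assoc[OF h b(3,1)] Cmp_assoc[OF h b(4,2)] Cmp_0_right[OF b(1)] Cmp_0_right[OF b(2)] by simp
  qed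
  then show ?thesis using in_add_iff Hom_0 by blast
qed

text \<open>Generators of N over k, with one copy of T for each, already give a map T^n -> X whose
  image under F contains N; the image stays inside N because N is a submodule.\<close>

lemma Hom_spans_approx:
  assumes N: "hom.subspace N" "N \<subseteq> Hom C T X"
    and act: "\<And>f b. f \<in> N \<Longrightarrow> b \<in> Hom C T T \<Longrightarrow> f \<cdot> b \<in> N"
  obtains U f where "in_add C T U" "f \<in> Hom C U X" "(\<lambda>g. f \<cdot> g) ` Hom C T U = N"
proof -
  obtain A where "finite A" "N = hom.span A"
    using hom.fin_dim_subset[OF Hom_finite N] by (auto simp: fin_dim_subspace_def)
  then obtain n :: nat and h where A: "N = hom.span (h ` {..<n})"
    using finite_imp_nat_seg_image_inj_on[of A] by (metis lessThan_def)
  have hN: "h a \<in> N" if "a < n" for a using that A hom.span_base by auto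
  then have hX: "h a \<in> Hom C T X" if "a < n" for a using that N(2) by auto
  obtain W where W: "is_direct_sum C {..<n} (\<lambda>_. T) W" using direct_power_exists by blast
  then obtain i p where ip: "\<forall>a\<in>{..<n}. i a \<in> Hom C T W \<and> p a \<in> Hom C W T"
    "\<forall>a\<in>{..<n}. \<forall>b\<in>{..<n}. p a \<cdot> i b = (if a = b then Id C T else 0)"
    unfolding is_direct_sum_def by blast
  obtain O' where O: "is_zero C O'" using zero_object by blast
  have WT: "in_add C T W"
    unfolding in_add_def using W is_biproduct_zero[OF O is_iso_Id] by blast
  have hp: "h a \<cdot> p a \<in> Hom C W X" if "a < n" for a
    using ip(1) that by (intro Cmp_in_Hom[OF _ hX[OF that]]) auto
  define f where "f = (\<Sum>a<n. h a \<cdot> p a)"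
  have f: "f \<in> Hom C W X" unfolding f_def using hp by (intro Hom_sum) auto
  have "f \<cdot> g \<in> N" if g: "g \<in> Hom C T W" for g
  proof -
    have "f \<cdot> g = (\<Sum>a<n. (h a \<cdot> p a) \<cdot> g)"
      unfolding f_def using hp by (intro Cmp_sum_left[OF g]) auto
    also have "\<dots> = (\<Sum>a<n. h a \<cdot> (p a \<cdot> g))"
      using ip(1) by (intro sum.cong refl Cmp_assoc[OF g _ hX, symmetric]) auto
    also have "\<dots> \<in> N"
      using hN act ip(1) Cmp_in_Hom[OF g] by (intro hom.subspace_sum[OF N(1)]) auto
    finally show ?thesis .
  qed
  moreover have "N \<subseteq> (\<lambda>g. f \<cdot> g) ` Hom C T W"
  proof -
    have "h b \<in> (\<lambda>g. f \<cdot> g) ` Hom C T W" if b: "b < n" for b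
    proof -
      have ib: "i b \<in> Hom C T W" using ip(1) b by auto
      have "f \<cdot> i b = (\<Sum>a<n. (h a \<cdot> p a) \<cdot> i b)"
        unfolding f_def using hp by (intro Cmp_sum_left[OF ib]) auto
      also have "\<dots> = (\<Sum>a<n. h a \<cdot> (p a \<cdot> i b))"
        using ip(1) by (intro sum.cong refl Cmp_assoc[OF ib _ hX, symmetric]) auto
      also have "\<dots> = (\<Sum>a<n. if a = b then h b else 0)"
        using ip(2) b Cmp_Id_right[OF hX] Cmp_0_right[OF hX] by (intro sum.cong) auto
      also have "\<dots> = h b" using b by simp
      finally show ?thesis using ib by (metis image_eqI)
    qed
    moreover have "hom.subspace ((\<lambda>g. f \<cdot> g) ` Hom C T W)"
      by (rule subspace_image_on[OF ambient_vector_space lin_on_post[OF f] Hom_subspace ambient_vector_space])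
    ultimately show ?thesis unfolding A by (intro hom.span_minimal) auto
  qed
  ultimately show ?thesis using that[OF WT f] by blast
qed

text \<open>This is the triangle that computes the index of X. Since
  \<open>Hom C T (susp C U1)\<close> vanishes, F turns it into a projective presentation of F
  X.\<close>

definition add_resolution :: "'o \<Rightarrow> 'o \<Rightarrow> 'o \<Rightarrow> 'm \<Rightarrow> 'm \<Rightarrow> 'm \<Rightarrow> bool"
  where "add_resolution X U1 U0 u v w \<longleftrightarrow> in_add C T U1 \<and> in_add C T U0 \<and> Tri C U1 U0 X u v w"

lemma add_resolutionD:
  assumes "add_resolution X U1 U0 u v w"
  shows "in_add C T U1" "in_add C T U0" "Tri C U1 U0 X u v w"
    "u \<in> Hom C U1 U0" "v \<in> Hom C U0 X" "w \<in> Hom C X (susp C U1)"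
  using assms Tri_in_Hom by (auto simp: add_resolution_def)

text \<open>A map T -> \<Sigma>U1 dies in \<Sigma>U0 by rigidity, so it factors through w, and then
  through \<open>w \<cdot> v = 0\<close> because F v is onto. Hence the cocone U1 of an add T-cover
  lies in add T.\<close>

lemma add_resolutionI:
  assumes U: "in_add C T U0" and v: "v \<in> Hom C U0 X" and onto: "\<And>h. h \<in> Hom C T X \<Longrightarrow> \<exists>g\<in>Hom C T U0. h = v \<cdot> g"
  obtains U1 u w where "add_resolution X U1 U0 u v w"
proof -
  obtain Q a b where "Tri C U0 X Q v a b" using Tri_complete[OF v] by blast
  then obtain U1 u g where t: "Tri C U1 U0 X u v (g \<cdot> a)" by (rule Tri_rotate_back)
  let ?w = "g \<cdot> a"
  have h: "u \<in> Hom C U1 U0" "?w \<in> Hom C X (susp C U1)" using Tri_in_Hom[OF t] by auto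
  have "f = 0" if f: "f \<in> Hom C T (susp C U1)" for f
  proof -
    have "suspm C u \<cdot> f = 0"
      using Cmp_in_Hom[OF f suspm_in_Hom[OF h(1)]] U in_add_iff by auto
    then obtain x where x: "x \<in> Hom C T X" "f = ?w \<cdot> x" using Tri_lift_w[OF t f] by metis
    then obtain y where y: "y \<in> Hom C T U0" "x = v \<cdot> y" using onto by blast
    have "f = ?w \<cdot> v \<cdot> y" using x y Cmp_assoc[OF y(1) v h(2)] by simp
    then show "f = 0" using Tri_comp_vw[OF t] Cmp_0_left[OF y(1)] by simp
  qed
  then have "in_add C T U1" unfolding in_add_iff using Hom_0 by blast
  then show ?thesis using that U t by (auto simp: add_resolution_def)
qed

lemma add_resolution_exists:
  obtains U1 U0 u v w where "add_resolution X U1 U0 u v w"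
proof -
  obtain U v where "in_add C T U" "v \<in> Hom C U X" "(\<lambda>g. v \<cdot> g) ` Hom C T U = Hom C T X"
    using Hom_spans_approx[OF Hom_subspace subset_refl, of X] Cmp_in_Hom by metis
  then show ?thesis using add_resolutionI[of U v X] that by (metis imageE)
qed

lemma add_resolution_lift:
  assumes r: "add_resolution X U1 U0 u v w" and A: "in_add C T A" and h: "h \<in> Hom C A X"
  obtains g where "g \<in> Hom C A U0" "h = v \<cdot> g"
proof -
  note d = add_resolutionD[OF r]
  have "w \<cdot> h = 0" using add_rigid[OF A d(1)] Cmp_in_Hom[OF h d(6)] by blast
  then show ?thesis using Tri_lift_v[OF d(3) h] that by metis
qed

lemma in_add_T: "in_add C T T"
  using T_rigid Hom_0 by (subst in_add_iff) blast

section \<open>Ghost maps\<close>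

text \<open>The maps killed by \<open>F = C(T, ?)\<close>; they are the maps factoring through \<open>add \<Sigma>T\<close>.\<close>

definition ghost :: "'o \<Rightarrow> 'o \<Rightarrow> 'm set"
  where "ghost X Z = {g \<in> Hom C X Z. \<forall>h\<in>Hom C T X. g \<cdot> h = 0}"

lemma ghostD: "g \<in> ghost X Z \<Longrightarrow> g \<in> Hom C X Z" "g \<in> ghost X Z \<Longrightarrow> h \<in> Hom C T X \<Longrightarrow> g \<cdot> h = 0"
  by (auto simp: ghost_def)

lemma ghostI: "g \<in> Hom C X Z \<Longrightarrow> (\<And>h. h \<in> Hom C T X \<Longrightarrow> g \<cdot> h = 0) \<Longrightarrow> g \<in> ghost X Z"
  by (auto simp: ghost_def)

lemma ghost_subspace: "hom.subspace (ghost X Z)"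
  by (rule hom.subspaceI)
    (auto simp: ghost_def Hom_add Hom_smul Cmp_0_left Cmp_add_left Cmp_smul_left)

lemma ghost_subset: "ghost X Z \<subseteq> Hom C X Z"
  by (auto simp: ghost_def)

lemma ghost_fin_dim: "fin_dim_subspace (smul C) (ghost X Z)"
  using hom.fin_dim_subset[OF Hom_finite ghost_subspace ghost_subset] .

lemma ghost_post:
  assumes g: "g \<in> ghost X Y" and f: "f \<in> Hom C Y Z"
  shows "f \<cdot> g \<in> ghost X Z"
proof (rule ghostI)
  show "f \<cdot> g \<in> Hom C X Z" using ghostD(1)[OF g] f by (rule Cmp_in_Hom)
  fix h assume h: "h \<in> Hom C T X"
  show "f \<cdot> g \<cdot> h = 0"
    using Cmp_assoc[OF h ghostD(1)[OF g] f] ghostD(2)[OF g h] Cmp_0_right[OF f] by simp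
qed

lemma ghost_pre:
  assumes g: "g \<in> ghost Y Z" and f: "f \<in> Hom C X Y"
  shows "g \<cdot> f \<in> ghost X Z"
proof (rule ghostI)
  show "g \<cdot> f \<in> Hom C X Z" using f ghostD(1)[OF g] by (rule Cmp_in_Hom)
  fix h assume h: "h \<in> Hom C T X"
  show "g \<cdot> f \<cdot> h = 0"
    using Cmp_assoc[OF h f ghostD(1)[OF g]] ghostD(2)[OF g Cmp_in_Hom[OF h f]] by simp
qed

lemma ghost_in_add: "in_add C T U \<Longrightarrow> ghost U Z = {0}"
  using in_add_eqI[of U _ Z 0] Cmp_0_left by (auto simp: ghost_def)

lemma ghost_iff_v:
  assumes r: "add_resolution X U1 U0 u v w" and g: "g \<in> Hom C X Z"
  shows "g \<in> ghost X Z \<longleftrightarrow> g \<cdot> v = 0"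
proof
  note d = add_resolutionD[OF r]
  assume "g \<in> ghost X Z"
  then have "g \<cdot> v \<in> ghost U0 Z" by (rule ghost_pre[OF _ d(5)])
  then show "g \<cdot> v = 0" using ghost_in_add[OF d(2)] by auto
next
  note d = add_resolutionD[OF r]
  assume gv: "g \<cdot> v = 0"
  show "g \<in> ghost X Z"
  proof (rule ghostI[OF g])
    fix h assume "h \<in> Hom C T X"
    then obtain s where s: "s \<in> Hom C T U0" "h = v \<cdot> s" using add_resolution_lift[OF r in_add_T] by metis
    show "g \<cdot> h = 0" using s Cmp_assoc[OF s(1) d(5) g] gv Cmp_0_left[OF s(1)] by simp
  qed
qed

text \<open>The map w is the universal ghost out of X: ghosts are the maps that kill v, and these
  are the maps factoring through w. This is the description by factorisation through add
  \<Sigma>T.\<close>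

lemma ghost_eq_w:
  assumes r: "add_resolution X U1 U0 u v w"
  shows "ghost X Z = (\<lambda>y. y \<cdot> w) ` Hom C (susp C U1) Z"
proof safe
  note d = add_resolutionD[OF r]
  fix g assume g: "g \<in> ghost X Z"
  then have "g \<cdot> v = 0" using ghost_iff_v[OF r ghostD(1)[OF g]] by simp
  then show "g \<in> (\<lambda>y. y \<cdot> w) ` Hom C (susp C U1) Z"
    using Tri_factor_w[OF d(3) ghostD(1)[OF g]] by (metis image_eqI)
next
  note d = add_resolutionD[OF r]
  fix y assume y: "y \<in> Hom C (susp C U1) Z"
  have "y \<cdot> w \<cdot> v = 0" using Cmp_assoc[OF d(5,6) y] Tri_comp_vw[OF d(3)] Cmp_0_right[OF y] by simp
  then show "y \<cdot> w \<in> ghost X Z" using ghost_iff_v[OF r Cmp_in_Hom[OF d(6) y]] by simp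
qed

lemma ghostE:
  assumes "add_resolution X U1 U0 u v w" "g \<in> ghost X Z"
  obtains y where "y \<in> Hom C (susp C U1) Z" "g = y \<cdot> w"
  using assms ghost_eq_w[OF assms(1), of Z] by auto

text \<open>A dual description, for maps into \<Sigma>X. A ghost factors through some \<Sigma>V1,
  and maps \<Sigma>V1 -> \<Sigma>\<Sigma>U1 vanish by rigidity; conversely a map killed by \<Sigma>w
  comes from \<Sigma>U0, and every map into \<Sigma>U0 is a ghost. Kernels of this form are what
  annihilators produce.\<close>

lemma ghost_susp_w:
  assumes r: "add_resolution X U1 U0 u v w" and g: "g \<in> Hom C V (susp C X)"
  shows "g \<in> ghost V (susp C X) \<longleftrightarrow> suspm C w \<cdot> g = 0"
proof
  note d = add_resolutionD[OF r]
  assume G: "g \<in> ghost V (susp C X)"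
  obtain V1 V0 a b c where r': "add_resolution V V1 V0 a b c" by (rule add_resolution_exists)
  note d' = add_resolutionD[OF r']
  obtain y where y: "y \<in> Hom C (susp C V1) (susp C X)" "g = y \<cdot> c" using ghostE[OF r' G] .
  have sw: "suspm C w \<in> Hom C (susp C X) (susp C (susp C U1))" using suspm_in_Hom[OF d(6)] .
  have "suspm C w \<cdot> y = 0" using add_rigid_susp[OF d'(1) d(1) Cmp_in_Hom[OF y(1) sw]] .
  then show "suspm C w \<cdot> g = 0" using y Cmp_assoc[OF d'(6) y(1) sw] Cmp_0_left[OF d'(6)] by simp
next
  note d = add_resolutionD[OF r]
  assume "suspm C w \<cdot> g = 0"
  then have z: "(- suspm C w) \<cdot> g = 0" using Cmp_minus_left[OF g suspm_in_Hom[OF d(6)]] by simp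
  obtain s where s: "s \<in> Hom C V (susp C U0)" "g = (- suspm C v) \<cdot> s"
    using Tri_lift_v[OF Tri_rot[OF Tri_rot2[OF d(3)]] g z] .
  have "s \<in> ghost V (susp C U0)"
    using s(1) Cmp_in_Hom[OF _ s(1)] d(2) in_add_iff by (auto simp: ghost_def)
  then show "g \<in> ghost V (susp C X)"
    using ghost_post[OF _ Hom_minus[OF suspm_in_Hom[OF d(5)]]] s(2) by blast
qed

section \<open>The Calabi-Yau duality\<close>

text \<open>\<open>perp S\<close> is the annihilator of \<open>S \<subseteq> C(X, Y)\<close> in \<open>C(Y, \<Sigma>\<^sup>2X)\<close>.\<close>

lemma two_CY_perp:
  obtains perp :: "'o \<Rightarrow> 'o \<Rightarrow> 'm set \<Rightarrow> 'm set"
  where "\<And>X Y S. hom.subspace S \<Longrightarrow> S \<subseteq> Hom C X Y \<Longrightarrow> hom.subspace (perp X Y S) \<and>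
      perp X Y S \<subseteq> Hom C Y (susp C (susp C X)) \<and> hom.dim (perp X Y S) + hom.dim S = hom.dim (Hom C X Y)"
    and "\<And>X Y X' c. c \<in> Hom C X X' \<Longrightarrow> perp X Y ((\<lambda>b. b \<cdot> c) ` Hom C X' Y) =
      {g \<in> Hom C Y (susp C (susp C X)). suspm C (suspm C c) \<cdot> g = 0}"
    and "\<And>X Y S S'. hom.subspace S \<Longrightarrow> hom.subspace S' \<Longrightarrow> S \<subseteq> Hom C X Y \<Longrightarrow> S' \<subseteq> Hom C X Y \<Longrightarrow>
      perp X Y {x + y |x y. x \<in> S \<and> y \<in> S'} = perp X Y S \<inter> perp X Y S'"
proof -
  from two_CY[unfolded two_Calabi_Yau_def] obtain \<Psi> where \<Psi>:
    "\<forall>X Y. bij_betw (\<Psi> X Y) (Hom_dual C X Y) (Hom C Y (susp C (susp C X)))"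
    "\<forall>X Y. \<forall>\<xi>\<in>Hom_dual C X Y. \<forall>\<eta>\<in>Hom_dual C X Y. \<Psi> X Y (\<xi> + \<eta>) = \<Psi> X Y \<xi> + \<Psi> X Y \<eta>"
    "\<forall>X Y c. \<forall>\<xi>\<in>Hom_dual C X Y. \<Psi> X Y (\<lambda>f. c * \<xi> f) = smul C c (\<Psi> X Y \<xi>)"
    "\<forall>X X' Y Y'. \<forall>a\<in>Hom C X X'. \<forall>b\<in>Hom C Y' Y. \<forall>\<xi>\<in>Hom_dual C X Y.
       \<Psi> X' Y' (Hom_dual_map C X' Y' a b \<xi>) = suspm C (suspm C a) \<cdot> \<Psi> X Y \<xi> \<cdot> b"
    by (elim exE conjE)
  have bij: "bij_betw (\<Psi> X Y) (Hom_dual C X Y) (Hom C Y (susp C (susp C X)))"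
    and add: "\<xi> \<in> Hom_dual C X Y \<Longrightarrow> \<eta> \<in> Hom_dual C X Y \<Longrightarrow> \<Psi> X Y (\<xi> + \<eta>) = \<Psi> X Y \<xi> + \<Psi> X Y \<eta>"
    and scl: "\<xi> \<in> Hom_dual C X Y \<Longrightarrow> \<Psi> X Y (\<lambda>f. c * \<xi> f) = smul C c (\<Psi> X Y \<xi>)"
    and nat: "a \<in> Hom C X X' \<Longrightarrow> b \<in> Hom C Y' Y \<Longrightarrow> \<xi> \<in> Hom_dual C X Y \<Longrightarrow>
          \<Psi> X' Y' (Hom_dual_map C X' Y' a b \<xi>) = suspm C (suspm C a) \<cdot> \<Psi> X Y \<xi> \<cdot> b"
    for X Y X' Y' \<xi> \<eta> c a b
    using \<Psi> by simp_all
  define A where "A X Y S = {\<xi> \<in> linear_maps (smul C) (*) (Hom C X Y) UNIV. \<forall>x\<in>S. \<xi> x = 0}" for X Y S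
  define perp where "perp X Y S = \<Psi> X Y ` A X Y S" for X Y S
  have AD: "A X Y S \<subseteq> Hom_dual C X Y" for X Y S by (auto simp: A_def Hom_dual_def)
  have inj: "inj_on (\<Psi> X Y) (Hom_dual C X Y)" for X Y using bij by (auto simp: bij_betw_def)
  have img: "\<Psi> X Y ` Hom_dual C X Y = Hom C Y (susp C (susp C X))" for X Y using bij by (auto simp: bij_betw_def)
  have lin: "lin_on (\<lambda>c f x. c * f x) (smul C) (Hom_dual C X Y) (\<Psi> X Y)" for X Y
    by (rule lin_onI) (auto simp: add scl)
  show ?thesis
  proof (rule that[of perp])
    fix X Y S assume S: "hom.subspace S" "S \<subseteq> Hom C X Y"
    note ann = dim_annihilator[OF ambient_vector_space Hom_finite S]
    interpret F: vector_space "\<lambda>c (f :: 'm \<Rightarrow> 'k) x. c * f x" by (rule ann(1))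
    have fA: "fin_dim_subspace (\<lambda>c f x. c * f x) (A X Y S)" using ann(2) by (simp add: A_def)
    have l: "lin_on (\<lambda>c f x. c * f x) (smul C) (A X Y S) (\<Psi> X Y)"
      by (rule lin_on_mono[OF lin AD])
    have "hom.subspace (perp X Y S)"
      unfolding perp_def by (rule subspace_image_on[OF ann(1) l F.fin_dim_subspaceD[OF fA] ambient_vector_space])
    moreover have "perp X Y S \<subseteq> Hom C Y (susp C (susp C X))"
      unfolding perp_def img[symmetric] by (rule image_mono[OF AD])
    moreover have "hom.dim (perp X Y S) = F.dim (A X Y S)"
      unfolding perp_def by (rule dim_inj_image[OF ann(1) ambient_vector_space l fA inj_on_subset[OF inj AD]])
    ultimately show "hom.subspace (perp X Y S) \<and>
      perp X Y S \<subseteq> Hom C Y (susp C (susp C X)) \<and> hom.dim (perp X Y S) + hom.dim S = hom.dim (Hom C X Y)"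
      using ann(3) by (simp add: A_def)
  next
    fix X Y X' c assume c: "c \<in> Hom C X X'"
    have "\<xi> \<in> A X Y ((\<lambda>b. b \<cdot> c) ` Hom C X' Y) \<longleftrightarrow> suspm C (suspm C c) \<cdot> \<Psi> X Y \<xi> = 0"
      if x: "\<xi> \<in> Hom_dual C X Y" for \<xi>
    proof -
      \<comment> \<open>Precomposition with c, acting on functionals. Naturality is applied in the
        first argument, with the identity in the second.\<close>
      let ?m = "Hom_dual_map C X' Y c (Id C Y) \<xi>"
      have g: "\<Psi> X Y \<xi> \<in> Hom C Y (susp C (susp C X))" using img x by blast
      have m1: "?m f = \<xi> (f \<cdot> c)" if "f \<in> Hom C X' Y" for f
        using that Cmp_Id_left[OF that] by (simp add: Hom_dual_map_def)
      have m0: "?m f = 0" if "f \<notin> Hom C X' Y" for f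
        using that by (simp add: Hom_dual_map_def)
      have xl: "f \<in> Hom C X Y \<Longrightarrow> g \<in> Hom C X Y \<Longrightarrow> \<xi> (f + g) = \<xi> f + \<xi> g"
        "f \<in> Hom C X Y \<Longrightarrow> \<xi> (smul C r f) = r * \<xi> f" for f g r
        using x by (auto simp: Hom_dual_def linear_maps_def)
      have mD: "?m \<in> Hom_dual C X' Y"
        unfolding Hom_dual_def linear_maps_def
        using m0 by (auto simp: m1 Hom_add Hom_smul Cmp_add_left[OF c] Cmp_smul_left[OF c] xl Cmp_in_Hom[OF c])
      have zD: "0 \<in> Hom_dual C X' Y" by (simp add: Hom_dual_def linear_maps_def)
      have "\<Psi> X' Y (0 + 0) = \<Psi> X' Y 0 + \<Psi> X' Y 0" by (rule add[OF zD zD])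
      then have z0: "\<Psi> X' Y 0 = 0" by simp
      have "\<xi> \<in> A X Y ((\<lambda>b. b \<cdot> c) ` Hom C X' Y) \<longleftrightarrow> (\<forall>f\<in>Hom C X' Y. \<xi> (f \<cdot> c) = 0)"
        using x by (auto simp: A_def Hom_dual_def)
      also have "\<dots> \<longleftrightarrow> ?m = 0" using m0 m1 by (auto simp: fun_eq_iff) metis
      also have "\<dots> \<longleftrightarrow> \<Psi> X' Y ?m = 0" using inj_on_eq_iff[OF inj mD zD] z0 by simp
      also have "\<Psi> X' Y ?m = suspm C (suspm C c) \<cdot> \<Psi> X Y \<xi>"
        using nat[OF c Id_in_Hom x] Cmp_Id_right[OF Cmp_in_Hom[OF g suspm_in_Hom[OF suspm_in_Hom[OF c]]]] by simp
      finally show ?thesis .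
    qed
    then show "perp X Y ((\<lambda>b. b \<cdot> c) ` Hom C X' Y) =
      {g \<in> Hom C Y (susp C (susp C X)). suspm C (suspm C c) \<cdot> g = 0}"
      unfolding perp_def img[symmetric] using AD by blast
  next
    fix X Y S S' assume S: "hom.subspace S" "hom.subspace S'" "S \<subseteq> Hom C X Y" "S' \<subseteq> Hom C X Y"
    have "A X Y {x + y |x y. x \<in> S \<and> y \<in> S'} = A X Y S \<inter> A X Y S'"
    proof safe
      fix \<xi> assume x: "\<xi> \<in> A X Y {x + y |x y. x \<in> S \<and> y \<in> S'}"
      have "\<xi> a = 0" if "a \<in> S" for a
      proof -
        have "a + 0 \<in> {x + y |x y. x \<in> S \<and> y \<in> S'}" using that hom.subspace_0[OF S(2)] by blast
        then show ?thesis using x by (simp add: A_def)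
      qed
      then show "\<xi> \<in> A X Y S" using x by (simp add: A_def)
      have "\<xi> a = 0" if "a \<in> S'" for a
      proof -
        have "0 + a \<in> {x + y |x y. x \<in> S \<and> y \<in> S'}" using that hom.subspace_0[OF S(1)] by blast
        then show ?thesis using x by (simp add: A_def)
      qed
      then show "\<xi> \<in> A X Y S'" using x by (simp add: A_def)
    next
      fix \<xi> assume "\<xi> \<in> A X Y S" "\<xi> \<in> A X Y S'"
      then show "\<xi> \<in> A X Y {x + y |x y. x \<in> S \<and> y \<in> S'}"
        using S(3,4) by (auto simp: A_def linear_maps_def subset_iff)
    qed
    then show "perp X Y {x + y |x y. x \<in> S \<and> y \<in> S'} = perp X Y S \<inter> perp X Y S'"
      unfolding perp_def using inj_on_image_Int[OF inj AD AD] by simp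
  qed
qed

section \<open>Dimension formulas\<close>

abbreviation dHom :: "'o \<Rightarrow> 'o \<Rightarrow> int" where "dHom X Z \<equiv> int (hom.dim (Hom C X Z))"

abbreviation dghost :: "'o \<Rightarrow> 'o \<Rightarrow> int" where "dghost X Z \<equiv> int (hom.dim (ghost X Z))"

text \<open>\<open>ev Z X\<close> is the value at \<open>X\<close> of the function attached to the class of \<open>F Z\<close>. Since
  \<open>Hom\<^sub>B(F X, F Z)\<close> has dimension \<open>dHom X Z - dghost X Z\<close>, it is the difference of the dimensions of
  \<open>Hom\<^sub>B(F X, F Z)\<close> and of the space of maps \<open>X \<rightarrow> \<Sigma>Z\<close> factoring through \<open>add \<Sigma>T\<close>.\<close>

definition ev :: "'o \<Rightarrow> 'o \<Rightarrow> int"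
  where "ev Z X = dHom X Z - dghost X Z - dghost X (susp C Z)"

lemma rank_nullity_pre:
  assumes "f \<in> Hom C X Y" "fin_dim_subspace (smul C) S" "S \<subseteq> Hom C Y Z"
  shows "hom.dim S = hom.dim {g \<in> S. g \<cdot> f = 0} + hom.dim ((\<lambda>g. g \<cdot> f) ` S)"
  using rank_nullity(2)[OF ambient_vector_space ambient_vector_space lin_on_mono[OF lin_on_pre[OF assms(1)] assms(3)] assms(2)] .

lemma lin_on_connecting:
  assumes "w \<in> Hom C X (susp C U)"
  shows "lin_on (smul C) (smul C) (Hom C U Z) (\<lambda>y. suspm C y \<cdot> w)"
  by (rule lin_on_comp[OF lin_on_suspm lin_on_pre[OF assms, of "susp C Z"]]) (auto simp: suspm_in_Hom)

text \<open>Hom(?, Z) applied to the triangle gives the exact sequence 0 -> ghost(X, Z) -> Hom(X, Z)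
  -> Hom(U0, Z) -> Hom(U1, Z) -> ghost(X, \<Sigma>Z) -> 0, whose dimensions have alternating sum
  0.\<close>

lemma ev_add_resolution:
  assumes r: "add_resolution X U1 U0 u v w"
  shows "dHom U0 Z - dHom U1 Z = ev Z X"
proof -
  note d = add_resolutionD[OF r]
  have "{g \<in> Hom C X Z. g \<cdot> v = 0} = ghost X Z"
    using ghost_iff_v[OF r] ghostD(1) by blast
  then have 1: "hom.dim (Hom C X Z) = hom.dim (ghost X Z) + hom.dim ((\<lambda>g. g \<cdot> v) ` Hom C X Z)"
    using rank_nullity_pre[OF d(5) Hom_finite subset_refl] by simp
  have "(\<lambda>g. g \<cdot> v) ` Hom C X Z = {x \<in> Hom C U0 Z. x \<cdot> u = 0}"
  proof safe
    fix g assume g: "g \<in> Hom C X Z"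
    show "g \<cdot> v \<in> Hom C U0 Z" using d(5) g by (rule Cmp_in_Hom)
    show "g \<cdot> v \<cdot> u = 0" using Cmp_assoc[OF d(4,5) g] Tri_comp_uv[OF d(3)] Cmp_0_right[OF g] by simp
  next
    fix x assume "x \<in> Hom C U0 Z" "x \<cdot> u = 0"
    then show "x \<in> (\<lambda>g. g \<cdot> v) ` Hom C X Z" using Tri_factor_v[OF d(3)] by (metis image_eqI)
  qed
  then have 2: "hom.dim (Hom C U0 Z) = hom.dim ((\<lambda>g. g \<cdot> v) ` Hom C X Z) + hom.dim ((\<lambda>x. x \<cdot> u) ` Hom C U0 Z)"
    using rank_nullity_pre[OF d(4) Hom_finite subset_refl] by simp
  have "{y \<in> Hom C U1 Z. suspm C y \<cdot> w = 0} = (\<lambda>x. x \<cdot> u) ` Hom C U0 Z"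
  proof safe
    fix y assume "y \<in> Hom C U1 Z" "suspm C y \<cdot> w = 0"
    then show "y \<in> (\<lambda>x. x \<cdot> u) ` Hom C U0 Z" using Tri_factor_u[OF d(3)] by (metis image_eqI)
  next
    fix x assume x: "x \<in> Hom C U0 Z"
    show "x \<cdot> u \<in> Hom C U1 Z" using d(4) x by (rule Cmp_in_Hom)
    show "suspm C (x \<cdot> u) \<cdot> w = 0"
      using suspm_Cmp[OF d(4) x] Cmp_assoc[OF d(6) suspm_in_Hom[OF d(4)] suspm_in_Hom[OF x]]
        Tri_comp_wu[OF d(3)] Cmp_0_right[OF suspm_in_Hom[OF x]] by simp
  qed
  moreover have "(\<lambda>y. suspm C y \<cdot> w) ` Hom C U1 Z = ghost X (susp C Z)"
    using susp_fully_faithful[of U1 Z] ghost_eq_w[OF r, of "susp C Z"]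
    unfolding bij_betw_def by (simp add: image_image[symmetric, of "\<lambda>y. y \<cdot> w" "suspm C"])
  ultimately have 3: "hom.dim (Hom C U1 Z) = hom.dim ((\<lambda>x. x \<cdot> u) ` Hom C U0 Z) + hom.dim (ghost X (susp C Z))"
    using rank_nullity(2)[OF ambient_vector_space ambient_vector_space lin_on_connecting[OF d(6)] Hom_finite, of Z] by simp
  show ?thesis unfolding ev_def using 1 2 3 by simp
qed

text \<open>Stated for any family S of subspaces of Hom(?, Z) stable under precomposition, so that
  one argument serves for all maps and for ghosts.\<close>

lemma dim_biproduct:
  assumes b: "is_biproduct C X Y W"
    and S: "\<And>A. fin_dim_subspace (smul C) (S A)" "\<And>A. S A \<subseteq> Hom C A Z"
    and ideal: "\<And>A A' f g. g \<in> S A \<Longrightarrow> f \<in> Hom C A' A \<Longrightarrow> g \<cdot> f \<in> S A'"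
  shows "hom.dim (S W) = hom.dim (S X) + hom.dim (S Y)"
proof -
  obtain i j p q where bi: "i \<in> Hom C X W" "j \<in> Hom C Y W" "p \<in> Hom C W X" "q \<in> Hom C W Y"
    "p \<cdot> i = Id C X" "q \<cdot> j = Id C Y" "q \<cdot> i = 0" "p \<cdot> j = 0" "i \<cdot> p + j \<cdot> q = Id C W"
    using b by (rule is_biproductE)
  have "(\<lambda>g. g \<cdot> i) ` S W = S X"
  proof safe
    show "g \<cdot> i \<in> S X" if "g \<in> S W" for g using ideal[OF that bi(1)] .
    fix h assume h: "h \<in> S X"
    then have hX: "h \<in> Hom C X Z" using S(2) by blast
    then have "h = (h \<cdot> p) \<cdot> i" using Cmp_assoc[OF bi(1,3) hX] bi(5) Cmp_Id_right[OF hX] by simp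
    then show "h \<in> (\<lambda>g. g \<cdot> i) ` S W" using ideal[OF h bi(3)] by (metis image_eqI)
  qed
  moreover have "{g \<in> S W. g \<cdot> i = 0} = (\<lambda>h. h \<cdot> q) ` S Y"
  proof safe
    fix g assume g: "g \<in> S W" "g \<cdot> i = 0"
    then have gW: "g \<in> Hom C W Z" using S(2) by blast
    have "g = g \<cdot> (i \<cdot> p + j \<cdot> q)" using bi(9) Cmp_Id_right[OF gW] by simp
    also have "\<dots> = g \<cdot> (i \<cdot> p) + g \<cdot> (j \<cdot> q)"
      by (rule Cmp_add_right[OF Cmp_in_Hom[OF bi(3,1)] Cmp_in_Hom[OF bi(4,2)] gW])
    also have "\<dots> = (g \<cdot> j) \<cdot> q"
      using Cmp_assoc[OF bi(3,1) gW] Cmp_assoc[OF bi(4,2) gW] g(2) Cmp_0_left[OF bi(3)] by simp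
    finally show "g \<in> (\<lambda>h. h \<cdot> q) ` S Y" using ideal[OF g(1) bi(2)] by (metis image_eqI)
  next
    fix h assume h: "h \<in> S Y"
    then have hY: "h \<in> Hom C Y Z" using S(2) by blast
    show "h \<cdot> q \<in> S W" using ideal[OF h bi(4)] .
    show "h \<cdot> q \<cdot> i = 0" using Cmp_assoc[OF bi(1,4) hY] bi(7) Cmp_0_right[OF hY] by simp
  qed
  moreover have "hom.dim ((\<lambda>h. h \<cdot> q) ` S Y) = hom.dim (S Y)"
  proof (rule dim_inj_image[OF ambient_vector_space ambient_vector_space lin_on_mono[OF lin_on_pre[OF bi(4)] S(2)] S(1)])
    show "inj_on (\<lambda>h. h \<cdot> q) (S Y)"
    proof (rule inj_onI)
      fix h h' assume h: "h \<in> S Y" "h' \<in> S Y" and e: "h \<cdot> q = h' \<cdot> q"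
      then have hY: "h \<in> Hom C Y Z" "h' \<in> Hom C Y Z" using S(2) by auto
      have "x = (x \<cdot> q) \<cdot> j" if "x \<in> Hom C Y Z" for x
        using Cmp_assoc[OF bi(2,4) that] bi(6) Cmp_Id_right[OF that] by simp
      then show "h = h'" using hY e by metis
    qed
  qed
  ultimately show ?thesis using rank_nullity_pre[OF bi(1) S(1) S(2)] by simp
qed

lemma ev_biproduct:
  assumes "is_biproduct C X Y W"
  shows "ev Z W = ev Z X + ev Z Y"
  using dim_biproduct[OF assms, where S = "\<lambda>A. Hom C A Z" and Z = Z] dim_biproduct[OF assms, where S = "\<lambda>A. ghost A Z" and Z = Z]
    dim_biproduct[OF assms, where S = "\<lambda>A. ghost A (susp C Z)" and Z = "susp C Z"]
    Hom_finite ghost_fin_dim ghost_subset ghost_pre Cmp_in_Hom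
  by (simp add: ev_def)

lemma ev_iso:
  assumes "isomorphic C X Y"
  shows "ev Z X = ev Z Y"
proof -
  obtain f where f: "is_iso C X Y f" using assms by (auto simp: isomorphic_def)
  obtain O' where O: "is_zero C O'" using zero_object by blast
  have "ev Z Y = ev Z X + ev Z O'" using ev_biproduct[OF is_biproduct_zero[OF O f]] .
  moreover have "ev Z O' = ev Z O' + ev Z O'" using ev_biproduct[OF is_biproduct_zero[OF O is_iso_Id]] .
  ultimately show ?thesis by simp
qed

text \<open>If \<open>e\<close> is a ghost then \<open>C/ghost(M,Z) \<rightarrow> C/ghost(E,Z) \<rightarrow> C/ghost(L,Z) \<rightarrow> ghost(M,\<Sigma>Z) \<rightarrow> ghost(E,\<Sigma>Z)
  \<rightarrow> ghost(L,\<Sigma>Z)\<close> is exact, with zeros added at both ends.\<close>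

lemma ev_additive:
  assumes t: "Tri C L E M a b e" and e: "e \<in> ghost M (susp C L)"
  shows "ev Z E = ev Z L + ev Z M"
proof -
  have h: "a \<in> Hom C L E" "b \<in> Hom C E M" "e \<in> Hom C M (susp C L)" using Tri_in_Hom[OF t] by auto
  obtain U1 U0 u v w where r: "add_resolution L U1 U0 u v w" by (rule add_resolution_exists)
  note d = add_resolutionD[OF r]
  obtain V1 V0 u' v' w' where r': "add_resolution M V1 V0 u' v' w'" by (rule add_resolution_exists)
  note d' = add_resolutionD[OF r']
  obtain y where y: "y \<in> Hom C (susp C V1) (susp C L)" "e = y \<cdot> w'" using ghostE[OF r' e] .
  \<comment> \<open>Both x and e factor through add \<Sigma>T, so the composite contains a map from
    add \<Sigma>T to add \<Sigma>\<Sigma>T, which is 0 by rigidity.\<close>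
  have kill: "suspm C x \<cdot> e = 0" if x: "x \<in> ghost L A" for x A
  proof -
    obtain z where z: "z \<in> Hom C (susp C U1) A" "x = z \<cdot> w" using ghostE[OF r x] .
    have sw: "suspm C w \<in> Hom C (susp C L) (susp C (susp C U1))" using suspm_in_Hom[OF d(6)] .
    have "suspm C w \<cdot> y = 0" using add_rigid_susp[OF d'(1) d(1) Cmp_in_Hom[OF y(1) sw]] .
    then have "suspm C w \<cdot> e = 0" using y Cmp_assoc[OF d'(6) y(1) sw] Cmp_0_left[OF d'(6)] by simp
    then show ?thesis
      using suspm_Cmp[OF d(6) z(1)] z(2) Cmp_assoc[OF h(3) sw suspm_in_Hom[OF z(1)]]
        Cmp_0_right[OF suspm_in_Hom[OF z(1)]] by simp
  qed
  \<comment> \<open>It suffices to extend the universal ghost w along a; composing this extension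
    with further maps then extends every ghost out of L to a ghost out of E.\<close>
  have "w \<in> ghost L (susp C U1)"
    using ghost_eq_w[OF r, of "susp C U1"] Id_in_Hom Cmp_Id_left[OF d(6)] by (metis image_eqI)
  then obtain t' where t': "t' \<in> Hom C E (susp C U1)" "w = t' \<cdot> a"
    using Tri_factor_u[OF t d(6)] kill by metis
  have t'ghost: "t' \<in> ghost E (susp C U1)"
    using t'(1) Cmp_in_Hom[OF _ t'(1)] d(1) in_add_iff by (auto simp: ghost_def)
  have ghost_ext: "\<exists>g'\<in>ghost E A. g = g' \<cdot> a" if g: "g \<in> ghost L A" for g A
  proof -
    obtain s where s: "s \<in> Hom C (susp C U1) A" "g = s \<cdot> w" using ghostE[OF r g] .
    then show ?thesis using ghost_post[OF t'ghost s(1)] Cmp_assoc[OF h(1) t'(1) s(1)] t'(2) by auto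
  qed
  have onto_b: "\<exists>g\<in>Hom C T E. f = b \<cdot> g" if "f \<in> Hom C T M" for f
    using Tri_lift_v[OF t that] ghostD(2)[OF e that] by metis
  \<comment> \<open>F b is onto because e is a ghost, so ghosts out of M can be detected after
    composing with b.\<close>
  have ghost_b: "g \<in> ghost M A" if g: "g \<in> Hom C M A" "g \<cdot> b \<in> ghost E A" for g A
  proof (rule ghostI[OF g(1)])
    fix f assume "f \<in> Hom C T M"
    then obtain f' where f': "f' \<in> Hom C T E" "f = b \<cdot> f'" using onto_b by blast
    show "g \<cdot> f = 0" using f' Cmp_assoc[OF f'(1) h(2) g(1)] ghostD(2)[OF g(2) f'(1)] by simp
  qed
  have ba: "g \<cdot> b \<cdot> a = 0" if "g \<in> Hom C M A" for g A
    using Cmp_assoc[OF h(1,2) that] Tri_comp_uv[OF t] Cmp_0_right[OF that] by simp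
  let ?SE = "{g \<in> Hom C E Z. g \<cdot> a \<in> ghost L Z}"
  let ?SL = "{g \<in> Hom C L Z. suspm C g \<cdot> e = 0}"
  let ?IM = "{g \<in> ghost M (susp C Z). g \<cdot> b = 0}"
  let ?IE = "{g \<in> ghost E (susp C Z). g \<cdot> a = 0}"
  have "{g \<in> Hom C M Z. g \<cdot> b \<in> ghost E Z} = ghost M Z"
    using ghost_b ghost_pre[OF _ h(2)] ghostD(1) by blast
  moreover have "{x + z |x z. x \<in> (\<lambda>g. g \<cdot> b) ` Hom C M Z \<and> z \<in> ghost E Z} = ?SE"
  proof (intro equalityI subsetI)
    fix x assume "x \<in> {x + z |x z. x \<in> (\<lambda>g. g \<cdot> b) ` Hom C M Z \<and> z \<in> ghost E Z}"
    then obtain g z where gz: "x = g \<cdot> b + z" "g \<in> Hom C M Z" "z \<in> ghost E Z" by blast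
    have "x \<cdot> a = z \<cdot> a"
      using gz Cmp_add_left[OF h(1) Cmp_in_Hom[OF h(2) gz(2)] ghostD(1)[OF gz(3)]] ba[OF gz(2)] by simp
    then show "x \<in> ?SE"
      using gz ghost_pre[OF gz(3) h(1)] Hom_add[OF Cmp_in_Hom[OF h(2) gz(2)] ghostD(1)[OF gz(3)]] by simp
  next
    fix x assume "x \<in> ?SE"
    then have x: "x \<in> Hom C E Z" "x \<cdot> a \<in> ghost L Z" by auto
    obtain z where z: "z \<in> ghost E Z" "x \<cdot> a = z \<cdot> a" using ghost_ext[OF x(2)] by blast
    have zH: "z \<in> Hom C E Z" using ghostD(1)[OF z(1)] .
    have "(x - z) \<cdot> a = 0" using Cmp_diff_left[OF h(1) x(1) zH] z(2) by simp
    then obtain g where g: "g \<in> Hom C M Z" "x - z = g \<cdot> b" using Tri_factor_v[OF t Hom_diff[OF x(1) zH]] by metis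
    have "x = g \<cdot> b + z" using g(2) by (metis diff_add_cancel)
    then show "x \<in> {x + z |x z. x \<in> (\<lambda>g. g \<cdot> b) ` Hom C M Z \<and> z \<in> ghost E Z}"
      using z(1) g(1) by blast
  qed
  ultimately have 1: "hom.dim (Hom C M Z) + hom.dim (ghost E Z) = hom.dim (ghost M Z) + hom.dim ?SE"
    using relative_rank_nullity[OF ambient_vector_space ambient_vector_space lin_on_pre[OF h(2)] Hom_finite Hom_finite
        image_subsetI[OF Cmp_in_Hom[OF h(2)]] ghost_subspace ghost_subset, of Z] by simp
  have "{x + z |x z. x \<in> (\<lambda>g. g \<cdot> a) ` Hom C E Z \<and> z \<in> ghost L Z} = ?SL"
  proof (intro equalityI subsetI)
    fix x assume "x \<in> {x + z |x z. x \<in> (\<lambda>g. g \<cdot> a) ` Hom C E Z \<and> z \<in> ghost L Z}"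
    then obtain g z where gz: "x = g \<cdot> a + z" "g \<in> Hom C E Z" "z \<in> ghost L Z" by blast
    have ga: "g \<cdot> a \<in> Hom C L Z" and zH: "z \<in> Hom C L Z" using Cmp_in_Hom[OF h(1) gz(2)] ghostD(1)[OF gz(3)] by auto
    have "suspm C (g \<cdot> a) \<cdot> e = 0"
      using suspm_Cmp[OF h(1) gz(2)] Cmp_assoc[OF h(3) suspm_in_Hom[OF h(1)] suspm_in_Hom[OF gz(2)]]
        Tri_comp_wu[OF t] Cmp_0_right[OF suspm_in_Hom[OF gz(2)]] by simp
    then have "suspm C x \<cdot> e = 0"
      using gz(1) suspm_add[OF ga zH] Cmp_add_left[OF h(3) suspm_in_Hom[OF ga] suspm_in_Hom[OF zH]] kill[OF gz(3)] by simp
    then show "x \<in> ?SL" using gz(1) Hom_add[OF ga zH] by simp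
  next
    fix x assume "x \<in> ?SL"
    then obtain g where "g \<in> Hom C E Z" "x = g \<cdot> a" using Tri_factor_u[OF t] by blast
    then show "x \<in> {x + z |x z. x \<in> (\<lambda>g. g \<cdot> a) ` Hom C E Z \<and> z \<in> ghost L Z}"
      using hom.subspace_0[OF ghost_subspace] by (intro CollectI exI[of _ x] exI[of _ 0]) auto
  qed
  then have 2: "hom.dim (Hom C E Z) + hom.dim (ghost L Z) = hom.dim ?SE + hom.dim ?SL"
    using relative_rank_nullity[OF ambient_vector_space ambient_vector_space lin_on_pre[OF h(1)] Hom_finite Hom_finite
        image_subsetI[OF Cmp_in_Hom[OF h(1)]] ghost_subspace ghost_subset, of Z] by simp
  have "(\<lambda>g. suspm C g \<cdot> e) ` Hom C L Z = ?IM"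
  proof (intro equalityI subsetI)
    fix x assume "x \<in> (\<lambda>g. suspm C g \<cdot> e) ` Hom C L Z"
    then obtain g where g: "x = suspm C g \<cdot> e" "g \<in> Hom C L Z" by blast
    have sg: "suspm C g \<in> Hom C (susp C L) (susp C Z)" using suspm_in_Hom[OF g(2)] .
    show "x \<in> ?IM"
      using ghost_post[OF e sg] g(1) Cmp_assoc[OF h(2,3) sg] Tri_comp_vw[OF t] Cmp_0_right[OF sg] by simp
  next
    fix x assume x: "x \<in> ?IM"
    then have "x \<in> Hom C M (susp C Z)" "x \<cdot> b = 0" using ghostD(1) by auto
    then obtain g' where g': "g' \<in> Hom C (susp C L) (susp C Z)" "x = g' \<cdot> e" using Tri_factor_w[OF t] by metis
    then show "x \<in> (\<lambda>g. suspm C g \<cdot> e) ` Hom C L Z" by (metis suspm_fullE image_eqI)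
  qed
  then have 3: "hom.dim (Hom C L Z) = hom.dim ?SL + hom.dim ?IM"
    using rank_nullity(2)[OF ambient_vector_space ambient_vector_space lin_on_connecting[OF h(3)] Hom_finite, of Z] by simp
  have "(\<lambda>g. g \<cdot> b) ` ghost M (susp C Z) = ?IE"
  proof (intro equalityI subsetI)
    fix x assume "x \<in> (\<lambda>g. g \<cdot> b) ` ghost M (susp C Z)"
    then show "x \<in> ?IE" using ghost_pre[OF _ h(2)] ba[OF ghostD(1)] by blast
  next
    fix x assume x: "x \<in> ?IE"
    then have "x \<in> Hom C E (susp C Z)" "x \<cdot> a = 0" using ghostD(1) by auto
    then obtain g where "g \<in> Hom C M (susp C Z)" "x = g \<cdot> b" using Tri_factor_v[OF t] by metis
    then show "x \<in> (\<lambda>g. g \<cdot> b) ` ghost M (susp C Z)" using x ghost_b by auto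
  qed
  then have 4: "hom.dim (ghost M (susp C Z)) = hom.dim ?IM + hom.dim ?IE"
    using rank_nullity_pre[OF h(2) ghost_fin_dim ghost_subset, of "susp C Z"] by simp
  have "(\<lambda>g. g \<cdot> a) ` ghost E (susp C Z) = ghost L (susp C Z)"
    using ghost_pre[OF _ h(1)] ghost_ext by blast
  then have 5: "hom.dim (ghost E (susp C Z)) = hom.dim ?IE + hom.dim (ghost L (susp C Z))"
    using rank_nullity_pre[OF h(1) ghost_fin_dim ghost_subset, of "susp C Z"] by simp
  show ?thesis unfolding ev_def using 1 2 3 4 5 by simp
qed

section \<open>Consequences of the Calabi-Yau duality\<close>

lemma dim_suspm_image:
  assumes "hom.subspace S" "S \<subseteq> Hom C X Y"
  shows "hom.dim (suspm C ` S) = hom.dim S"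
  using susp_fully_faithful[of X Y] inj_on_subset[OF _ assms(2)]
  by (intro dim_inj_image[OF ambient_vector_space ambient_vector_space lin_on_mono[OF lin_on_suspm assms(2)]
        hom.fin_dim_subset[OF Hom_finite assms]]) (auto simp: bij_betw_def)

lemma dim_Hom_susp: "dHom (susp C X) (susp C Y) = dHom X Y"
  using dim_suspm_image[OF Hom_subspace subset_refl, of X Y] susp_fully_faithful[of X Y]
  by (simp add: bij_betw_def)

text \<open>For \<open>W \<rightarrow> Z\<close>, being in \<open>coghost W Z\<close> means to factor through \<open>add T\<close>, whereas ghosts are the
  maps factoring through \<open>add \<Sigma>T\<close>.\<close>

definition coghost :: "'o \<Rightarrow> 'o \<Rightarrow> 'm set"
  where "coghost W Z = {g \<in> Hom C W Z. suspm C g \<in> ghost (susp C W) (susp C Z)}"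

lemma coghost_subspace: "hom.subspace (coghost W Z)"
  unfolding coghost_def
  by (rule subspace_preimage_on[OF ambient_vector_space lin_on_suspm Hom_subspace ambient_vector_space ghost_subspace])

lemma suspm_coghost: "suspm C ` coghost W Z = ghost (susp C W) (susp C Z)"
  unfolding coghost_def using susp_fully_faithful[of W Z] ghost_subset[of "susp C W" "susp C Z"]
  by (auto simp: bij_betw_def)

lemma dim_coghost: "hom.dim (coghost W Z) = hom.dim (ghost (susp C W) (susp C Z))"
  using dim_suspm_image[OF coghost_subspace, of W Z W Z] suspm_coghost
  by (simp add: coghost_def)

text \<open>By \<open>dim_Ext1_mod_eq\<close> this is the dimension of Ext^1(F \<Sigma>W, F
  Z).\<close>

abbreviation dext :: "'o \<Rightarrow> 'o \<Rightarrow> int"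
  where "dext W Z \<equiv> int (hom.dim (ghost W Z \<inter> coghost W Z))"

text \<open>\<open>ghost_susp_w\<close> suspended once, which is the form in which
  \<open>two_CY_perp\<close> delivers the annihilator of the multiples of w.\<close>

lemma susp_kernel_eq_ghost:
  assumes r: "add_resolution W U1 U0 u v w"
  shows "{g \<in> Hom C (susp C V) (susp C (susp C W)). suspm C (suspm C w) \<cdot> g = 0} = suspm C ` ghost V (susp C W)"
proof -
  note d = add_resolutionD[OF r]
  have sw: "suspm C w \<in> Hom C (susp C W) (susp C (susp C U1))" using suspm_in_Hom[OF d(6)] .
  have e: "suspm C (suspm C w) \<cdot> suspm C g = 0 \<longleftrightarrow> g \<in> ghost V (susp C W)" if g: "g \<in> Hom C V (susp C W)" for g
    using suspm_Cmp[OF g sw] suspm_eq_0[OF Cmp_in_Hom[OF g sw]] ghost_susp_w[OF r g] by simp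
  show ?thesis
  proof safe
    fix g assume g: "g \<in> Hom C (susp C V) (susp C (susp C W))" "suspm C (suspm C w) \<cdot> g = 0"
    obtain g' where "g' \<in> Hom C V (susp C W)" "g = suspm C g'" using g(1) by (rule suspm_fullE)
    then show "g \<in> suspm C ` ghost V (susp C W)" using e g(2) by auto
  next
    fix g assume g: "g \<in> ghost V (susp C W)"
    then have "g \<in> Hom C V (susp C W)" using ghostD(1) by blast
    then show "suspm C g \<in> Hom C (susp C V) (susp C (susp C W))" "suspm C (suspm C w) \<cdot> suspm C g = 0"
      using suspm_in_Hom e g by auto
  qed
qed

lemma dim_Hom_dual: "dHom X (susp C Y) = dHom Y (susp C X)"
proof -
  obtain perp where p: "\<And>X Y S. hom.subspace S \<Longrightarrow> S \<subseteq> Hom C X Y \<Longrightarrow> hom.subspace (perp X Y S) \<and>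
      perp X Y S \<subseteq> Hom C Y (susp C (susp C X)) \<and> hom.dim (perp X Y S) + hom.dim S = hom.dim (Hom C X Y)"
    "\<And>X Y X' c. c \<in> Hom C X X' \<Longrightarrow> perp X Y ((\<lambda>b. b \<cdot> c) ` Hom C X' Y) =
      {g \<in> Hom C Y (susp C (susp C X)). suspm C (suspm C c) \<cdot> g = 0}"
    by (rule two_CY_perp) blast
  \<comment> \<open>The annihilator of 0 is the whole space. Annihilators are computed for sets of
    multiples of a map c, so 0 is written as the multiples of c = 0.\<close>
  have "(\<lambda>b. b \<cdot> 0) ` Hom C X (susp C Y) = (\<lambda>b. 0) ` Hom C X (susp C Y)"
    using Cmp_0_right by (rule image_cong[OF refl])
  also have "\<dots> = {0}" using Hom_0 by blast
  finally have "(\<lambda>b. b \<cdot> 0) ` Hom C X (susp C Y) = {0}" .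
  then have "perp X (susp C Y) {0} = Hom C (susp C Y) (susp C (susp C X))"
    using p(2)[of 0 X X "susp C Y"] Cmp_0_left by (auto simp: suspm_0)
  then show ?thesis
    using p(1)[OF hom.subspace_single_0, of X "susp C Y"] dim_Hom_susp[of Y "susp C X"] by simp
qed

text \<open>Ghosts out of X are the multiples of w, so their annihilator is the kernel of
  \<Sigma>\<Sigma>w, and this is the suspension of ghost(Y, \<Sigma>X).\<close>

lemma ghost_duality: "dghost X (susp C Y) + dghost Y (susp C X) = dHom X (susp C Y)"
proof -
  obtain perp where p: "\<And>X Y S. hom.subspace S \<Longrightarrow> S \<subseteq> Hom C X Y \<Longrightarrow> hom.subspace (perp X Y S) \<and>
      perp X Y S \<subseteq> Hom C Y (susp C (susp C X)) \<and> hom.dim (perp X Y S) + hom.dim S = hom.dim (Hom C X Y)"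
    "\<And>X Y X' c. c \<in> Hom C X X' \<Longrightarrow> perp X Y ((\<lambda>b. b \<cdot> c) ` Hom C X' Y) =
      {g \<in> Hom C Y (susp C (susp C X)). suspm C (suspm C c) \<cdot> g = 0}"
    by (rule two_CY_perp) blast
  obtain U1 U0 u v w where r: "add_resolution X U1 U0 u v w" by (rule add_resolution_exists)
  have "perp X (susp C Y) (ghost X (susp C Y)) = suspm C ` ghost Y (susp C X)"
    using p(2)[OF add_resolutionD(6)[OF r]] ghost_eq_w[OF r] susp_kernel_eq_ghost[OF r] by simp
  then show ?thesis
    using p(1)[OF ghost_subspace ghost_subset, of X "susp C Y"] dim_suspm_image[OF ghost_subspace ghost_subset, of Y "susp C X"]
    by simp
qed

text \<open>\<open>ghost_eq_w\<close> for \<Sigma>W, desuspended: the connecting map of a triangle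
  for \<Sigma>W has the form \<Sigma>c.\<close>

lemma coghost_eq:
  assumes r: "add_resolution (susp C W) U1 U0 u v (suspm C c)" and c: "c \<in> Hom C W U1"
  shows "coghost W Z = (\<lambda>y. y \<cdot> c) ` Hom C U1 Z"
proof (intro equalityI subsetI)
  fix g assume "g \<in> coghost W Z"
  then have g: "g \<in> Hom C W Z" "suspm C g \<in> ghost (susp C W) (susp C Z)" by (auto simp: coghost_def)
  obtain y' where y': "y' \<in> Hom C (susp C U1) (susp C Z)" "suspm C g = y' \<cdot> suspm C c" using ghostE[OF r g(2)] .
  obtain y where y: "y \<in> Hom C U1 Z" "y' = suspm C y" using y'(1) by (rule suspm_fullE)
  have "g = y \<cdot> c" using suspm_inj[OF g(1) Cmp_in_Hom[OF c y(1)]] suspm_Cmp[OF c y(1)] y' y by simp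
  then show "g \<in> (\<lambda>y. y \<cdot> c) ` Hom C U1 Z" using y by blast
next
  fix g assume "g \<in> (\<lambda>y. y \<cdot> c) ` Hom C U1 Z"
  then obtain y where y: "y \<in> Hom C U1 Z" "g = y \<cdot> c" by blast
  then show "g \<in> coghost W Z"
    using ghost_eq_w[OF r] suspm_Cmp[OF c y(1)] Cmp_in_Hom[OF c y(1)] suspm_in_Hom[OF y(1)] by (auto simp: coghost_def)
qed

text \<open>The annihilator of ghosts plus coghosts W -> \<Sigma>V is the intersection of the two
  annihilators, and this is the suspension of the intersection of ghosts and coghosts V ->
  \<Sigma>W. Inclusion and exclusion for the dimension of the sum gives the formula.\<close>

lemma ext_duality:
  "dext V (susp C W) = dHom W (susp C V) - dghost W (susp C V)
     - dghost (susp C W) (susp C (susp C V)) + dext W (susp C V)"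
proof -
  obtain perp where p: "\<And>X Y S. hom.subspace S \<Longrightarrow> S \<subseteq> Hom C X Y \<Longrightarrow> hom.subspace (perp X Y S) \<and>
      perp X Y S \<subseteq> Hom C Y (susp C (susp C X)) \<and> hom.dim (perp X Y S) + hom.dim S = hom.dim (Hom C X Y)"
    "\<And>X Y X' c. c \<in> Hom C X X' \<Longrightarrow> perp X Y ((\<lambda>b. b \<cdot> c) ` Hom C X' Y) =
      {g \<in> Hom C Y (susp C (susp C X)). suspm C (suspm C c) \<cdot> g = 0}"
    "\<And>X Y S S'. hom.subspace S \<Longrightarrow> hom.subspace S' \<Longrightarrow> S \<subseteq> Hom C X Y \<Longrightarrow> S' \<subseteq> Hom C X Y \<Longrightarrow>
      perp X Y {x + y |x y. x \<in> S \<and> y \<in> S'} = perp X Y S \<inter> perp X Y S'"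
    by (rule two_CY_perp) blast
  obtain U1 U0 u v w where r: "add_resolution W U1 U0 u v w" by (rule add_resolution_exists)
  obtain V1 V0 u' v' w' where r': "add_resolution (susp C W) V1 V0 u' v' w'" by (rule add_resolution_exists)
  obtain c where c: "c \<in> Hom C W V1" "w' = suspm C c" using add_resolutionD(6)[OF r'] by (rule suspm_fullE)
  let ?G = "ghost W (susp C V)" and ?K = "coghost W (susp C V)"
  let ?S = "{x + y |x y. x \<in> ?G \<and> y \<in> ?K}"
  have KH: "?K \<subseteq> Hom C W (susp C V)" by (auto simp: coghost_def)
  have S: "hom.subspace ?S" "?S \<subseteq> Hom C W (susp C V)"
    using hom.subspace_sums[OF ghost_subspace coghost_subspace] Hom_add ghostD(1) KH by blast+
  have "perp W (susp C V) ?G = suspm C ` ghost V (susp C W)"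
    using p(2)[OF add_resolutionD(6)[OF r]] ghost_eq_w[OF r] susp_kernel_eq_ghost[OF r] by simp
  moreover have "perp W (susp C V) ?K = ghost (susp C V) (susp C (susp C W))"
  proof -
    have "{g \<in> Hom C (susp C V) (susp C (susp C W)). suspm C (suspm C c) \<cdot> g = 0} = ghost (susp C V) (susp C (susp C W))"
      using ghost_susp_w[OF r', of _ "susp C V"] ghostD(1) unfolding c(2) by blast
    then show ?thesis using p(2)[OF c(1)] coghost_eq[OF r'[unfolded c(2)] c(1)] by simp
  qed
  ultimately have "perp W (susp C V) ?S = suspm C ` ghost V (susp C W) \<inter> ghost (susp C V) (susp C (susp C W))"
    using p(3)[OF ghost_subspace coghost_subspace ghost_subset KH] by simp
  also have "\<dots> = suspm C ` (ghost V (susp C W) \<inter> coghost V (susp C W))"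
    using ghostD(1) by (auto simp: coghost_def)
  finally have "hom.dim (ghost V (susp C W) \<inter> coghost V (susp C W)) + hom.dim ?S = hom.dim (Hom C W (susp C V))"
    using p(1)[OF S] dim_suspm_image[OF hom.subspace_inter[OF ghost_subspace coghost_subspace] le_infI1[OF ghost_subset],
        of V "susp C W" V "susp C W"] by simp
  moreover have "hom.dim ?S + hom.dim (?G \<inter> ?K) = hom.dim ?G + hom.dim ?K"
    by (rule hom.dim_sum_Int[OF Hom_finite ghost_subspace ghost_subset coghost_subspace KH])
  ultimately show ?thesis using dim_coghost[of W "susp C V"] by linarith
qed

text \<open>The left-hand side will turn out to be the antisymmetrised Euler form of \<open>F \<Sigma>W\<close> and \<open>F \<Sigma>V\<close>.\<close>

lemma euler_ev:
  "dHom (susp C W) (susp C V) - dghost (susp C W) (susp C V) - dext W (susp C V)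
    - (dHom (susp C V) (susp C W) - dghost (susp C V) (susp C W) - dext V (susp C W))
    = ev (susp C V) (susp C W) + ev (susp C V) W"
  unfolding ev_def
  using ext_duality[of V W] ghost_duality[of W "susp C V"] dim_Hom_dual[of W "susp C V"] by linarith

text \<open>By \<open>ghost_duality\<close> the dimensions of the two ghost spaces add up to 1, so
  one of them is the full, one-dimensional space of maps.\<close>

lemma ghost_dichotomy:
  assumes "hom.dim (Hom C L (susp C M)) = 1" "e \<in> Hom C M (susp C L)" "e' \<in> Hom C L (susp C M)"
  shows "e \<in> ghost M (susp C L) \<or> e' \<in> ghost L (susp C M)"
proof -
  have "dghost L (susp C M) = 1 \<or> dghost M (susp C L) = 1"
    using ghost_duality[of L M] assms(1) by linarith
  moreover have "hom.dim (Hom C M (susp C L)) = 1" using dim_Hom_dual[of L M] assms(1) by simp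
  ultimately show ?thesis
    using hom.dim_eq_imp_eq[OF Hom_finite ghost_subspace ghost_subset, of L "susp C M"]
      hom.dim_eq_imp_eq[OF Hom_finite ghost_subspace ghost_subset, of M "susp C L"] assms by auto
qed

section \<open>Triangles whose connecting morphism is not a ghost\<close>

text \<open>The factorization of \<open>F f\<close> through its image lifts to \<open>C\<close>.\<close>

lemma image_factorization:
  assumes f: "f \<in> Hom C X Y"
  obtains D a b where "a \<in> Hom C X D" "b \<in> Hom C D Y" "f = b \<cdot> a"
    "\<And>h. h \<in> Hom C T D \<Longrightarrow> \<exists>h'\<in>Hom C T X. h = a \<cdot> h'"
    "\<And>h. h \<in> Hom C T D \<Longrightarrow> b \<cdot> h = 0 \<Longrightarrow> h = 0"
proof -
  obtain U1 U0 u v w where r: "add_resolution X U1 U0 u v w" by (rule add_resolution_exists)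
  note d = add_resolutionD[OF r]
  have fv: "f \<cdot> v \<in> Hom C U0 Y" using Cmp_in_Hom[OF d(5) f] .
  \<comment> \<open>This is the kernel of F(f v), and F v is onto. The cone D0 of an add T-cover of
    it therefore has F D0 isomorphic to the image of F f.\<close>
  let ?N = "{h \<in> Hom C T U0. f \<cdot> v \<cdot> h = 0}"
  have N: "hom.subspace ?N"
    by (rule subspace_kernel_on[OF ambient_vector_space lin_on_post[OF fv] Hom_subspace ambient_vector_space])
  have act: "h \<cdot> b \<in> ?N" if "h \<in> ?N" "b \<in> Hom C T T" for h b
    using that Cmp_in_Hom[of b T T h U0] Cmp_assoc[of b T T h U0 "f \<cdot> v" Y] fv Cmp_0_left[of b T T] by simp
  obtain U t where U: "in_add C T U" "t \<in> Hom C U U0" "(\<lambda>g. t \<cdot> g) ` Hom C T U = ?N"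
    using Hom_spans_approx[OF N _ act, of U0] by blast
  obtain D0 p s where t: "Tri C U U0 D0 t p s" using Tri_complete[OF U(2)] by blast
  have h: "p \<in> Hom C U0 D0" "s \<in> Hom C D0 (susp C U)" using Tri_in_Hom[OF t] by auto
  have "f \<cdot> v \<cdot> t = 0"
  proof (rule in_add_eqI[OF U(1) Cmp_in_Hom[OF U(2) fv] Hom_0])
    fix g assume g: "g \<in> Hom C T U"
    then have "t \<cdot> g \<in> ?N" using U(3) by blast
    then show "f \<cdot> v \<cdot> t \<cdot> g = 0 \<cdot> g" using Cmp_assoc[OF g U(2) fv] Cmp_0_left[OF g] by simp
  qed
  then obtain b0 where b0: "b0 \<in> Hom C D0 Y" "f \<cdot> v = b0 \<cdot> p" using Tri_factor_v[OF t fv] by metis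
  have pt: "p \<cdot> x = 0" if "x \<in> ?N" for x
  proof -
    obtain g where g: "g \<in> Hom C T U" "x = t \<cdot> g" using \<open>x \<in> ?N\<close> U(3) by blast
    show ?thesis using g Cmp_assoc[OF g(1) U(2) h(1)] Tri_comp_uv[OF t] Cmp_0_left[OF g(1)] by simp
  qed
  have vu: "f \<cdot> v \<cdot> u = 0"
    using Cmp_assoc[OF d(4,5) f] Tri_comp_uv[OF d(3)] Cmp_0_right[OF f] by simp
  have "p \<cdot> u = 0"
  proof (rule in_add_eqI[OF d(1) Cmp_in_Hom[OF d(4) h(1)] Hom_0])
    fix g assume g: "g \<in> Hom C T U1"
    have "u \<cdot> g \<in> ?N" using Cmp_in_Hom[OF g d(4)] Cmp_assoc[OF g d(4) fv] vu Cmp_0_left[OF g] by simp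
    then show "p \<cdot> u \<cdot> g = 0 \<cdot> g" using pt Cmp_assoc[OF g d(4) h(1)] Cmp_0_left[OF g] by simp
  qed
  then obtain a0 where a0: "a0 \<in> Hom C X D0" "p = a0 \<cdot> v" using Tri_factor_v[OF d(3) h(1)] by metis
  have ba0: "b0 \<cdot> a0 \<in> Hom C X Y" using Cmp_in_Hom[OF a0(1) b0(1)] .
  have "(f - b0 \<cdot> a0) \<cdot> v = 0"
    using Cmp_diff_left[OF d(5) f ba0] Cmp_assoc[OF d(5) a0(1) b0(1)] a0(2) b0(2) by simp
  then obtain s' where s': "s' \<in> Hom C (susp C U1) Y" "f - b0 \<cdot> a0 = s' \<cdot> w"
    using Tri_factor_w[OF d(3) Hom_diff[OF f ba0]] by metis
  \<comment> \<open>The difference of f and \<open>b0 \<cdot> a0\<close> kills v, so it is a ghost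
    and factors through w. Adding the summand \<Sigma>U1, on which F vanishes, absorbs it and makes
    the factorisation exact in C.\<close>
  obtain D where "is_biproduct C D0 (susp C U1) D" using biproducts by blast
  then obtain i j p' q where D: "i \<in> Hom C D0 D" "j \<in> Hom C (susp C U1) D" "p' \<in> Hom C D D0" "q \<in> Hom C D (susp C U1)"
    "p' \<cdot> i = Id C D0" "q \<cdot> j = Id C (susp C U1)" "q \<cdot> i = 0" "p' \<cdot> j = 0" "i \<cdot> p' + j \<cdot> q = Id C D"
    by (rule is_biproductE)
  let ?a = "i \<cdot> a0 + j \<cdot> w" and ?b = "b0 \<cdot> p' + s' \<cdot> q"
  have ia: "i \<cdot> a0 \<in> Hom C X D" "j \<cdot> w \<in> Hom C X D" "b0 \<cdot> p' \<in> Hom C D Y" "s' \<cdot> q \<in> Hom C D Y"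
    using Cmp_in_Hom a0(1) b0(1) s'(1) D(1-4) d(6) by blast+
  have a: "?a \<in> Hom C X D" and b: "?b \<in> Hom C D Y" using Hom_add ia by auto
  have bi: "?b \<cdot> i = b0" "?b \<cdot> j = s'"
    using Cmp_add_left[OF D(1) ia(3,4)] Cmp_add_left[OF D(2) ia(3,4)]
      Cmp_assoc[OF D(1,3) b0(1)] Cmp_assoc[OF D(1,4) s'(1)] Cmp_assoc[OF D(2,3) b0(1)] Cmp_assoc[OF D(2,4) s'(1)]
      D(5-8) Cmp_Id_right[OF b0(1)] Cmp_Id_right[OF s'(1)] Cmp_0_right[OF b0(1)] Cmp_0_right[OF s'(1)] by simp_all
  have "?b \<cdot> ?a = b0 \<cdot> a0 + s' \<cdot> w"
    using Cmp_add_right[OF ia(1,2) b] Cmp_assoc[OF a0(1) D(1) b] Cmp_assoc[OF d(6) D(2) b] bi by simp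
  then have fba: "f = ?b \<cdot> ?a" using s'(2) by (simp add: algebra_simps)
  have lift: "\<exists>g\<in>Hom C T U0. x = i \<cdot> (p \<cdot> g)" if x: "x \<in> Hom C T D" for x
  proof -
    have "q \<cdot> x = 0" using Cmp_in_Hom[OF x D(4)] d(1) in_add_iff by auto
    then have "x = i \<cdot> (p' \<cdot> x)"
      using Cmp_Id_left[OF x] D(9) Cmp_add_left[OF x Cmp_in_Hom[OF D(3,1)] Cmp_in_Hom[OF D(4,2)]]
        Cmp_assoc[OF x D(3,1)] Cmp_assoc[OF x D(4,2)] Cmp_0_right[OF D(2)] by simp
    moreover have "p' \<cdot> x \<in> Hom C T D0" using Cmp_in_Hom[OF x D(3)] .
    moreover have "s \<cdot> (p' \<cdot> x) = 0" using Cmp_in_Hom[OF Cmp_in_Hom[OF x D(3)] h(2)] U(1) in_add_iff by auto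
    ultimately show ?thesis using Tri_lift_v[OF t] by metis
  qed
  show ?thesis
  proof (rule that[OF a b fba])
    fix x assume x: "x \<in> Hom C T D"
    obtain g where g: "g \<in> Hom C T U0" "x = i \<cdot> (p \<cdot> g)" using lift[OF x] by blast
    have vg: "v \<cdot> g \<in> Hom C T X" using Cmp_in_Hom[OF g(1) d(5)] .
    have "w \<cdot> (v \<cdot> g) = 0" using Cmp_assoc[OF g(1) d(5,6)] Tri_comp_vw[OF d(3)] Cmp_0_left[OF g(1)] by simp
    then have "?a \<cdot> (v \<cdot> g) = i \<cdot> (a0 \<cdot> (v \<cdot> g))"
      using Cmp_add_left[OF vg ia(1,2)] Cmp_assoc[OF vg a0(1) D(1)] Cmp_assoc[OF vg d(6) D(2)] Cmp_0_right[OF D(2)] by simp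
    also have "\<dots> = x" using g(2) Cmp_assoc[OF g(1) d(5) a0(1)] a0(2) by simp
    finally show "\<exists>h'\<in>Hom C T X. x = ?a \<cdot> h'" using vg by metis
  next
    fix x assume x: "x \<in> Hom C T D" and bx: "?b \<cdot> x = 0"
    obtain g where g: "g \<in> Hom C T U0" "x = i \<cdot> (p \<cdot> g)" using lift[OF x] by blast
    have "f \<cdot> v \<cdot> g = ?b \<cdot> x"
      using g(2) Cmp_assoc[OF Cmp_in_Hom[OF g(1) h(1)] D(1) b] bi(1) Cmp_assoc[OF g(1) h(1) b0(1)] b0(2) by simp
    then have "p \<cdot> g = 0" using pt[of g] g(1) bx by simp
    then show "x = 0" using g(2) Cmp_0_right[OF D(1)] by simp
  qed
qed

text \<open>Factor the desuspended connecting map u' as \<beta> \<alpha> through W. In the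
  octahedron, the connecting maps of A -> \<Sigma>M' -> \<Sigma>W, W -> L -> D' and A -> E -> D' are
  ghosts, because F(\<Sigma>\<alpha>) is onto and F(\<Sigma>\<beta>) is injective. So ev is additive
  on all three triangles, and A and D' cancel.\<close>

lemma ev_triangle:
  assumes t: "Tri C L E M a b e"
  obtains W where "\<And>Z. ev Z L + ev Z M - ev Z E = ev Z (susp C W) + ev Z W"
proof -
  obtain M' u' f g where T0: "Tri C M' L E u' a (g \<cdot> b)" and f: "f \<in> Hom C (susp C M') M" "g \<in> Hom C M (susp C M')"
    "g \<cdot> f = Id C (susp C M')" "f \<cdot> g = Id C M" using Tri_rotate_back[OF t] by metis
  have isoM: "isomorphic C (susp C M') M" using f by (auto simp: isomorphic_def is_iso_def)
  have u': "u' \<in> Hom C M' L" using Tri_in_Hom[OF T0] by simp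
  obtain D a1 b1 where D: "a1 \<in> Hom C (susp C M') D" "b1 \<in> Hom C D (susp C L)" "suspm C u' = b1 \<cdot> a1"
    "\<And>h. h \<in> Hom C T D \<Longrightarrow> \<exists>h'\<in>Hom C T (susp C M'). h = a1 \<cdot> h'"
    "\<And>h. h \<in> Hom C T D \<Longrightarrow> b1 \<cdot> h = 0 \<Longrightarrow> h = 0"
    using image_factorization[OF suspm_in_Hom[OF u']] by metis
  \<comment> \<open>Replacing D by an isomorphic \<Sigma>W allows both factors to be
    desuspended.\<close>
  obtain W k l where W: "k \<in> Hom C (susp C W) D" "l \<in> Hom C D (susp C W)" "l \<cdot> k = Id C (susp C W)" "k \<cdot> l = Id C D"
    by (rule ess_surjE)
  obtain \<alpha> where \<alpha>: "\<alpha> \<in> Hom C M' W" "l \<cdot> a1 = suspm C \<alpha>" using Cmp_in_Hom[OF D(1) W(2)] by (rule suspm_fullE)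
  obtain \<beta> where \<beta>: "\<beta> \<in> Hom C W L" "b1 \<cdot> k = suspm C \<beta>" using Cmp_in_Hom[OF W(1) D(2)] by (rule suspm_fullE)
  have "suspm C (\<beta> \<cdot> \<alpha>) = (b1 \<cdot> k) \<cdot> (l \<cdot> a1)" using suspm_Cmp[OF \<alpha>(1) \<beta>(1)] \<alpha> \<beta> by simp
  also have "\<dots> = b1 \<cdot> (k \<cdot> (l \<cdot> a1))" using Cmp_assoc[OF Cmp_in_Hom[OF D(1) W(2)] W(1) D(2)] by simp
  also have "\<dots> = suspm C u'" using Cmp_assoc[OF D(1) W(2,1)] W(4) Cmp_Id_left[OF D(1)] D(3) by simp
  finally have fac: "u' = \<beta> \<cdot> \<alpha>" using suspm_inj[OF Cmp_in_Hom[OF \<alpha>(1) \<beta>(1)] u'] by simp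
  have onto: "\<exists>h'\<in>Hom C T (susp C M'). h = suspm C \<alpha> \<cdot> h'" if h: "h \<in> Hom C T (susp C W)" for h
  proof -
    obtain h' where h': "h' \<in> Hom C T (susp C M')" "k \<cdot> h = a1 \<cdot> h'" using D(4)[OF Cmp_in_Hom[OF h W(1)]] by blast
    have "h = l \<cdot> (k \<cdot> h)" using Cmp_assoc[OF h W(1,2)] W(3) Cmp_Id_left[OF h] by simp
    then show ?thesis using h' Cmp_assoc[OF h'(1) D(1) W(2)] \<alpha>(2) by auto
  qed
  have mono: "h = 0" if h: "h \<in> Hom C T (susp C W)" "suspm C \<beta> \<cdot> h = 0" for h
  proof -
    have "b1 \<cdot> (k \<cdot> h) = 0" using Cmp_assoc[OF h(1) W(1) D(2)] \<beta>(2) h(2) by simp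
    then have "k \<cdot> h = 0" using D(5)[OF Cmp_in_Hom[OF h(1) W(1)]] by simp
    then show ?thesis using Cmp_assoc[OF h(1) W(1,2)] W(3) Cmp_Id_left[OF h(1)] Cmp_0_right[OF W(2)] by simp
  qed
  obtain A i i' where T1: "Tri C M' W A \<alpha> i i'" using Tri_complete[OF \<alpha>(1)] by blast
  obtain D' j j' where T2: "Tri C W L D' \<beta> j j'" using Tri_complete[OF \<beta>(1)] by blast
  obtain x y where T3: "Tri C A E D' x y (suspm C i \<cdot> j')"
    using octahedral[OF T1 T2 T0[unfolded fac]] by blast
  have i: "i \<in> Hom C W A" and j': "j' \<in> Hom C D' (susp C W)" using Tri_in_Hom[OF T1] Tri_in_Hom[OF T2] by auto
  have "- suspm C i \<in> ghost (susp C W) (susp C A)"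
  proof (rule ghostI)
    show "- suspm C i \<in> Hom C (susp C W) (susp C A)" using suspm_in_Hom[OF i] by simp
    fix h assume "h \<in> Hom C T (susp C W)"
    then obtain h' where h': "h' \<in> Hom C T (susp C M')" "h = suspm C \<alpha> \<cdot> h'" using onto by blast
    have "suspm C i \<cdot> suspm C \<alpha> = 0"
      using suspm_Cmp[OF \<alpha>(1) i] Tri_comp_uv[OF T1] suspm_0 by simp
    then have "(- suspm C i) \<cdot> suspm C \<alpha> = 0"
      using Cmp_minus_left[OF suspm_in_Hom[OF \<alpha>(1)] suspm_in_Hom[OF i]] by simp
    then show "- suspm C i \<cdot> h = 0"
      using h' Cmp_assoc[OF h'(1) suspm_in_Hom[OF \<alpha>(1)] Hom_minus[OF suspm_in_Hom[OF i]]] Cmp_0_left[OF h'(1)] by simp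
  qed
  note 1 = ev_additive[OF Tri_rot2[OF T1] this]
  have gj: "j' \<in> ghost D' (susp C W)"
  proof (rule ghostI[OF j'])
    fix h assume h: "h \<in> Hom C T D'"
    have "suspm C \<beta> \<cdot> (j' \<cdot> h) = 0"
      using Cmp_assoc[OF h j' suspm_in_Hom[OF \<beta>(1)]] Tri_comp_wu[OF T2] Cmp_0_left[OF h] by simp
    then show "j' \<cdot> h = 0" using mono[OF Cmp_in_Hom[OF h j']] by simp
  qed
  note 2 = ev_additive[OF T2 gj]
  note 3 = ev_additive[OF T3 ghost_post[OF gj suspm_in_Hom[OF i]]]
  show ?thesis
  proof (rule that[of W])
    fix Z show "ev Z L + ev Z M - ev Z E = ev Z (susp C W) + ev Z W"
      using 1[of Z] 2[of Z] 3[of Z] ev_iso[OF isoM, of Z] by simp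
  qed
qed

text \<open>Both biproducts are cones of the zero composition \<open>V0 \<rightarrow> X \<rightarrow> \<Sigma> U1\<close>.\<close>

lemma add_resolution_unique:
  assumes r: "add_resolution X U1 U0 u v w" and r': "add_resolution X V1 V0 u' v' w'"
  obtains Q where "is_biproduct C U1 V0 Q" "is_biproduct C V1 U0 Q"
proof -
  note d = add_resolutionD[OF r] and d' = add_resolutionD[OF r']
  have wv: "w \<cdot> v' = 0" using add_rigid[OF d'(2) d(1)] Cmp_in_Hom[OF d'(5) d(6)] by blast
  obtain Y k k' where T: "Tri C V0 (susp C U1) Y (w \<cdot> v') k k'"
    using Tri_complete[OF Cmp_in_Hom[OF d'(5) d(6)]] by blast
  have 1: "is_biproduct C (susp C U1) (susp C V0) Y"
    using Tri_split Tri_rot[OF T] wv suspm_0 by simp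
  \<comment> \<open>The connecting map of the octahedron runs from add \<Sigma>T to add
    \<Sigma>\<Sigma>T, so rigidity makes the third triangle split.\<close>
  have "suspm C w' \<cdot> (- suspm C v) \<in> Hom C (susp C U0) (susp C (susp C V1))"
    by (rule Cmp_in_Hom[OF Hom_minus[OF suspm_in_Hom[OF d(5)]] suspm_in_Hom[OF d'(6)]])
  then have 2: "is_biproduct C (susp C V1) (susp C U0) Y"
    using octahedral_split[OF Tri_rot[OF d'(3)] Tri_rot2[OF d(3)] T] add_rigid_susp[OF d(2) d'(1)] by blast
  obtain Q f g where "f \<in> Hom C (susp C Q) Y" "g \<in> Hom C Y (susp C Q)"
    "g \<cdot> f = Id C (susp C Q)" "f \<cdot> g = Id C Y" by (rule ess_surjE)
  then have "is_iso C Y (susp C Q) g" by (auto simp: is_iso_def)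
  then show ?thesis
    using that is_biproduct_desusp is_biproduct_iso[OF 1] is_biproduct_iso[OF 2] by blast
qed

end

section \<open>Modules over the endomorphism algebra\<close>

lemma fd_moduleD:
  assumes "fd_module B M"
  shows "vector_space (mscale M)" "fin_dim_subspace (mscale M) (mcarr M)"
    "module.subspace (mscale M) (mcarr M)"
    "\<And>x b. x \<in> mcarr M \<Longrightarrow> b \<in> acarr B \<Longrightarrow> mact M x b \<in> mcarr M"
    "\<And>x y b. x \<in> mcarr M \<Longrightarrow> y \<in> mcarr M \<Longrightarrow> b \<in> acarr B \<Longrightarrow> mact M (x + y) b = mact M x b + mact M y b"
    "\<And>x b b'. x \<in> mcarr M \<Longrightarrow> b \<in> acarr B \<Longrightarrow> b' \<in> acarr B \<Longrightarrow> mact M x (b + b') = mact M x b + mact M x b'"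
    "\<And>c x b. x \<in> mcarr M \<Longrightarrow> b \<in> acarr B \<Longrightarrow> mact M (mscale M c x) b = mscale M c (mact M x b)"
    "\<And>c x b. x \<in> mcarr M \<Longrightarrow> b \<in> acarr B \<Longrightarrow> mact M x (ascale B c b) = mscale M c (mact M x b)"
    "\<And>x b b'. x \<in> mcarr M \<Longrightarrow> b \<in> acarr B \<Longrightarrow> b' \<in> acarr B \<Longrightarrow> mact M x (amult B b b') = mact M (mact M x b) b'"
    "\<And>x. x \<in> mcarr M \<Longrightarrow> mact M x (aunit B) = x"
  using assms by (auto simp: fd_module_def fin_dim_subspace_def)

lemma fd_module_closed:
  assumes "fd_module B M"
  shows "0 \<in> mcarr M" "\<And>x y. x \<in> mcarr M \<Longrightarrow> y \<in> mcarr M \<Longrightarrow> x + y \<in> mcarr M"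
    "\<And>x y. x \<in> mcarr M \<Longrightarrow> y \<in> mcarr M \<Longrightarrow> x - y \<in> mcarr M"
    "\<And>c x. x \<in> mcarr M \<Longrightarrow> mscale M c x \<in> mcarr M"
proof -
  interpret vector_space "mscale M" by (rule fd_moduleD(1)[OF assms])
  note s = fd_moduleD(3)[OF assms]
  show "0 \<in> mcarr M" "\<And>x y. x \<in> mcarr M \<Longrightarrow> y \<in> mcarr M \<Longrightarrow> x + y \<in> mcarr M"
    "\<And>x y. x \<in> mcarr M \<Longrightarrow> y \<in> mcarr M \<Longrightarrow> x - y \<in> mcarr M"
    "\<And>c x. x \<in> mcarr M \<Longrightarrow> mscale M c x \<in> mcarr M"
    using s by (auto simp: subspace_0 subspace_add subspace_diff subspace_scale)
qed

lemma mact_0: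
  assumes "fd_module B M" "b \<in> acarr B"
  shows "mact M 0 b = 0"
  using fd_moduleD(5)[OF assms(1), of 0 0 b] fd_module_closed(1)[OF assms(1)] assms(2) by simp

lemma Hom_modI:
  assumes "\<And>x. x \<in> mcarr M \<Longrightarrow> f x \<in> mcarr N" "\<And>x. x \<notin> mcarr M \<Longrightarrow> f x = 0"
    "lin_on (mscale M) (mscale N) (mcarr M) f"
    "\<And>x b. x \<in> mcarr M \<Longrightarrow> b \<in> acarr B \<Longrightarrow> f (mact M x b) = mact N (f x) b"
  shows "f \<in> Hom_mod B M N"
  using assms by (auto simp: Hom_mod_def linear_maps_def lin_on_def)

lemma Hom_modD:
  assumes "f \<in> Hom_mod B M N"
  shows "\<And>x. x \<in> mcarr M \<Longrightarrow> f x \<in> mcarr N" "\<And>x. x \<notin> mcarr M \<Longrightarrow> f x = 0"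
    "lin_on (mscale M) (mscale N) (mcarr M) f"
    "\<And>x y. x \<in> mcarr M \<Longrightarrow> y \<in> mcarr M \<Longrightarrow> f (x + y) = f x + f y"
    "\<And>c x. x \<in> mcarr M \<Longrightarrow> f (mscale M c x) = mscale N c (f x)"
    "\<And>x b. x \<in> mcarr M \<Longrightarrow> b \<in> acarr B \<Longrightarrow> f (mact M x b) = mact N (f x) b"
  using assms by (auto simp: Hom_mod_def linear_maps_def lin_on_def)

lemma Hom_mod_0: "fd_module B M \<Longrightarrow> f \<in> Hom_mod B M N \<Longrightarrow> f 0 = 0"
  using Hom_modD(4)[of f B M N 0 0] fd_module_closed(1) by fastforce

lemma Hom_mod_diff_arg:
  assumes "fd_module B M" "f \<in> Hom_mod B M N" "x \<in> mcarr M" "y \<in> mcarr M"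
  shows "f (x - y) = f x - f y"
proof -
  interpret vector_space "mscale M" by (rule fd_moduleD(1)[OF assms(1)])
  show ?thesis by (rule lin_on_diff[OF Hom_modD(3)[OF assms(2)] fd_moduleD(3)[OF assms(1)] assms(3,4)])
qed

lemma Hom_mod_comp:
  assumes "fd_module B N" "f \<in> Hom_mod B M N" "g \<in> Hom_mod B N L"
  shows "(\<lambda>x. g (f x)) \<in> Hom_mod B M L"
  by (rule Hom_modI)
    (use Hom_modD[OF assms(2)] Hom_modD[OF assms(3)] Hom_mod_0[OF assms(1,3)] in \<open>auto simp: lin_on_def\<close>)

lemma vector_space_pointwise:
  assumes "vector_space (s :: 'k::field \<Rightarrow> 'w::ab_group_add \<Rightarrow> 'w)"
  shows "vector_space (\<lambda>c (f :: 'v \<Rightarrow> 'w) x. s c (f x))"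
proof -
  interpret vector_space s by fact
  show ?thesis
    by unfold_locales (auto simp: fun_eq_iff scale_right_distrib scale_left_distrib)
qed

lemma Hom_mod_id: "fd_module B M \<Longrightarrow> (\<lambda>x. if x \<in> mcarr M then x else 0) \<in> Hom_mod B M M"
  by (rule Hom_modI) (auto simp: lin_on_def fd_module_closed fd_moduleD(4))

lemma Hom_mod_subspace:
  fixes M :: "('k::field, 'v::ab_group_add, 'b::ab_group_add) rmod" and N :: "('k, 'w::ab_group_add, 'b) rmod"
  assumes N: "fd_module B N"
  shows "module.subspace (\<lambda>c f x. mscale N c (f x)) (Hom_mod B M N)"
proof -
  interpret s: vector_space "mscale N" by (rule fd_moduleD(1)[OF N])
  interpret F: vector_space "\<lambda>c (f :: 'v \<Rightarrow> 'w) x. mscale N c (f x)"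
    by (rule vector_space_pointwise[OF fd_moduleD(1)[OF N]])
  show ?thesis
  proof (rule F.subspaceI)
    show "0 \<in> Hom_mod B M N"
      by (intro Hom_modI) (auto simp: lin_on_def fd_module_closed[OF N] mact_0[OF N])
    show "f + g \<in> Hom_mod B M N" if "f \<in> Hom_mod B M N" "g \<in> Hom_mod B M N" for f g
      by (rule Hom_modI)
        (use Hom_modD[OF that(1)] Hom_modD[OF that(2)] in
          \<open>auto simp: lin_on_def fd_module_closed[OF N] fd_moduleD(5)[OF N] s.scale_right_distrib algebra_simps\<close>)
    show "(\<lambda>x. mscale N c (f x)) \<in> Hom_mod B M N" if "f \<in> Hom_mod B M N" for c f
      by (rule Hom_modI)
        (use Hom_modD[OF that(1)] in
          \<open>auto simp: lin_on_def fd_module_closed[OF N] fd_moduleD(7)[OF N] s.scale_right_distrib s.scale_left_commute\<close>)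
  qed
qed

lemma zero_in_Hom_mod:
  fixes M :: "('k::field, 'v::ab_group_add, 'b::ab_group_add) rmod" and N :: "('k, 'w::ab_group_add, 'b) rmod"
  assumes N: "fd_module B N"
  shows "0 \<in> Hom_mod B M N"
proof -
  interpret F: vector_space "\<lambda>c (f :: 'v \<Rightarrow> 'w) x. mscale N c (f x)"
    by (rule vector_space_pointwise[OF fd_moduleD(1)[OF N]])
  show ?thesis by (rule F.subspace_0[OF Hom_mod_subspace[OF N]])
qed

lemma Hom_mod_diff:
  fixes M :: "('k::field, 'v::ab_group_add, 'b::ab_group_add) rmod" and N :: "('k, 'w::ab_group_add, 'b) rmod"
  assumes N: "fd_module B N" and "f \<in> Hom_mod B M N" "g \<in> Hom_mod B M N"
  shows "f - g \<in> Hom_mod B M N"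
proof -
  interpret F: vector_space "\<lambda>c (f :: 'v \<Rightarrow> 'w) x. mscale N c (f x)"
    by (rule vector_space_pointwise[OF fd_moduleD(1)[OF N]])
  show ?thesis by (rule F.subspace_diff[OF Hom_mod_subspace[OF N] assms(2,3)])
qed

lemma fd_module_sub:
  assumes N: "fd_module B N" and S: "submodule_of B N S"
  shows "fd_module B (N\<lparr>mcarr := S\<rparr>)"
proof -
  interpret vector_space "mscale N" by (rule fd_moduleD(1)[OF N])
  have sub: "subspace S" "S \<subseteq> mcarr N" using S by (auto simp: submodule_of_def)
  have "fin_dim_subspace (mscale N) S" using fin_dim_subset[OF fd_moduleD(2)[OF N] sub] .
  then show ?thesis
    using N S sub(2) unfolding fd_module_def submodule_of_def by (auto simp: subset_iff)
qed

lemma submodule_image: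
  assumes "fd_module B M" "fd_module B N" "g \<in> Hom_mod B M N"
  shows "submodule_of B N (g ` mcarr M)"
proof -
  have "mact N (g x) b \<in> g ` mcarr M" if "x \<in> mcarr M" "b \<in> acarr B" for x b
    using Hom_modD(6)[OF assms(3) that] fd_moduleD(4)[OF assms(1) that] by (metis image_eqI)
  then show ?thesis
    using subspace_image_on[OF fd_moduleD(1)[OF assms(1)] Hom_modD(3)[OF assms(3)]
        fd_moduleD(3)[OF assms(1)] fd_moduleD(1)[OF assms(2)]] Hom_modD(1)[OF assms(3)]
    by (auto simp: submodule_of_def)
qed

lemma submodule_kernel:
  assumes "fd_module B M" "fd_module B N" "g \<in> Hom_mod B M N"
  shows "submodule_of B M (map_kernel M g)"
proof -
  show ?thesis
    using subspace_kernel_on[OF fd_moduleD(1)[OF assms(1)] Hom_modD(3)[OF assms(3)]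
        fd_moduleD(3)[OF assms(1)] fd_moduleD(1)[OF assms(2)]]
      Hom_modD(6)[OF assms(3)] fd_moduleD(4)[OF assms(1)] mact_0[OF assms(2)]
    by (auto simp: submodule_of_def map_kernel_def)
qed

text \<open>Projectivity lifts along surjections; here N is cut down to the image of g, which is
  again a finite-dimensional module.\<close>

lemma projective_lift:
  fixes M N P :: "('k::field, 'b::ab_group_add) fmod"
  assumes P: "projective_mod B P" and M: "fd_module B M" and N: "fd_module B N"
    and g: "g \<in> Hom_mod B M N" and f: "f \<in> Hom_mod B P N" and fg: "f ` mcarr P \<subseteq> g ` mcarr M"
  obtains h where "h \<in> Hom_mod B P M" "\<And>x. x \<in> mcarr P \<Longrightarrow> g (h x) = f x"
proof -
  let ?N = "N\<lparr>mcarr := g ` mcarr M\<rparr>"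
  have "fd_module B ?N" by (rule fd_module_sub[OF N submodule_image[OF M N g]])
  moreover have "g \<in> Hom_mod B M ?N" "f \<in> Hom_mod B P ?N"
    using Hom_modD[OF g] Hom_modD[OF f] fg by (auto intro!: Hom_modI)
  moreover have "g ` mcarr M = mcarr ?N" by simp
  ultimately have "\<exists>h\<in>Hom_mod B P M. \<forall>x\<in>mcarr P. g (h x) = f x"
    using P M unfolding projective_mod_def by blast
  then show ?thesis using that by blast
qed

section \<open>Independence of Ext^1 from the projective resolution\<close>

lemma proj_resolutionD:
  assumes "proj_resolution B X P0 P1 P2 \<epsilon> d1 d2"
  shows "projective_mod B P0" "projective_mod B P1" "projective_mod B P2"
    "fd_module B P0" "fd_module B P1" "fd_module B P2"
    "\<epsilon> \<in> Hom_mod B P0 X" "d1 \<in> Hom_mod B P1 P0" "d2 \<in> Hom_mod B P2 P1"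
    "\<epsilon> ` mcarr P0 = mcarr X" "map_kernel P0 \<epsilon> = d1 ` mcarr P1" "map_kernel P1 d1 = d2 ` mcarr P2"
  using assms by (auto simp: proj_resolution_def projective_mod_def)

lemma resolution_comparison:
  assumes X: "fd_module B X"
    and R: "proj_resolution B X P0 P1 P2 \<epsilon> d1 d2" and Q: "proj_resolution B X Q0 Q1 Q2 \<epsilon>' d1' d2'"
  obtains f0 f1 where "f0 \<in> Hom_mod B P0 Q0" "f1 \<in> Hom_mod B P1 Q1"
    "\<And>x. x \<in> mcarr P0 \<Longrightarrow> \<epsilon>' (f0 x) = \<epsilon> x" "\<And>x. x \<in> mcarr P1 \<Longrightarrow> d1' (f1 x) = f0 (d1 x)"
proof -
  note r = proj_resolutionD[OF R] and q = proj_resolutionD[OF Q]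
  have "\<epsilon> ` mcarr P0 \<subseteq> \<epsilon>' ` mcarr Q0" using r(10) q(10) by simp
  then obtain f0 where f0: "f0 \<in> Hom_mod B P0 Q0" "\<And>x. x \<in> mcarr P0 \<Longrightarrow> \<epsilon>' (f0 x) = \<epsilon> x"
    using projective_lift[OF r(1) q(4) X q(7) r(7)] by blast
  have "(\<lambda>x. f0 (d1 x)) ` mcarr P1 \<subseteq> d1' ` mcarr Q1"
  proof
    fix y assume "y \<in> (\<lambda>x. f0 (d1 x)) ` mcarr P1"
    then obtain x where x: "x \<in> mcarr P1" "y = f0 (d1 x)" by blast
    then have "d1 x \<in> map_kernel P0 \<epsilon>" using r(11) by blast
    then have "d1 x \<in> mcarr P0" "\<epsilon> (d1 x) = 0" by (auto simp: map_kernel_def)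
    then have "y \<in> map_kernel Q0 \<epsilon>'" using x f0 Hom_modD(1)[OF f0(1)] by (simp add: map_kernel_def)
    then show "y \<in> d1' ` mcarr Q1" using q(11) by simp
  qed
  then obtain f1 where "f1 \<in> Hom_mod B P1 Q1" "\<And>x. x \<in> mcarr P1 \<Longrightarrow> d1' (f1 x) = f0 (d1 x)"
    using projective_lift[OF r(2) q(5,4,8) Hom_mod_comp[OF r(4) r(8) f0(1)]] by blast
  then show ?thesis using that f0 by blast
qed

abbreviation cocycles ::
  "('k::field, 'b::ab_group_add) kalgebra \<Rightarrow> ('k, 'b) fmod \<Rightarrow> ('k, 'b) fmod \<Rightarrow> ('k, 'b) fmod \<Rightarrow>
    ('k poly \<Rightarrow> 'k poly) \<Rightarrow> ('k poly \<Rightarrow> 'k poly) set"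
  where "cocycles B P1 P2 Y d2 \<equiv> {h \<in> Hom_mod B P1 Y. \<forall>x\<in>mcarr P2. h (d2 x) = 0}"

abbreviation coboundaries ::
  "('k::field, 'b::ab_group_add) kalgebra \<Rightarrow> ('k, 'b) fmod \<Rightarrow> ('k, 'b) fmod \<Rightarrow>
    ('k poly \<Rightarrow> 'k poly) \<Rightarrow> ('k poly \<Rightarrow> 'k poly) set"
  where "coboundaries B P0 Y d1 \<equiv> (\<lambda>h. h \<circ> d1) ` Hom_mod B P0 Y"

lemma cocycles_coboundaries:
  fixes Y :: "('k::field, 'b::ab_group_add) fmod"
  assumes Y: "fd_module B Y" and R: "proj_resolution B X P0 P1 P2 \<epsilon> d1 d2"
  shows "module.subspace (\<lambda>c f x. mscale Y c (f x)) (cocycles B P1 P2 Y d2)"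
    "module.subspace (\<lambda>c f x. mscale Y c (f x)) (coboundaries B P0 Y d1)"
    "coboundaries B P0 Y d1 \<subseteq> cocycles B P1 P2 Y d2"
proof -
  note r = proj_resolutionD[OF R]
  interpret s: vector_space "mscale Y" by (rule fd_moduleD(1)[OF Y])
  interpret F: vector_space "\<lambda>c (f :: 'k poly \<Rightarrow> 'k poly) x. mscale Y c (f x)"
    by (rule vector_space_pointwise[OF fd_moduleD(1)[OF Y]])
  show "F.subspace (cocycles B P1 P2 Y d2)"
  proof -
    note H = Hom_mod_subspace[OF Y, of P1]
    show ?thesis
      by (rule F.subspaceI)
        (simp_all add: F.subspace_0[OF H] F.subspace_add[OF H] F.subspace_scale[OF H])
  qed
  have l: "lin_on (\<lambda>c f x. mscale Y c (f x)) (\<lambda>c f x. mscale Y c (f x)) (Hom_mod B P0 Y) (\<lambda>h. h \<circ> d1)"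
    by (rule lin_onI) (auto simp: fun_eq_iff)
  show "F.subspace (coboundaries B P0 Y d1)"
    by (rule subspace_image_on[OF F.vector_space_axioms l Hom_mod_subspace[OF Y] F.vector_space_axioms])
  have "d1 (d2 x) = 0" if "x \<in> mcarr P2" for x
    using r(12) that by (auto simp: map_kernel_def)
  then show "coboundaries B P0 Y d1 \<subseteq> cocycles B P1 P2 Y d2"
    using Hom_mod_comp[OF r(4) r(8)] Hom_mod_0[OF r(4)] by (auto simp: comp_def)
qed

text \<open>The first cohomology computed with P is at most as large as that computed with Q,
  written with sums instead of differences; exchanging the resolutions gives equality. Pulling back
  along f1 maps cocycles to cocycles and is onto modulo coboundaries, because f followed by g is
  homotopic to the identity.\<close>

lemma Ext1_dim_le:
  fixes Y :: "('k::field, 'b::ab_group_add) fmod"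
  assumes X: "fd_module B X" and Y: "fd_module B Y"
    and R: "proj_resolution B X P0 P1 P2 \<epsilon> d1 d2" and Q: "proj_resolution B X Q0 Q1 Q2 \<epsilon>' d1' d2'"
    and finP: "fin_dim_subspace (\<lambda>c f x. mscale Y c (f x)) (Hom_mod B P1 Y)"
    and finQ: "fin_dim_subspace (\<lambda>c f x. mscale Y c (f x)) (Hom_mod B Q1 Y)"
  shows "maps_dim Y (cocycles B P1 P2 Y d2) + maps_dim Y (coboundaries B Q0 Y d1')
    \<le> maps_dim Y (cocycles B Q1 Q2 Y d2') + maps_dim Y (coboundaries B P0 Y d1)"
proof -
  note r = proj_resolutionD[OF R] and q = proj_resolutionD[OF Q]
  note cr = cocycles_coboundaries[OF Y R] and cq = cocycles_coboundaries[OF Y Q]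
  let ?sc = "\<lambda>c (f :: 'k poly \<Rightarrow> 'k poly) x. mscale Y c (f x)"
  let ?ZP = "cocycles B P1 P2 Y d2" and ?BP = "coboundaries B P0 Y d1"
  let ?ZQ = "cocycles B Q1 Q2 Y d2'" and ?BQ = "coboundaries B Q0 Y d1'"
  interpret F: vector_space ?sc by (rule vector_space_pointwise[OF fd_moduleD(1)[OF Y]])
  obtain f0 f1 where f: "f0 \<in> Hom_mod B P0 Q0" "f1 \<in> Hom_mod B P1 Q1"
    "\<And>x. x \<in> mcarr P0 \<Longrightarrow> \<epsilon>' (f0 x) = \<epsilon> x" "\<And>x. x \<in> mcarr P1 \<Longrightarrow> d1' (f1 x) = f0 (d1 x)"
    using resolution_comparison[OF X R Q] by metis
  obtain g0 g1 where g: "g0 \<in> Hom_mod B Q0 P0" "g1 \<in> Hom_mod B Q1 P1"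
    "\<And>x. x \<in> mcarr Q0 \<Longrightarrow> \<epsilon> (g0 x) = \<epsilon>' x" "\<And>x. x \<in> mcarr Q1 \<Longrightarrow> d1 (g1 x) = g0 (d1' x)"
    using resolution_comparison[OF X Q R] by metis
  let ?i = "\<lambda>x. if x \<in> mcarr P0 then x else 0"
  \<comment> \<open>The identity and g0 f0 both cover the identity of X, so their difference lands
    in the kernel of \<epsilon>, the image of d1; lifting it through d1 gives the homotopy
    s.\<close>
  let ?k = "?i - (\<lambda>x. g0 (f0 x))"
  have k: "?k \<in> Hom_mod B P0 P0"
    by (rule Hom_mod_diff[OF r(4) Hom_mod_id[OF r(4)] Hom_mod_comp[OF q(4) f(1) g(1)]])
  have "?k ` mcarr P0 \<subseteq> d1 ` mcarr P1"
  proof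
    fix y assume "y \<in> ?k ` mcarr P0"
    then obtain x where x: "x \<in> mcarr P0" "y = x - g0 (f0 x)" by auto
    have gx: "g0 (f0 x) \<in> mcarr P0" using Hom_modD(1)[OF g(1) Hom_modD(1)[OF f(1) x(1)]] .
    have "\<epsilon> y = 0"
      using x Hom_mod_diff_arg[OF r(4,7) x(1) gx] f(3)[OF x(1)] g(3)[OF Hom_modD(1)[OF f(1) x(1)]] by simp
    then have "y \<in> map_kernel P0 \<epsilon>" using x gx fd_module_closed(3)[OF r(4)] by (simp add: map_kernel_def)
    then show "y \<in> d1 ` mcarr P1" using r(11) by simp
  qed
  then obtain s where s: "s \<in> Hom_mod B P0 P1" "\<And>x. x \<in> mcarr P0 \<Longrightarrow> d1 (s x) = ?k x"
    using projective_lift[OF r(1) r(5) r(4) r(8) k] by blast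
  have kill: "h' (f1 (d2 x)) = 0" if h': "h' \<in> ?ZQ" and x: "x \<in> mcarr P2" for h' x
  proof -
    have "d2 x \<in> map_kernel P1 d1" using r(12) x by blast
    then have d: "d2 x \<in> mcarr P1" "d1 (d2 x) = 0" by (auto simp: map_kernel_def)
    have "f1 (d2 x) \<in> map_kernel Q1 d1'"
      using d f(4)[OF d(1)] Hom_modD(1)[OF f(2) d(1)] Hom_mod_0[OF r(4) f(1)] by (simp add: map_kernel_def)
    then show ?thesis using q(12) h' by auto
  qed
  have into: "(\<lambda>h. h \<circ> f1) ` ?ZQ \<subseteq> ?ZP"
    using Hom_mod_comp[OF q(5) f(2)] kill by (auto simp: comp_def)
  have homotopy: "h - ((h \<circ> g1) \<circ> f1) \<in> ?BP" if h: "h \<in> ?ZP" for h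
  proof -
    have hH: "h \<in> Hom_mod B P1 Y" using h by simp
    have "(h - ((h \<circ> g1) \<circ> f1)) x = ((\<lambda>x. h (s x)) \<circ> d1) x" for x
    proof (cases "x \<in> mcarr P1")
      case True
      let ?y = "g1 (f1 x)" and ?z = "s (d1 x)"
      have d1x: "d1 x \<in> mcarr P0" using Hom_modD(1)[OF r(8) True] .
      have f1x: "f1 x \<in> mcarr Q1" using Hom_modD(1)[OF f(2) True] .
      have m: "?y \<in> mcarr P1" "?z \<in> mcarr P1" "x - ?y \<in> mcarr P1" "x - ?y - ?z \<in> mcarr P1"
        using Hom_modD(1)[OF g(2) f1x] Hom_modD(1)[OF s(1) d1x] True fd_module_closed(3)[OF r(5)] by auto
      \<comment> \<open>Once the homotopy term is subtracted, x - g1 (f1 x) becomes a cycle, hence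
        an element of the image of d2, where the cocycle h vanishes.\<close>
      have "d1 (x - ?y - ?z) = d1 x - d1 ?y - d1 ?z"
        using Hom_mod_diff_arg[OF r(5,8) m(3,2)] Hom_mod_diff_arg[OF r(5,8) True m(1)] by simp
      also have "\<dots> = 0" using s(2)[OF d1x] d1x g(4)[OF f1x] f(4)[OF True] by simp
      finally have "x - ?y - ?z \<in> map_kernel P1 d1" using m(4) by (simp add: map_kernel_def)
      then have "h (x - ?y - ?z) = 0" using r(12) h by auto
      then show ?thesis
        using Hom_mod_diff_arg[OF r(5) hH m(3,2)] Hom_mod_diff_arg[OF r(5) hH True m(1)] by simp
    next
      case False
      then show ?thesis
        using Hom_modD(2)[OF hH] Hom_modD(2)[OF f(2)] Hom_modD(2)[OF r(8)] Hom_mod_0[OF q(5) g(2)]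
          Hom_mod_0[OF r(5) hH] Hom_mod_0[OF r(4) s(1)] by simp
    qed
    then have "h - ((h \<circ> g1) \<circ> f1) = (\<lambda>x. h (s x)) \<circ> d1" by (rule ext)
    then show ?thesis using Hom_mod_comp[OF r(5) s(1) hH] by blast
  qed
  have pullback: "h \<circ> g1 \<in> ?ZQ" if h: "h \<in> ?ZP" for h
  proof -
    have "h (g1 (d2' x)) = 0" if x: "x \<in> mcarr Q2" for x
    proof -
      have "d2' x \<in> map_kernel Q1 d1'" using q(12) x by blast
      then have d: "d2' x \<in> mcarr Q1" "d1' (d2' x) = 0" by (auto simp: map_kernel_def)
      have "g1 (d2' x) \<in> map_kernel P1 d1"
        using d g(4)[OF d(1)] Hom_modD(1)[OF g(2) d(1)] Hom_mod_0[OF q(4) g(1)] by (simp add: map_kernel_def)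
      then show ?thesis using r(12) h by auto
    qed
    then show ?thesis using Hom_mod_comp[OF r(5) g(2)] h by (auto simp: comp_def)
  qed
  have l: "lin_on ?sc ?sc ?ZQ (\<lambda>h. h \<circ> f1)" by (rule lin_onI) (auto simp: fun_eq_iff)
  have fZ: "fin_dim_subspace ?sc ?ZQ" "fin_dim_subspace ?sc ?ZP"
    using F.fin_dim_subset[OF finQ cq(1)] F.fin_dim_subset[OF finP cr(1)] by auto
  have "?ZP \<subseteq> {x + y |x y. x \<in> (\<lambda>h. h \<circ> f1) ` ?ZQ \<and> y \<in> ?BP}"
  proof
    fix h assume h: "h \<in> ?ZP"
    have "h = ((h \<circ> g1) \<circ> f1) + (h - ((h \<circ> g1) \<circ> f1))"
      by (subst add.commute) (rule diff_add_cancel[symmetric])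
    then show "h \<in> {x + y |x y. x \<in> (\<lambda>h. h \<circ> f1) ` ?ZQ \<and> y \<in> ?BP}"
      using homotopy[OF h] pullback[OF h] by blast
  qed
  moreover have "{x + y |x y. x \<in> (\<lambda>h. h \<circ> f1) ` ?ZQ \<and> y \<in> ?BP} \<subseteq> ?ZP"
  proof (rule subsetI)
    fix h assume "h \<in> {x + y |x y. x \<in> (\<lambda>h. h \<circ> f1) ` ?ZQ \<and> y \<in> ?BP}"
    then obtain x y where h: "h = x + y" and "x \<in> (\<lambda>h. h \<circ> f1) ` ?ZQ" "y \<in> ?BP" by blast
    then have "x \<in> ?ZP" "y \<in> ?ZP" using into cr(3) by (blast, blast)
    then show "h \<in> ?ZP" unfolding h by (rule F.subspace_add[OF cr(1)])
  qed
  ultimately have sumeq: "{x + y |x y. x \<in> (\<lambda>h. h \<circ> f1) ` ?ZQ \<and> y \<in> ?BP} = ?ZP" by blast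
  let ?K = "{h \<in> ?ZQ. h \<circ> f1 \<in> ?BP}"
  have rr: "F.dim ?ZQ + F.dim ?BP = F.dim ?K + F.dim ?ZP"
    using relative_rank_nullity[OF F.vector_space_axioms F.vector_space_axioms l fZ into cr(2,3)] sumeq by simp
  have "?BQ \<subseteq> ?K"
  proof
    fix h assume h: "h \<in> ?BQ"
    then obtain h0 where h0: "h0 \<in> Hom_mod B Q0 Y" "h = h0 \<circ> d1'" by blast
    have "(h \<circ> f1) x = ((\<lambda>x. h0 (f0 x)) \<circ> d1) x" for x
    proof (cases "x \<in> mcarr P1")
      case True
      then show ?thesis using h0 f(4) by simp
    next
      case False
      then show ?thesis
        using h0 Hom_modD(2)[OF f(2)] Hom_modD(2)[OF r(8)] Hom_mod_0[OF q(5,8)] Hom_mod_0[OF r(4) f(1)] by simp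
    qed
    then have "h \<circ> f1 = (\<lambda>x. h0 (f0 x)) \<circ> d1" by (rule ext)
    then have "h \<circ> f1 \<in> ?BP" using Hom_mod_comp[OF q(4) f(1) h0(1)] by blast
    then show "h \<in> ?K" using h cq(3) by blast
  qed
  moreover have K: "F.subspace ?K"
    by (rule subspace_preimage_on[OF F.vector_space_axioms l cq(1) F.vector_space_axioms cr(2)])
  ultimately have "F.dim ?BQ \<le> F.dim ?K"
    using F.dim_mono_fin[OF F.fin_dim_subset[OF fZ(1) K] cq(2)] by blast
  then show ?thesis using rr by (simp add: maps_dim_def)
qed

section \<open>The functor F, full and dense onto finite-dimensional right B-modules\<close>

context cluster_tilted
begin

abbreviation B :: "('k, 'm) kalgebra" where "B \<equiv> End_alg C T"

lemma B_simps [simp]: "acarr B = Hom C T T" "ascale B = smul C" "amult B = Cmp C" "aunit B = Id C T"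
  by (simp_all add: End_alg_def)

text \<open>\<open>represents Z Y \<theta>\<close>: \<open>\<theta>\<close> is an isomorphism of right \<open>B\<close>-modules \<open>F Z \<rightarrow> Y\<close>.\<close>

definition represents :: "'o \<Rightarrow> ('k, 'v::ab_group_add, 'm) rmod \<Rightarrow> ('m \<Rightarrow> 'v) \<Rightarrow> bool"
  where "represents Z Y \<theta> \<longleftrightarrow> vector_space (mscale Y) \<and>
    lin_on (smul C) (mscale Y) (Hom C T Z) \<theta> \<and> bij_betw \<theta> (Hom C T Z) (mcarr Y) \<and>
    (\<forall>h\<in>Hom C T Z. \<forall>b\<in>Hom C T T. \<theta> (h \<cdot> b) = mact Y (\<theta> h) b)"

lemma representsD:
  assumes "represents Z Y \<theta>"
  shows "vector_space (mscale Y)" "lin_on (smul C) (mscale Y) (Hom C T Z) \<theta>"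
    "inj_on \<theta> (Hom C T Z)" "mcarr Y = \<theta> ` Hom C T Z"
    "\<And>h b. h \<in> Hom C T Z \<Longrightarrow> b \<in> Hom C T T \<Longrightarrow> \<theta> (h \<cdot> b) = mact Y (\<theta> h) b"
    "\<theta> 0 = 0"
    "\<And>h. h \<in> Hom C T Z \<Longrightarrow> \<theta> h = 0 \<longleftrightarrow> h = 0"
proof -
  show 1: "vector_space (mscale Y)" "lin_on (smul C) (mscale Y) (Hom C T Z) \<theta>"
    "inj_on \<theta> (Hom C T Z)" "mcarr Y = \<theta> ` Hom C T Z"
    "\<And>h b. h \<in> Hom C T Z \<Longrightarrow> b \<in> Hom C T T \<Longrightarrow> \<theta> (h \<cdot> b) = mact Y (\<theta> h) b"
    using assms by (auto simp: represents_def bij_betw_def)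
  show 2: "\<theta> 0 = 0" using hom.lin_on_zero[OF 1(2) Hom_subspace] .
  show "\<And>h. h \<in> Hom C T Z \<Longrightarrow> \<theta> h = 0 \<longleftrightarrow> h = 0"
    using 2 inj_on_eq_iff[OF 1(3) _ Hom_0] by auto
qed

lemma represents_F: "represents Z (F_mod C T Z) (\<lambda>h. h)"
  by (auto simp: represents_def F_mod_def ambient_vector_space lin_on_def bij_betw_def)

lemma represents_fd_module:
  assumes "represents Z Y \<theta>"
  shows "fd_module B Y"
proof -
  note r = representsD[OF assms]
  have "fin_dim_subspace (mscale Y) (mcarr Y)"
    unfolding r(4) by (rule rank_nullity(1)[OF ambient_vector_space r(1,2) Hom_finite])
  then show ?thesis
    unfolding fd_module_def B_simps r(4)
    using r(1) Cmp_in_Hom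
    by (auto simp: r(5)[symmetric] lin_on_add[OF r(2), symmetric] lin_on_scale[OF r(2), symmetric]
        Hom_add Hom_smul Cmp_add_left Cmp_add_right Cmp_smul_left Cmp_smul_right Cmp_assoc Cmp_Id_right Id_in_Hom)
qed

lemma represents_iso:
  assumes r: "represents Z Y \<theta>" and f: "f \<in> Hom C Z' Z" "g \<in> Hom C Z Z'" "g \<cdot> f = Id C Z'" "f \<cdot> g = Id C Z"
  shows "represents Z' Y (\<lambda>h. \<theta> (f \<cdot> h))"
proof -
  note d = representsD[OF r]
  have fh: "f \<cdot> h \<in> Hom C T Z" if "h \<in> Hom C T Z'" for h using Cmp_in_Hom[OF that f(1)] .
  have gf: "g \<cdot> (f \<cdot> h) = h" if "h \<in> Hom C T Z'" for h
    using Cmp_assoc[OF that f(1,2)] f(3) Cmp_Id_left[OF that] by simp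
  have fg: "f \<cdot> (g \<cdot> h) = h" "g \<cdot> h \<in> Hom C T Z'" if "h \<in> Hom C T Z" for h
    using Cmp_assoc[OF that f(2,1)] f(4) Cmp_Id_left[OF that] Cmp_in_Hom[OF that f(2)] by simp_all
  have "inj_on (\<lambda>h. \<theta> (f \<cdot> h)) (Hom C T Z')"
    by (rule inj_onI) (metis fh gf inj_onD[OF d(3)])
  moreover have "(\<lambda>h. \<theta> (f \<cdot> h)) ` Hom C T Z' = mcarr Y"
    unfolding d(4) using fh fg by (auto simp: image_iff) metis
  ultimately show ?thesis
    unfolding represents_def using d(1)
      lin_on_comp[OF lin_on_post[OF f(1)] d(2) image_subsetI[OF fh]]
    by (auto simp: bij_betw_def Cmp_assoc[OF _ _ f(1)] d(5)[OF fh, symmetric])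
qed

text \<open>F Z is moved into the polynomials by sending a basis to distinct monomials, and the
  action is transported along this injection.\<close>

lemma represents_poly_exists:
  obtains Y :: "('k, 'm) fmod" and \<theta> where "represents Z Y \<theta>"
proof -
  obtain E where E: "finite E" "hom.independent E" "hom.span E = Hom C T Z"
    using hom.fin_dim_basis[OF Hom_finite] by metis
  obtain e :: "'m \<Rightarrow> nat" where e: "inj_on e E" using finite_imp_inj_to_nat_seg[OF E(1)] by metis
  define \<theta> where "\<theta> h = (\<Sum>b\<in>E. monom (hom.representation E h b) (e b))" for h
  have coeff: "coeff (\<theta> h) (e b) = hom.representation E h b" if "b \<in> E" for h b
  proof -
    have "coeff (\<theta> h) (e b) = (\<Sum>b'\<in>E. if b' = b then hom.representation E h b' else 0)"
      unfolding \<theta>_def coeff_sum using e that by (intro sum.cong) (auto dest: inj_onD)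
    then show ?thesis using that E(1) by simp
  qed
  interpret poly: vector_space "smult :: 'k \<Rightarrow> 'k poly \<Rightarrow> 'k poly"
    by unfold_locales (auto simp: smult_add_right smult_add_left)
  have lin: "lin_on (smul C) smult (Hom C T Z) \<theta>"
  proof (rule lin_onI)
    fix h h' assume "h \<in> Hom C T Z" "h' \<in> Hom C T Z"
    then show "\<theta> (h + h') = \<theta> h + \<theta> h'"
      using E by (simp add: \<theta>_def hom.representation_add add_monom[symmetric] sum.distrib)
  next
    fix c h assume "h \<in> Hom C T Z"
    then show "\<theta> (smul C c h) = smult c (\<theta> h)"
      using E by (simp add: \<theta>_def hom.representation_scale smult_monom[symmetric] poly.scale_sum_right)
  qed
  have inj: "inj_on \<theta> (Hom C T Z)"
  proof (rule hom.lin_on_inj[OF lin Hom_subspace])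
    fix h assume h: "h \<in> Hom C T Z" "\<theta> h = 0"
    have "hom.representation E h b = 0" for b
      using coeff[of b h] h(2) hom.representation_ne_zero[of E h b] by (cases "b \<in> E") auto
    then show "h = 0"
      using hom.sum_nonzero_representation_eq[OF E(2), of h] h(1) E(3) by simp
  qed
  let ?inv = "inv_into (Hom C T Z) \<theta>"
  define Y :: "('k, 'm) fmod"
    where "Y = \<lparr>mcarr = \<theta> ` Hom C T Z, mscale = smult, mact = (\<lambda>y b. \<theta> (?inv y \<cdot> b))\<rparr>"
  have "represents Z Y \<theta>"
    using poly.vector_space_axioms lin inj by (auto simp: represents_def Y_def bij_betw_def)
  then show ?thesis by (rule that)
qed

text \<open>A module with generators \<open>y\<^sub>a\<close> is represented by the cone of a presentation \<open>T\<^sup>e \<rightarrow> T\<^sup>d\<close> of it.\<close>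

lemma represents_exists:
  fixes Y :: "('k, 'v::ab_group_add, 'm) rmod"
  assumes Y: "fd_module B Y"
  obtains Z \<theta> where "represents Z Y \<theta>"
proof -
  note m = fd_moduleD[OF Y, unfolded B_simps] and cl = fd_module_closed[OF Y]
  interpret s: vector_space "mscale Y" by (rule m(1))
  obtain A where A0: "finite A" "mcarr Y = s.span A"
    using m(2) by (auto simp: fin_dim_subspace_def)
  obtain d :: nat and y where "A = y ` {i. i < d}"
    using finite_imp_nat_seg_image_inj_on[OF A0(1)] by blast
  then have A: "mcarr Y = s.span (y ` {..<d})"
    using A0(2) by (simp add: lessThan_def)
  have yY: "y a \<in> mcarr Y" if "a < d" for a using that A s.span_base by auto
  obtain W where W: "is_direct_sum C {..<d} (\<lambda>_. T) W" using direct_power_exists by blast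
  then obtain i p where ip: "\<forall>a\<in>{..<d}. i a \<in> Hom C T W \<and> p a \<in> Hom C W T"
    "\<forall>a\<in>{..<d}. \<forall>b\<in>{..<d}. p a \<cdot> i b = (if a = b then Id C T else 0)"
    unfolding is_direct_sum_def by blast
  obtain O' where O: "is_zero C O'" using zero_object by blast
  have WT: "in_add C T W"
    unfolding in_add_def using W is_biproduct_zero[OF O is_iso_Id] by blast
  \<comment> \<open>The module map from F W, with W = T^d, to Y that sends the a-th generator to
    \<open>y a\<close>; vectors spanning Y over k serve as generators.\<close>
  define \<pi> where "\<pi> h = (\<Sum>a<d. mact Y (y a) (p a \<cdot> h))" for h
  have ph: "p a \<cdot> h \<in> Hom C T T" if "a < d" "h \<in> Hom C T W" for a h
    using ip(1) that Cmp_in_Hom[OF that(2)] by auto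
  have pW: "p a \<in> Hom C W T" if "a < d" for a using ip(1) that by auto
  have \<pi>Y: "\<pi> h \<in> mcarr Y" if "h \<in> Hom C T W" for h
    unfolding \<pi>_def using that ph yY m(4) by (intro s.subspace_sum[OF m(3)]) auto
  have lin: "lin_on (smul C) (mscale Y) (Hom C T W) \<pi>"
  proof (rule lin_onI)
    fix h h' assume h: "h \<in> Hom C T W" "h' \<in> Hom C T W"
    show "\<pi> (h + h') = \<pi> h + \<pi> h'"
      unfolding \<pi>_def sum.distrib[symmetric]
      using Cmp_add_right[OF h pW] m(6)[OF yY ph[OF _ h(1)] ph[OF _ h(2)]] by (intro sum.cong) auto
  next
    fix c h assume h: "h \<in> Hom C T W"
    show "\<pi> (smul C c h) = mscale Y c (\<pi> h)"
      unfolding \<pi>_def s.scale_sum_right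
      using Cmp_smul_right[OF h pW] m(8)[OF yY ph[OF _ h]] by (intro sum.cong) auto
  qed
  have mact_sum: "mact Y (\<Sum>a\<in>I. f a) b = (\<Sum>a\<in>I. mact Y (f a) b)"
    if "b \<in> Hom C T T" "\<And>a. a \<in> I \<Longrightarrow> f a \<in> mcarr Y" for I :: "nat set" and f b
    by (rule s.lin_on_sum[of "mscale Y" "mcarr Y" "\<lambda>x. mact Y x b", OF _ m(3) that(2)])
      (auto intro!: lin_onI simp: m(5,7) that(1))
  have act: "\<pi> (h \<cdot> b) = mact Y (\<pi> h) b" if h: "h \<in> Hom C T W" and b: "b \<in> Hom C T T" for h b
  proof -
    have "\<pi> (h \<cdot> b) = (\<Sum>a<d. mact Y (mact Y (y a) (p a \<cdot> h)) b)"
      unfolding \<pi>_def using Cmp_assoc[OF b h pW] m(9)[OF yY ph[OF _ h] b] by (intro sum.cong) auto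
    also have "\<dots> = mact Y (\<pi> h) b"
      unfolding \<pi>_def using yY ph[OF _ h] m(4) by (intro mact_sum[OF b, symmetric]) auto
    finally show ?thesis .
  qed
  have onto: "\<pi> ` Hom C T W = mcarr Y"
  proof
    show "\<pi> ` Hom C T W \<subseteq> mcarr Y" using \<pi>Y by blast
    have "y b \<in> \<pi> ` Hom C T W" if b: "b < d" for b
    proof -
      have ib: "i b \<in> Hom C T W" using ip(1) b by auto
      have z: "mact Y x 0 = 0" if "x \<in> mcarr Y" for x
        using m(6)[OF that, of 0 0] by simp
      have "\<pi> (i b) = (\<Sum>a<d. if a = b then y b else 0)"
        unfolding \<pi>_def using ip(2) b yY m(10) z by (intro sum.cong) auto
      also have "\<dots> = y b" using b by simp
      finally show ?thesis using ib by (metis image_eqI)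
    qed
    moreover have "s.subspace (\<pi> ` Hom C T W)"
      by (rule subspace_image_on[OF ambient_vector_space lin Hom_subspace m(1)])
    ultimately show "mcarr Y \<subseteq> \<pi> ` Hom C T W" unfolding A by (intro s.span_minimal) auto
  qed
  let ?N = "{h \<in> Hom C T W. \<pi> h = 0}"
  have N: "hom.subspace ?N" by (rule subspace_kernel_on[OF ambient_vector_space lin Hom_subspace m(1)])
  have act0: "h \<cdot> b \<in> ?N" if "h \<in> ?N" "b \<in> Hom C T T" for h b
    using that act[of h b] Cmp_in_Hom[of b T T h W] m(5)[OF cl(1,1) that(2)] by simp
  obtain U u where U: "in_add C T U" "u \<in> Hom C U W" "(\<lambda>g. u \<cdot> g) ` Hom C T U = ?N"
    using Hom_spans_approx[OF N _ act0, of W] by blast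
  obtain Z v w where t: "Tri C U W Z u v w" using Tri_complete[OF U(2)] by blast
  have v: "v \<in> Hom C W Z" "w \<in> Hom C Z (susp C U)" using Tri_in_Hom[OF t] by auto
  have lift: "\<exists>g\<in>Hom C T W. h = v \<cdot> g" if h: "h \<in> Hom C T Z" for h
    using Tri_lift_v[OF t h] Cmp_in_Hom[OF h v(2)] U(1) in_add_iff by blast
  have ker: "v \<cdot> g = 0 \<longleftrightarrow> \<pi> g = 0" if g: "g \<in> Hom C T W" for g
  proof
    assume "v \<cdot> g = 0"
    then obtain x where "x \<in> Hom C T U" "g = u \<cdot> x" using Tri_lift_u[OF t g] by metis
    then show "\<pi> g = 0" using U(3) by blast
  next
    assume "\<pi> g = 0"
    then obtain x where x: "x \<in> Hom C T U" "g = u \<cdot> x" using U(3) g by blast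
    then show "v \<cdot> g = 0" using Cmp_assoc[OF x(1) U(2) v(1)] Tri_comp_uv[OF t] Cmp_0_left[OF x(1)] by simp
  qed
  have well: "\<pi> g = \<pi> g'" if g: "g \<in> Hom C T W" "g' \<in> Hom C T W" "v \<cdot> g = v \<cdot> g'" for g g'
    using ker[OF Hom_diff[OF g(1,2)]] Cmp_diff_right[OF g(1,2) v(1)] g(3)
      hom.lin_on_diff[OF lin Hom_subspace g(1,2)] by simp
  \<comment> \<open>F v is onto and has the same kernel as \<pi>, so \<pi> descends to F Z; sec
    picks preimages under F v.\<close>
  define sec where "sec h = (SOME g. g \<in> Hom C T W \<and> h = v \<cdot> g)" for h
  have sec: "sec h \<in> Hom C T W" "h = v \<cdot> sec h" if "h \<in> Hom C T Z" for h
    using someI_ex[of "\<lambda>g. g \<in> Hom C T W \<and> h = v \<cdot> g"] lift[OF that] unfolding sec_def by auto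
  define \<theta> where "\<theta> h = \<pi> (sec h)" for h
  have \<theta>: "\<theta> (v \<cdot> g) = \<pi> g" if "g \<in> Hom C T W" for g
    unfolding \<theta>_def using well[OF sec(1) that] sec(2) Cmp_in_Hom[OF that v(1)] by metis
  have "represents Z Y \<theta>"
    unfolding represents_def
  proof (intro conjI ballI)
    show "vector_space (mscale Y)" by (rule m(1))
    show lt: "lin_on (smul C) (mscale Y) (Hom C T Z) \<theta>"
    proof (rule lin_onI)
      fix h h' assume "h \<in> Hom C T Z" "h' \<in> Hom C T Z"
      then obtain g g' where g: "g \<in> Hom C T W" "g' \<in> Hom C T W" "h = v \<cdot> g" "h' = v \<cdot> g'" using lift by metis
      then show "\<theta> (h + h') = \<theta> h + \<theta> h'"
        using Cmp_add_right[OF g(1,2) v(1)] \<theta>[OF Hom_add[OF g(1,2)]] \<theta>[OF g(1)] \<theta>[OF g(2)] lin_on_add[OF lin g(1,2)] by simp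
    next
      fix c h assume "h \<in> Hom C T Z"
      then obtain g where g: "g \<in> Hom C T W" "h = v \<cdot> g" using lift by metis
      then show "\<theta> (smul C c h) = mscale Y c (\<theta> h)"
        using Cmp_smul_right[OF g(1) v(1)] \<theta>[OF Hom_smul[OF g(1)]] \<theta>[OF g(1)] lin_on_scale[OF lin g(1)] by simp
    qed
    show "bij_betw \<theta> (Hom C T Z) (mcarr Y)"
      unfolding bij_betw_def
    proof
      show "inj_on \<theta> (Hom C T Z)"
        by (rule hom.lin_on_inj[OF lt Hom_subspace]) (metis \<theta> ker lift)
      show "\<theta> ` Hom C T Z = mcarr Y"
      proof
        show "\<theta> ` Hom C T Z \<subseteq> mcarr Y" using \<pi>Y sec(1) by (auto simp: \<theta>_def)
        show "mcarr Y \<subseteq> \<theta> ` Hom C T Z"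
          unfolding onto[symmetric] using \<theta>[symmetric] Cmp_in_Hom[OF _ v(1)] by (auto intro!: image_eqI)
      qed
    qed
    fix h b assume h: "h \<in> Hom C T Z" and b: "b \<in> Hom C T T"
    then obtain g where g: "g \<in> Hom C T W" "h = v \<cdot> g" using lift by metis
    show "\<theta> (h \<cdot> b) = mact Y (\<theta> h) b"
      using g Cmp_assoc[OF b g(1) v(1)] \<theta>[OF Cmp_in_Hom[OF b g(1)]] \<theta>[OF g(1)] act[OF g(1) b] by simp
  qed
  then show ?thesis by (rule that)
qed

text \<open>The duality formulas speak about F \<Sigma>V, and every object is isomorphic to a
  suspension.\<close>

lemma represents_susp_exists:
  fixes Y :: "('k, 'v::ab_group_add, 'm) rmod"
  assumes "fd_module B Y"
  obtains V \<theta> where "represents (susp C V) Y \<theta>"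
proof -
  obtain Z \<theta> where r: "represents Z Y \<theta>" using represents_exists[OF assms] .
  obtain V f g where "f \<in> Hom C (susp C V) Z" "g \<in> Hom C Z (susp C V)"
    "g \<cdot> f = Id C (susp C V)" "f \<cdot> g = Id C Z" by (rule ess_surjE)
  then show ?thesis using represents_iso[OF r] that by blast
qed

text \<open>The module map is first realised on U0, where a dual basis prescribes g0 with F g0 =
  \<eta> F v. This g0 kills u because maps out of add T are determined by F, and therefore it
  factors through v.\<close>

lemma F_full:
  assumes \<eta>: "\<And>h. h \<in> Hom C T X \<Longrightarrow> \<eta> h \<in> Hom C T Z" "lin_on (smul C) (smul C) (Hom C T X) \<eta>"
    "\<And>h b. h \<in> Hom C T X \<Longrightarrow> b \<in> Hom C T T \<Longrightarrow> \<eta> (h \<cdot> b) = \<eta> h \<cdot> b"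
  obtains g where "g \<in> Hom C X Z" "\<And>h. h \<in> Hom C T X \<Longrightarrow> \<eta> h = g \<cdot> h"
proof -
  obtain U1 U0 u v w where r: "add_resolution X U1 U0 u v w" by (rule add_resolution_exists)
  note d = add_resolutionD[OF r]
  obtain n :: nat and q c where qc: "\<And>a. a < n \<Longrightarrow> q a \<in> Hom C T U0" "\<And>a. a < n \<Longrightarrow> c a \<in> Hom C U0 T"
    "(\<Sum>a<n. q a \<cdot> c a) = Id C U0" using in_add_dual_basis[OF d(2)] by metis
  have vq: "v \<cdot> q a \<in> Hom C T X" if "a < n" for a using Cmp_in_Hom[OF qc(1)[OF that] d(5)] .
  have ch: "c a \<cdot> h \<in> Hom C T T" if "a < n" "h \<in> Hom C T U0" for a h using Cmp_in_Hom[OF that(2) qc(2)[OF that(1)]] .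
  define g0 where "g0 = (\<Sum>a<n. \<eta> (v \<cdot> q a) \<cdot> c a)"
  have e: "\<eta> (v \<cdot> q a) \<cdot> c a \<in> Hom C U0 Z" if "a < n" for a
    using Cmp_in_Hom[OF qc(2) \<eta>(1)[OF vq]] that by blast
  have g0: "g0 \<in> Hom C U0 Z" unfolding g0_def using e by (intro Hom_sum) auto
  have g0h: "g0 \<cdot> h = \<eta> (v \<cdot> h)" if h: "h \<in> Hom C T U0" for h
  proof -
    have "g0 \<cdot> h = (\<Sum>a<n. (\<eta> (v \<cdot> q a) \<cdot> c a) \<cdot> h)"
      unfolding g0_def using e by (intro Cmp_sum_left[OF h]) auto
    also have "\<dots> = (\<Sum>a<n. \<eta> ((v \<cdot> q a) \<cdot> (c a \<cdot> h)))"
      using Cmp_assoc[OF h qc(2) \<eta>(1)[OF vq]] \<eta>(3)[OF vq ch[OF _ h]] by (intro sum.cong) auto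
    also have "\<dots> = \<eta> (\<Sum>a<n. (v \<cdot> q a) \<cdot> (c a \<cdot> h))"
      using Cmp_in_Hom[OF ch[OF _ h] vq] by (intro hom.lin_on_sum[OF \<eta>(2) Hom_subspace, symmetric]) auto
    also have "(\<Sum>a<n. (v \<cdot> q a) \<cdot> (c a \<cdot> h)) = (\<Sum>a<n. v \<cdot> ((q a \<cdot> c a) \<cdot> h))"
    proof (rule sum.cong)
      fix a assume "a \<in> {..<n}"
      then have a: "q a \<in> Hom C T U0" "c a \<in> Hom C U0 T" using qc by auto
      show "(v \<cdot> q a) \<cdot> (c a \<cdot> h) = v \<cdot> ((q a \<cdot> c a) \<cdot> h)"
        using Cmp_assoc[OF Cmp_in_Hom[OF h a(2)] a(1) d(5)] Cmp_assoc[OF h a(2,1)] by simp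
    qed simp
    also have "\<dots> = v \<cdot> (\<Sum>a<n. (q a \<cdot> c a) \<cdot> h)"
      using Cmp_in_Hom[OF h Cmp_in_Hom[OF qc(2,1)]] by (intro Cmp_sum_right[OF d(5), symmetric]) auto
    also have "(\<Sum>a<n. (q a \<cdot> c a) \<cdot> h) = (\<Sum>a<n. q a \<cdot> c a) \<cdot> h"
      using Cmp_in_Hom[OF qc(2,1)] by (intro Cmp_sum_left[OF h, symmetric]) auto
    finally show ?thesis using qc(3) Cmp_Id_left[OF h] by simp
  qed
  have "g0 \<cdot> u = 0"
  proof (rule in_add_eqI[OF d(1) Cmp_in_Hom[OF d(4) g0] Hom_0])
    fix h assume h: "h \<in> Hom C T U1"
    have "v \<cdot> (u \<cdot> h) = 0" using Cmp_assoc[OF h d(4,5)] Tri_comp_uv[OF d(3)] Cmp_0_left[OF h] by simp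
    then show "g0 \<cdot> u \<cdot> h = 0 \<cdot> h"
      using Cmp_assoc[OF h d(4) g0] g0h[OF Cmp_in_Hom[OF h d(4)]] hom.lin_on_zero[OF \<eta>(2) Hom_subspace] Cmp_0_left[OF h] by simp
  qed
  then obtain g where g: "g \<in> Hom C X Z" "g0 = g \<cdot> v" using Tri_factor_v[OF d(3) g0] by metis
  have "\<eta> h = g \<cdot> h" if h: "h \<in> Hom C T X" for h
  proof -
    obtain s where s: "s \<in> Hom C T U0" "h = v \<cdot> s" using add_resolution_lift[OF r in_add_T h] .
    then show ?thesis using g0h[OF s(1)] g Cmp_assoc[OF s(1) d(5) g(1)] by simp
  qed
  then show ?thesis using that g(1) by blast
qed

text \<open>The homomorphism \<open>Y1 \<rightarrow> Y2\<close> corresponding to \<open>F g\<close>.\<close>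

definition F_map :: "'o \<Rightarrow> ('k, 'v::ab_group_add, 'm) rmod \<Rightarrow> ('m \<Rightarrow> 'v) \<Rightarrow> ('m \<Rightarrow> 'w::ab_group_add) \<Rightarrow> 'm \<Rightarrow> 'v \<Rightarrow> 'w"
  where "F_map X Y1 \<theta>1 \<theta>2 g = (\<lambda>y. if y \<in> mcarr Y1 then \<theta>2 (g \<cdot> inv_into (Hom C T X) \<theta>1 y) else 0)"

context
  fixes X Z and Y1 :: "('k, 'v::ab_group_add, 'm) rmod" and Y2 :: "('k, 'w::ab_group_add, 'm) rmod" and \<theta>1 \<theta>2
  assumes r1: "represents X Y1 \<theta>1" and r2: "represents Z Y2 \<theta>2"
begin

lemma F_map_apply: "h \<in> Hom C T X \<Longrightarrow> F_map X Y1 \<theta>1 \<theta>2 g (\<theta>1 h) = \<theta>2 (g \<cdot> h)"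
  using representsD[OF r1] by (simp add: F_map_def)

lemma F_map_outside: "y \<notin> mcarr Y1 \<Longrightarrow> F_map X Y1 \<theta>1 \<theta>2 g y = 0"
  by (simp add: F_map_def)

lemma F_map_in_Hom_mod:
  assumes g: "g \<in> Hom C X Z"
  shows "F_map X Y1 \<theta>1 \<theta>2 g \<in> Hom_mod B Y1 Y2"
proof -
  note d1 = representsD[OF r1] and d2 = representsD[OF r2]
  have gh: "g \<cdot> h \<in> Hom C T Z" if "h \<in> Hom C T X" for h using Cmp_in_Hom[OF that g] .
  show ?thesis
  proof (rule Hom_modI)
    show "F_map X Y1 \<theta>1 \<theta>2 g x \<in> mcarr Y2" if "x \<in> mcarr Y1" for x
      using that F_map_apply gh unfolding d1(4) d2(4) by auto
    show "F_map X Y1 \<theta>1 \<theta>2 g x = 0" if "x \<notin> mcarr Y1" for x using F_map_outside[OF that] .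
    show "lin_on (mscale Y1) (mscale Y2) (mcarr Y1) (F_map X Y1 \<theta>1 \<theta>2 g)"
    proof (rule lin_onI)
      fix x y assume "x \<in> mcarr Y1" "y \<in> mcarr Y1"
      then obtain h h' where h: "h \<in> Hom C T X" "h' \<in> Hom C T X" "x = \<theta>1 h" "y = \<theta>1 h'" unfolding d1(4) by blast
      have "F_map X Y1 \<theta>1 \<theta>2 g (\<theta>1 (h + h')) = \<theta>2 (g \<cdot> h) + \<theta>2 (g \<cdot> h')"
        using F_map_apply[OF Hom_add[OF h(1,2)]] Cmp_add_right[OF h(1,2) g] lin_on_add[OF d2(2) gh[OF h(1)] gh[OF h(2)]] by simp
      then show "F_map X Y1 \<theta>1 \<theta>2 g (x + y) = F_map X Y1 \<theta>1 \<theta>2 g x + F_map X Y1 \<theta>1 \<theta>2 g y"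
        using lin_on_add[OF d1(2) h(1,2)] h F_map_apply by simp
    next
      fix c x assume "x \<in> mcarr Y1"
      then obtain h where h: "h \<in> Hom C T X" "x = \<theta>1 h" unfolding d1(4) by blast
      have "F_map X Y1 \<theta>1 \<theta>2 g (\<theta>1 (smul C c h)) = mscale Y2 c (\<theta>2 (g \<cdot> h))"
        using F_map_apply[OF Hom_smul[OF h(1)]] Cmp_smul_right[OF h(1) g] lin_on_scale[OF d2(2) gh[OF h(1)]] by simp
      then show "F_map X Y1 \<theta>1 \<theta>2 g (mscale Y1 c x) = mscale Y2 c (F_map X Y1 \<theta>1 \<theta>2 g x)"
        using lin_on_scale[OF d1(2) h(1)] h F_map_apply by simp
    qed
    fix x b assume "x \<in> mcarr Y1" and "b \<in> acarr B"
    then obtain h where h: "h \<in> Hom C T X" "x = \<theta>1 h" and b: "b \<in> Hom C T T" unfolding d1(4) B_simps by blast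
    then show "F_map X Y1 \<theta>1 \<theta>2 g (mact Y1 x b) = mact Y2 (F_map X Y1 \<theta>1 \<theta>2 g x) b"
      using d1(5)[OF h(1) b] d2(5)[OF gh[OF h(1)] b] F_map_apply[OF h(1)] F_map_apply[OF Cmp_in_Hom[OF b h(1)]]
        Cmp_assoc[OF b h(1) g] by simp
  qed
qed

lemma F_map_surj:
  assumes f: "f \<in> Hom_mod B Y1 Y2"
  obtains g where "g \<in> Hom C X Z" "f = F_map X Y1 \<theta>1 \<theta>2 g"
proof -
  note d1 = representsD[OF r1] and d2 = representsD[OF r2] and m = Hom_modD[OF f]
  define \<eta> where "\<eta> h = inv_into (Hom C T Z) \<theta>2 (f (\<theta>1 h))" for h
  have fY: "f (\<theta>1 h) \<in> \<theta>2 ` Hom C T Z" if "h \<in> Hom C T X" for h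
    using m(1)[of "\<theta>1 h"] that d1(4) d2(4) by auto
  have \<eta>: "\<eta> h \<in> Hom C T Z" "\<theta>2 (\<eta> h) = f (\<theta>1 h)" if "h \<in> Hom C T X" for h
    unfolding \<eta>_def using inv_into_into[OF fY[OF that]] f_inv_into_f[OF fY[OF that]] by auto
  have \<eta>eq: "\<eta> h = k" if "h \<in> Hom C T X" "k \<in> Hom C T Z" "f (\<theta>1 h) = \<theta>2 k" for h k
    using inj_onD[OF d2(3), of "\<eta> h" k] \<eta>[OF that(1)] that by simp
  have tc: "\<theta>1 h \<in> mcarr Y1" if "h \<in> Hom C T X" for h using that d1(4) by blast
  have "lin_on (smul C) (smul C) (Hom C T X) \<eta>"
  proof (rule lin_onI)
    fix h h' assume h: "h \<in> Hom C T X" "h' \<in> Hom C T X"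
    show "\<eta> (h + h') = \<eta> h + \<eta> h'"
      using h \<eta>(1) by (intro \<eta>eq Hom_add)
        (auto simp: lin_on_add[OF d1(2)] lin_on_add[OF d2(2)] m(4) tc \<eta>(2))
  next
    fix c h assume h: "h \<in> Hom C T X"
    show "\<eta> (smul C c h) = smul C c (\<eta> h)"
      using h \<eta>(1) by (intro \<eta>eq Hom_smul)
        (auto simp: lin_on_scale[OF d1(2)] lin_on_scale[OF d2(2)] m(5) tc \<eta>(2))
  qed
  moreover have "\<eta> (h \<cdot> b) = \<eta> h \<cdot> b" if "h \<in> Hom C T X" "b \<in> Hom C T T" for h b
    using that \<eta>[OF that(1)] m(6)[OF tc[OF that(1)], of b]
    by (intro \<eta>eq Cmp_in_Hom[OF that(2)]) (auto simp: d1(5) d2(5))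
  ultimately obtain g where g: "g \<in> Hom C X Z" "\<And>h. h \<in> Hom C T X \<Longrightarrow> \<eta> h = g \<cdot> h"
    using F_full[of X \<eta> Z] \<eta>(1) by blast
  have "f y = F_map X Y1 \<theta>1 \<theta>2 g y" for y
  proof (cases "y \<in> mcarr Y1")
    case True
    then obtain h where h: "h \<in> Hom C T X" "y = \<theta>1 h" unfolding d1(4) by blast
    then show ?thesis using F_map_apply[OF h(1)] g(2)[OF h(1)] \<eta>(2)[OF h(1)] by simp
  next
    case False
    then show ?thesis using m(2) F_map_outside by simp
  qed
  then show ?thesis using that g(1) by blast
qed

lemma F_map_eq_0:
  assumes g: "g \<in> Hom C X Z"
  shows "F_map X Y1 \<theta>1 \<theta>2 g = 0 \<longleftrightarrow> g \<in> ghost X Z"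
proof -
  note d1 = representsD[OF r1] and d2 = representsD[OF r2]
  have "F_map X Y1 \<theta>1 \<theta>2 g = 0 \<longleftrightarrow> (\<forall>y\<in>mcarr Y1. F_map X Y1 \<theta>1 \<theta>2 g y = 0)"
    using F_map_outside by (auto simp: fun_eq_iff)
  also have "\<dots> \<longleftrightarrow> (\<forall>h\<in>Hom C T X. g \<cdot> h = 0)"
    unfolding d1(4) using F_map_apply d2(7)[OF Cmp_in_Hom[OF _ g]] by simp
  finally show ?thesis using g by (simp add: ghost_def)
qed

lemma lin_on_F_map:
  "lin_on (smul C) (\<lambda>c f x. mscale Y2 c (f x)) (Hom C X Z) (F_map X Y1 \<theta>1 \<theta>2)"
proof -
  note d1 = representsD[OF r1] and d2 = representsD[OF r2]
  interpret s: vector_space "mscale Y2" by (rule d2(1))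
  have inv: "inv_into (Hom C T X) \<theta>1 y \<in> Hom C T X" if "y \<in> mcarr Y1" for y
    using that d1(4) inv_into_into by metis
  show ?thesis
  proof (rule lin_onI)
    fix g g' assume g: "g \<in> Hom C X Z" "g' \<in> Hom C X Z"
    show "F_map X Y1 \<theta>1 \<theta>2 (g + g') = F_map X Y1 \<theta>1 \<theta>2 g + F_map X Y1 \<theta>1 \<theta>2 g'"
      using g by (auto simp: fun_eq_iff F_map_def Cmp_add_left[OF inv] lin_on_add[OF d2(2)] Cmp_in_Hom[OF inv])
  next
    fix c g assume g: "g \<in> Hom C X Z"
    show "F_map X Y1 \<theta>1 \<theta>2 (smul C c g) = (\<lambda>x. mscale Y2 c (F_map X Y1 \<theta>1 \<theta>2 g x))"
      using g by (auto simp: fun_eq_iff F_map_def Cmp_smul_left[OF inv] lin_on_scale[OF d2(2)] Cmp_in_Hom[OF inv])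
  qed
qed

lemma F_map_image: "F_map X Y1 \<theta>1 \<theta>2 ` Hom C X Z = Hom_mod B Y1 Y2"
  using F_map_in_Hom_mod F_map_surj by (metis (no_types, lifting) image_eqI image_subsetI subsetI subset_antisym)

lemma Hom_mod_fin_dim: "fin_dim_subspace (\<lambda>c f x. mscale Y2 c (f x)) (Hom_mod B Y1 Y2)"
  using rank_nullity(1)[OF ambient_vector_space vector_space_pointwise[OF representsD(1)[OF r2]] lin_on_F_map Hom_finite]
  by (simp add: F_map_image)

lemma dim_Hom_mod_eq: "int (dim_Hom_mod B Y1 Y2) = dHom X Z - dghost X Z"
proof -
  have "{g \<in> Hom C X Z. F_map X Y1 \<theta>1 \<theta>2 g = 0} = ghost X Z"
    using F_map_eq_0 ghostD(1) by blast
  then have "hom.dim (Hom C X Z) = hom.dim (ghost X Z) + dim_Hom_mod B Y1 Y2"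
    using rank_nullity(2)[OF ambient_vector_space vector_space_pointwise[OF representsD(1)[OF r2]] lin_on_F_map Hom_finite]
    by (simp add: F_map_image dim_Hom_mod_def maps_dim_def)
  then show ?thesis by simp
qed

text \<open>No nonzero ghost leaves add T, so F is injective on these morphisms.\<close>

lemma F_map_dim_image:
  assumes "in_add C T X" "hom.subspace S" "S \<subseteq> Hom C X Z"
  shows "maps_dim Y2 (F_map X Y1 \<theta>1 \<theta>2 ` S) = hom.dim S"
  unfolding maps_dim_def
proof (rule dim_inj_image[OF ambient_vector_space vector_space_pointwise[OF representsD(1)[OF r2]]])
  show "lin_on (smul C) (\<lambda>c f x. mscale Y2 c (f x)) S (F_map X Y1 \<theta>1 \<theta>2)"
    by (rule lin_on_mono[OF lin_on_F_map assms(3)])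
  then show "inj_on (F_map X Y1 \<theta>1 \<theta>2) S"
    using F_map_eq_0 ghost_in_add[OF assms(1)] assms(2,3) by (intro hom.lin_on_inj) auto
  show "fin_dim_subspace (smul C) S" by (rule hom.fin_dim_subset[OF Hom_finite assms(2,3)])
qed

end

lemma F_map_comp:
  assumes r1: "represents X1 Y1 \<theta>1" and r2: "represents X2 Y2 \<theta>2" and r3: "represents X3 Y3 \<theta>3"
    and g: "g \<in> Hom C X1 X2" and f: "f \<in> Hom C X2 X3"
  shows "F_map X2 Y2 \<theta>2 \<theta>3 f \<circ> F_map X1 Y1 \<theta>1 \<theta>2 g = F_map X1 Y1 \<theta>1 \<theta>3 (f \<cdot> g)"
proof
  fix y
  show "(F_map X2 Y2 \<theta>2 \<theta>3 f \<circ> F_map X1 Y1 \<theta>1 \<theta>2 g) y = F_map X1 Y1 \<theta>1 \<theta>3 (f \<cdot> g) y"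
  proof (cases "y \<in> mcarr Y1")
    case True
    then obtain h where h: "h \<in> Hom C T X1" "y = \<theta>1 h" unfolding representsD(4)[OF r1] by blast
    then show ?thesis
      using F_map_apply[OF r1 r2 h(1)] F_map_apply[OF r2 r3 Cmp_in_Hom[OF h(1) g]] F_map_apply[OF r1 r3 h(1)]
        Cmp_assoc[OF h(1) g f] by simp
  next
    case False
    then show ?thesis
      using F_map_outside[OF r1 r2] F_map_outside[OF r1 r3]
        Hom_mod_0[OF represents_fd_module[OF r2] F_map_in_Hom_mod[OF r2 r3 f]] by simp
  qed
qed

text \<open>By fullness the lifting problem becomes one in C, where it is solved on each component T
  of a dual basis of U.\<close>

lemma represents_projective:
  fixes P :: "('k, 'm) fmod"
  assumes U: "in_add C T U" and r: "represents U P \<theta>"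
  shows "projective_mod B P"
  unfolding projective_mod_def
proof (intro conjI allI impI ballI)
  show "fd_module B P" by (rule represents_fd_module[OF r])
  fix M N :: "('k, 'm) fmod" and g f
  assume M: "fd_module B M" and N: "fd_module B N" and g: "g \<in> Hom_mod B M N" and onto: "g ` mcarr M = mcarr N"
    and f: "f \<in> Hom_mod B P N"
  obtain X \<theta>M where rM: "represents X M \<theta>M" using represents_exists[OF M] .
  obtain Z \<theta>N where rN: "represents Z N \<theta>N" using represents_exists[OF N] .
  obtain \<gamma> where \<gamma>: "\<gamma> \<in> Hom C X Z" "g = F_map X M \<theta>M \<theta>N \<gamma>" using F_map_surj[OF rM rN g] .
  obtain \<phi> where \<phi>: "\<phi> \<in> Hom C U Z" "f = F_map U P \<theta> \<theta>N \<phi>" using F_map_surj[OF r rN f] .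
  have lift: "\<exists>x\<in>Hom C T X. h = \<gamma> \<cdot> x" if h: "h \<in> Hom C T Z" for h
  proof -
    have "\<theta>N h \<in> g ` mcarr M" using h onto representsD(4)[OF rN] by auto
    then obtain x where x: "x \<in> Hom C T X" "\<theta>N h = g (\<theta>M x)" unfolding representsD(4)[OF rM] by blast
    then show ?thesis
      using \<gamma> F_map_apply[OF rM rN x(1)] inj_onD[OF representsD(3)[OF rN], of h "\<gamma> \<cdot> x"] h Cmp_in_Hom[OF x(1) \<gamma>(1)] by auto
  qed
  obtain n :: nat and q c where qc: "\<And>a. a < n \<Longrightarrow> q a \<in> Hom C T U" "\<And>a. a < n \<Longrightarrow> c a \<in> Hom C U T"
    "(\<Sum>a<n. q a \<cdot> c a) = Id C U" using in_add_dual_basis[OF U] by metis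
  have "\<exists>x. a < n \<longrightarrow> x \<in> Hom C T X \<and> \<phi> \<cdot> q a = \<gamma> \<cdot> x" for a
    using lift Cmp_in_Hom[OF qc(1) \<phi>(1)] by metis
  then obtain x where x: "\<And>a. a < n \<Longrightarrow> x a \<in> Hom C T X" "\<And>a. a < n \<Longrightarrow> \<phi> \<cdot> q a = \<gamma> \<cdot> x a" by metis
  define \<psi> where "\<psi> = (\<Sum>a<n. x a \<cdot> c a)"
  have xc: "x a \<cdot> c a \<in> Hom C U X" if "a < n" for a using Cmp_in_Hom[OF qc(2) x(1)] that by blast
  have \<psi>: "\<psi> \<in> Hom C U X" unfolding \<psi>_def using xc by (intro Hom_sum) auto
  have "\<gamma> \<cdot> \<psi> = (\<Sum>a<n. \<gamma> \<cdot> (x a \<cdot> c a))"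
    unfolding \<psi>_def using xc by (intro Cmp_sum_right[OF \<gamma>(1)]) auto
  also have "\<dots> = (\<Sum>a<n. \<phi> \<cdot> (q a \<cdot> c a))"
    using Cmp_assoc[OF qc(2) x(1) \<gamma>(1)] Cmp_assoc[OF qc(2,1) \<phi>(1)] x(2) by (intro sum.cong) auto
  also have "\<dots> = \<phi> \<cdot> (\<Sum>a<n. q a \<cdot> c a)"
    using Cmp_in_Hom[OF qc(2,1)] by (intro Cmp_sum_right[OF \<phi>(1), symmetric]) auto
  finally have "\<gamma> \<cdot> \<psi> = \<phi>" using qc(3) Cmp_Id_right[OF \<phi>(1)] by simp
  then have "g \<circ> F_map U P \<theta> \<theta>M \<psi> = f" using F_map_comp[OF r rM rN \<psi> \<gamma>(1)] \<gamma>(2) \<phi>(2) by simp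
  then show "\<exists>h\<in>Hom_mod B P M. \<forall>x\<in>mcarr P. g (h x) = f x"
    using F_map_in_Hom_mod[OF r rM \<psi>] by (auto simp: fun_eq_iff)
qed

text \<open>No nonzero ghost leaves add T, so dHom U Z is the dimension of Hom_B(F U, F Z), and F U
  is projective. The copy P of F U on polynomials is there because \<open>projective_mod\<close>
  speaks of such modules.\<close>

lemma dHom_short_exact:
  assumes U: "in_add C T U" and fd: "fd_module B L" "fd_module B M" "fd_module B N" and ex: "short_exact B L M N"
    and r: "represents ZL L \<theta>L" "represents ZM M \<theta>M" "represents ZN N \<theta>N"
  shows "dHom U ZM = dHom U ZL + dHom U ZN"
proof -
  obtain P :: "('k, 'm) fmod" and \<theta> where rP: "represents U P \<theta>" using represents_poly_exists .
  have pr: "projective_mod B P" by (rule represents_projective[OF U rP])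
  have P: "fd_module B P" by (rule represents_fd_module[OF rP])
  obtain i p where ip: "i \<in> Hom_mod B L M" "p \<in> Hom_mod B M N" "inj_on i (mcarr L)"
    "i ` mcarr L = map_kernel M p" "p ` mcarr M = mcarr N"
    using ex by (auto simp: short_exact_def)
  have dims: "int (dim_Hom_mod B P Y) = dHom U Z" if "represents Z Y \<theta>'" for Y :: "('k, 'm) fmod" and Z \<theta>'
    using dim_Hom_mod_eq[OF rP that] ghost_in_add[OF U] by simp
  let ?scM = "\<lambda>c f x. mscale M c (f x)" and ?scN = "\<lambda>c f x. mscale N c (f x)" and ?scL = "\<lambda>c f x. mscale L c (f x)"
  have vs: "vector_space (\<lambda>c (f :: 'k poly \<Rightarrow> 'k poly) x. mscale Y c (f x))" if "fd_module B Y" for Y :: "('k, 'm) fmod"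
    by (rule vector_space_pointwise[OF fd_moduleD(1)[OF that]])
  have lin: "lin_on (\<lambda>c f x. mscale Y c (f x)) (\<lambda>c f x. mscale Y' c (f x)) (Hom_mod B P Y) (\<lambda>f x. g (f x))"
    if Y: "fd_module B Y" and g: "g \<in> Hom_mod B Y Y'" for Y Y' :: "('k, 'm) fmod" and g
  proof -
    have in_Y: "f x \<in> mcarr Y" if "f \<in> Hom_mod B P Y" for f x
      using Hom_modD(1,2)[OF that, of x] fd_module_closed(1)[OF Y] by (cases "x \<in> mcarr P") auto
    show ?thesis
      by (rule lin_onI) (simp_all add: fun_eq_iff in_Y Hom_modD(4,5)[OF g])
  qed
  note l = lin[OF fd(2) ip(2)] and l' = lin[OF fd(1) ip(1)]
  have im: "(\<lambda>f x. p (f x)) ` Hom_mod B P M = Hom_mod B P N"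
  proof
    show "(\<lambda>f x. p (f x)) ` Hom_mod B P M \<subseteq> Hom_mod B P N" using Hom_mod_comp[OF fd(2) _ ip(2)] by blast
    show "Hom_mod B P N \<subseteq> (\<lambda>f x. p (f x)) ` Hom_mod B P M"
    proof
      fix f assume f: "f \<in> Hom_mod B P N"
      have "f ` mcarr P \<subseteq> p ` mcarr M" using Hom_modD(1)[OF f] ip(5) by auto
      then obtain h where h: "h \<in> Hom_mod B P M" "\<And>x. x \<in> mcarr P \<Longrightarrow> p (h x) = f x"
        using projective_lift[OF pr fd(2,3) ip(2) f] by blast
      have "f = (\<lambda>x. p (h x))"
        using h Hom_modD(2)[OF f] Hom_modD(2)[OF h(1)] Hom_mod_0[OF fd(2) ip(2)] by (auto simp: fun_eq_iff) metis
      then show "f \<in> (\<lambda>f x. p (f x)) ` Hom_mod B P M" using h(1) by blast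
    qed
  qed
  have ker: "{f \<in> Hom_mod B P M. (\<lambda>x. p (f x)) = 0} = (\<lambda>f x. i (f x)) ` Hom_mod B P L"
  proof safe
    fix f assume f: "f \<in> Hom_mod B P M" and z: "(\<lambda>x. p (f x)) = 0"
    have "f ` mcarr P \<subseteq> i ` mcarr L"
      unfolding ip(4) map_kernel_def using Hom_modD(1)[OF f] fun_cong[OF z] by auto
    then obtain h where h: "h \<in> Hom_mod B P L" "\<And>x. x \<in> mcarr P \<Longrightarrow> i (h x) = f x"
      using projective_lift[OF pr fd(1,2) ip(1) f] by blast
    have "f = (\<lambda>x. i (h x))"
      using h Hom_modD(2)[OF f] Hom_modD(2)[OF h(1)] Hom_mod_0[OF fd(1) ip(1)] by (auto simp: fun_eq_iff) metis
    then show "f \<in> (\<lambda>f x. i (f x)) ` Hom_mod B P L" using h(1) by blast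
  next
    fix f assume f: "f \<in> Hom_mod B P L"
    show "(\<lambda>x. i (f x)) \<in> Hom_mod B P M" by (rule Hom_mod_comp[OF fd(1) f ip(1)])
    have "p (i x) = 0" if "x \<in> mcarr L" for x
    proof -
      have "i x \<in> map_kernel M p" using that ip(4) by blast
      then show ?thesis by (simp add: map_kernel_def)
    qed
    then show "(\<lambda>x. p (i (f x))) = 0"
      using Hom_modD(1,2)[OF f] Hom_mod_0[OF fd(1) ip(1)] Hom_mod_0[OF fd(2) ip(2)] by (auto simp: fun_eq_iff) metis
  qed
  have inj: "inj_on (\<lambda>f x. i (f x)) (Hom_mod B P L)"
  proof (rule inj_onI, rule ext)
    fix f g x assume f: "f \<in> Hom_mod B P L" and g: "g \<in> Hom_mod B P L" and e: "(\<lambda>x. i (f x)) = (\<lambda>x. i (g x))"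
    show "f x = g x"
      using fun_cong[OF e, of x] Hom_modD(1,2)[OF f, of x] Hom_modD(1,2)[OF g, of x] inj_onD[OF ip(3)]
      by (cases "x \<in> mcarr P") auto
  qed
  have "dim_Hom_mod B P M = dim_Hom_mod B P L + dim_Hom_mod B P N"
    using rank_nullity(2)[OF vs[OF fd(2)] vs[OF fd(3)] l Hom_mod_fin_dim[OF rP r(2)]]
      dim_inj_image[OF vs[OF fd(1)] vs[OF fd(2)] l' Hom_mod_fin_dim[OF rP r(1)] inj]
    by (simp add: im ker dim_Hom_mod_def maps_dim_def)
  then show ?thesis using dims[OF r(1)] dims[OF r(2)] dims[OF r(3)] by simp
qed

text \<open>By \<open>ev_add_resolution\<close> the module enters only through dHom from objects of
  add T.\<close>

lemma ev_short_exact: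
  assumes "fd_module B L" "fd_module B M" "fd_module B N" "short_exact B L M N"
    "represents ZL L \<theta>L" "represents ZM M \<theta>M" "represents ZN N \<theta>N"
  shows "ev ZM X = ev ZL X + ev ZN X"
proof -
  obtain U1 U0 u v w where r: "add_resolution X U1 U0 u v w" by (rule add_resolution_exists)
  note d = add_resolutionD[OF r]
  show ?thesis
    using dHom_short_exact[OF d(1) assms] dHom_short_exact[OF d(2) assms]
      ev_add_resolution[OF r, of ZM] ev_add_resolution[OF r, of ZL] ev_add_resolution[OF r, of ZN] by simp
qed

section \<open>The Euler form\<close>

text \<open>F turns U2 -> U1 -> U0 into the start of a projective resolution of X. A map g : U1 -> Z
  gives a cocycle iff g c is a ghost, and a coboundary iff g c = 0. So composing with c identifies
  cocycles modulo coboundaries with the ghosts among the multiples of c, and these multiples are the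
  coghosts.\<close>

lemma dim_Ext1_mod_eq:
  assumes rX: "represents (susp C W) X \<theta>X" and rY: "represents Z Y \<theta>Y"
  shows "int (dim_Ext1_mod B X Y) = dext W Z"
proof -
  have X: "fd_module B X" and Y: "fd_module B Y"
    using represents_fd_module[OF rX] represents_fd_module[OF rY] .
  obtain U1 U0 u v w where r: "add_resolution (susp C W) U1 U0 u v w" by (rule add_resolution_exists)
  note d = add_resolutionD[OF r]
  obtain c where c: "c \<in> Hom C W U1" "w = suspm C c" using d(6) by (rule suspm_fullE)
  \<comment> \<open>Rotating back to a triangle that starts at W turns c into - c; the sign affects
    neither the kernel nor the image of composition with c.\<close>
  have "Tri C U1 U0 (susp C W) u v (- suspm C (- c))"
    using d(3) c suspm_minus[OF c(1)] by simp
  then have t: "Tri C W U1 U0 (- c) u v"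
    using c(1) d(4,5) by (subst Tri_rotate) auto
  have cc: "- c \<in> Hom C W U1" using c(1) by simp
  \<comment> \<open>The kernel of F u; U2 is chosen to cover it, which continues the resolution by
    one step.\<close>
  let ?N = "{h \<in> Hom C T U1. u \<cdot> h = 0}"
  have N: "hom.subspace ?N"
    by (rule subspace_kernel_on[OF ambient_vector_space lin_on_post[OF d(4)] Hom_subspace ambient_vector_space])
  have act: "h \<cdot> b \<in> ?N" if "h \<in> ?N" "b \<in> Hom C T T" for h b
    using that Cmp_in_Hom[of b T T h U1] Cmp_assoc[of b T T h U1 u U0] d(4) Cmp_0_left[of b T T] by simp
  obtain U2 a where U2: "in_add C T U2" "a \<in> Hom C U2 U1" "(\<lambda>g. a \<cdot> g) ` Hom C T U2 = ?N"
    using Hom_spans_approx[OF N _ act, of U1] by blast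
  obtain P0 :: "('k, 'm) fmod" and \<theta>0 where r0: "represents U0 P0 \<theta>0" using represents_poly_exists .
  obtain P1 :: "('k, 'm) fmod" and \<theta>1 where r1: "represents U1 P1 \<theta>1" using represents_poly_exists .
  obtain P2 :: "('k, 'm) fmod" and \<theta>2 where r2: "represents U2 P2 \<theta>2" using represents_poly_exists .
  let ?\<epsilon> = "F_map U0 P0 \<theta>0 \<theta>X v" and ?d1 = "F_map U1 P1 \<theta>1 \<theta>0 u" and ?d2 = "F_map U2 P2 \<theta>2 \<theta>1 a"
  have res: "proj_resolution B X P0 P1 P2 ?\<epsilon> ?d1 ?d2"
    unfolding proj_resolution_def
  proof (intro conjI)
    show "projective_mod B P0" "projective_mod B P1" "projective_mod B P2"
      using represents_projective d(1,2) U2(1) r0 r1 r2 by blast+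
    show "?\<epsilon> \<in> Hom_mod B P0 X" "?d1 \<in> Hom_mod B P1 P0" "?d2 \<in> Hom_mod B P2 P1"
      using F_map_in_Hom_mod[OF r0 rX d(5)] F_map_in_Hom_mod[OF r1 r0 d(4)] F_map_in_Hom_mod[OF r2 r1 U2(2)] .
    show "?\<epsilon> ` mcarr P0 = mcarr X"
    proof
      show "?\<epsilon> ` mcarr P0 \<subseteq> mcarr X" using Hom_modD(1)[OF F_map_in_Hom_mod[OF r0 rX d(5)]] by blast
      show "mcarr X \<subseteq> ?\<epsilon> ` mcarr P0"
      proof
        fix x assume "x \<in> mcarr X"
        then obtain h where h: "h \<in> Hom C T (susp C W)" "x = \<theta>X h" unfolding representsD(4)[OF rX] by blast
        obtain s where s: "s \<in> Hom C T U0" "h = v \<cdot> s" using add_resolution_lift[OF r in_add_T h(1)] .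
        then have "x = ?\<epsilon> (\<theta>0 s)" using F_map_apply[OF r0 rX s(1)] h(2) by simp
        then show "x \<in> ?\<epsilon> ` mcarr P0" using s(1) representsD(4)[OF r0] by blast
      qed
    qed
    show "map_kernel P0 ?\<epsilon> = ?d1 ` mcarr P1"
    proof (intro equalityI subsetI)
      fix x assume "x \<in> map_kernel P0 ?\<epsilon>"
      then have "x \<in> mcarr P0" and x0: "?\<epsilon> x = 0" by (auto simp: map_kernel_def)
      then obtain s where s: "s \<in> Hom C T U0" "x = \<theta>0 s" unfolding representsD(4)[OF r0] by blast
      have "v \<cdot> s = 0"
        using x0 s F_map_apply[OF r0 rX s(1)] representsD(7)[OF rX Cmp_in_Hom[OF s(1) d(5)]] by simp
      then obtain q where q: "q \<in> Hom C T U1" "s = u \<cdot> q" using Tri_lift_u[OF d(3) s(1)] by metis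
      then have "x = ?d1 (\<theta>1 q)" using F_map_apply[OF r1 r0 q(1)] s(2) by simp
      then show "x \<in> ?d1 ` mcarr P1" using q(1) representsD(4)[OF r1] by blast
    next
      fix x assume "x \<in> ?d1 ` mcarr P1"
      then obtain q where q: "q \<in> Hom C T U1" "x = ?d1 (\<theta>1 q)" unfolding representsD(4)[OF r1] by blast
      have uq: "u \<cdot> q \<in> Hom C T U0" using Cmp_in_Hom[OF q(1) d(4)] .
      have x: "x = \<theta>0 (u \<cdot> q)" using q(2) F_map_apply[OF r1 r0 q(1)] by simp
      have "v \<cdot> (u \<cdot> q) = 0" using Cmp_assoc[OF q(1) d(4,5)] Tri_comp_uv[OF d(3)] Cmp_0_left[OF q(1)] by simp
      then have "?\<epsilon> x = 0" using x F_map_apply[OF r0 rX uq] representsD(6)[OF rX] by simp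
      then show "x \<in> map_kernel P0 ?\<epsilon>" using x uq representsD(4)[OF r0] by (auto simp: map_kernel_def)
    qed
    show "map_kernel P1 ?d1 = ?d2 ` mcarr P2"
    proof (intro equalityI subsetI)
      fix x assume "x \<in> map_kernel P1 ?d1"
      then have "x \<in> mcarr P1" and x0: "?d1 x = 0" by (auto simp: map_kernel_def)
      then obtain s where s: "s \<in> Hom C T U1" "x = \<theta>1 s" unfolding representsD(4)[OF r1] by blast
      have "u \<cdot> s = 0"
        using x0 s F_map_apply[OF r1 r0 s(1)] representsD(7)[OF r0 Cmp_in_Hom[OF s(1) d(4)]] by simp
      then have "s \<in> (\<lambda>g. a \<cdot> g) ` Hom C T U2" using U2(3) s(1) by simp
      then obtain q where q: "q \<in> Hom C T U2" "s = a \<cdot> q" by blast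
      then have "x = ?d2 (\<theta>2 q)" using F_map_apply[OF r2 r1 q(1)] s(2) by simp
      then show "x \<in> ?d2 ` mcarr P2" using q(1) representsD(4)[OF r2] by blast
    next
      fix x assume "x \<in> ?d2 ` mcarr P2"
      then obtain q where q: "q \<in> Hom C T U2" "x = ?d2 (\<theta>2 q)" unfolding representsD(4)[OF r2] by blast
      have "a \<cdot> q \<in> ?N" using q(1) U2(3) by blast
      then have aq: "a \<cdot> q \<in> Hom C T U1" "u \<cdot> (a \<cdot> q) = 0" by auto
      have x: "x = \<theta>1 (a \<cdot> q)" using q(2) F_map_apply[OF r2 r1 q(1)] by simp
      then have "?d1 x = 0" using aq F_map_apply[OF r1 r0 aq(1)] representsD(6)[OF r0] by simp
      then show "x \<in> map_kernel P1 ?d1" using x aq representsD(4)[OF r1] by (auto simp: map_kernel_def)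
    qed
  qed
  let ?S = "{g \<in> Hom C U1 Z. g \<cdot> a = 0}" and ?R = "(\<lambda>x. x \<cdot> u) ` Hom C U0 Z"
  have S: "hom.subspace ?S"
    by (rule subspace_kernel_on[OF ambient_vector_space lin_on_pre[OF U2(2)] Hom_subspace ambient_vector_space])
  have R: "hom.subspace ?R" "?R \<subseteq> Hom C U1 Z"
    using subspace_image_on[OF ambient_vector_space lin_on_pre[OF d(4)] Hom_subspace ambient_vector_space]
      Cmp_in_Hom[OF d(4)] by blast+
  have S_iff: "g \<cdot> a = 0 \<longleftrightarrow> (\<forall>h\<in>?N. g \<cdot> h = 0)" if g: "g \<in> Hom C U1 Z" for g
  proof
    assume z: "g \<cdot> a = 0"
    show "\<forall>h\<in>?N. g \<cdot> h = 0"
      unfolding U2(3)[symmetric]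
      using Cmp_assoc[OF _ U2(2) g] z Cmp_0_left by auto
  next
    assume z: "\<forall>h\<in>?N. g \<cdot> h = 0"
    show "g \<cdot> a = 0"
    proof (rule in_add_eqI[OF U2(1) Cmp_in_Hom[OF U2(2) g] Hom_0])
      fix h assume h: "h \<in> Hom C T U2"
      then have "g \<cdot> (a \<cdot> h) = 0" using z U2(3) by blast
      then show "g \<cdot> a \<cdot> h = 0 \<cdot> h" using Cmp_assoc[OF h U2(2) g] Cmp_0_left[OF h] by simp
    qed
  qed
  have cyc: "cocycles B P1 P2 Y ?d2 = F_map U1 P1 \<theta>1 \<theta>Y ` ?S"
  proof -
    have e: "(\<forall>x\<in>mcarr P2. F_map U1 P1 \<theta>1 \<theta>Y g (?d2 x) = 0) \<longleftrightarrow> g \<cdot> a = 0" if g: "g \<in> Hom C U1 Z" for g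
    proof -
      have "(\<forall>x\<in>mcarr P2. F_map U1 P1 \<theta>1 \<theta>Y g (?d2 x) = 0) \<longleftrightarrow> F_map U2 P2 \<theta>2 \<theta>Y (g \<cdot> a) = 0"
        using fun_cong[OF F_map_comp[OF r2 r1 rY U2(2) g]] F_map_outside[OF r2 rY] by (auto simp: fun_eq_iff)
      then show ?thesis
        using F_map_eq_0[OF r2 rY Cmp_in_Hom[OF U2(2) g]] ghost_in_add[OF U2(1), of Z] by simp
    qed
    show ?thesis
      unfolding F_map_image[OF r1 rY, symmetric] using e by blast
  qed
  have cob: "coboundaries B P0 Y ?d1 = F_map U1 P1 \<theta>1 \<theta>Y ` ?R"
    unfolding F_map_image[OF r0 rY, symmetric] image_image
    using F_map_comp[OF r1 r0 rY d(4)] by (intro image_cong) auto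
  have pre: "g \<cdot> (- c) = 0 \<longleftrightarrow> g \<in> ?R" if g: "g \<in> Hom C U1 Z" for g
  proof
    assume "g \<cdot> (- c) = 0"
    then show "g \<in> ?R" using Tri_factor_v[OF t g] by (metis image_eqI)
  next
    assume "g \<in> ?R"
    then obtain x where x: "x \<in> Hom C U0 Z" "g = x \<cdot> u" by blast
    then show "g \<cdot> (- c) = 0" using Cmp_assoc[OF cc d(4) x(1)] Tri_comp_uv[OF t] Cmp_0_right[OF x(1)] by simp
  qed
  have RS: "?R \<subseteq> ?S"
  proof
    fix g assume "g \<in> ?R"
    then obtain x where x: "x \<in> Hom C U0 Z" "g = x \<cdot> u" by blast
    have g: "g \<in> Hom C U1 Z" using x Cmp_in_Hom[OF d(4)] by simp
    have "g \<cdot> h = 0" if "h \<in> ?N" for h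
      using that x Cmp_assoc[of h T U1 u U0 x Z] d(4) Cmp_0_right[OF x(1)] by simp
    then show "g \<in> ?S" using S_iff[OF g] g by simp
  qed
  \<comment> \<open>By exactness the kernel of F u is also the image of F c, so the cocycle
    condition on g becomes a ghost condition on g c.\<close>
  have N_eq: "?N = (\<lambda>s. (- c) \<cdot> s) ` Hom C T W"
  proof (intro equalityI subsetI)
    fix h assume "h \<in> ?N"
    then show "h \<in> (\<lambda>s. (- c) \<cdot> s) ` Hom C T W" using Tri_lift_u[OF t, of h T] by (metis (mono_tags, lifting) image_eqI mem_Collect_eq)
  next
    fix h assume "h \<in> (\<lambda>s. (- c) \<cdot> s) ` Hom C T W"
    then obtain s where s: "s \<in> Hom C T W" "h = (- c) \<cdot> s" by blast
    then show "h \<in> ?N" using Cmp_in_Hom[OF s(1) cc] Cmp_assoc[OF s(1) cc d(4)] Tri_comp_uv[OF t] Cmp_0_left[OF s(1)] by simp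
  qed
  have S_ghost: "g \<in> ?S \<longleftrightarrow> g \<cdot> (- c) \<in> ghost W Z" if g: "g \<in> Hom C U1 Z" for g
  proof -
    have "g \<in> ?S \<longleftrightarrow> (\<forall>s\<in>Hom C T W. g \<cdot> ((- c) \<cdot> s) = 0)"
      using S_iff[OF g] g N_eq by simp
    also have "\<dots> \<longleftrightarrow> g \<cdot> (- c) \<in> ghost W Z"
      using Cmp_assoc[OF _ cc g] Cmp_in_Hom[OF cc g] by (simp add: ghost_def)
    finally show ?thesis .
  qed
  have "(\<lambda>g. g \<cdot> (- c)) ` Hom C U1 Z = (\<lambda>g. g \<cdot> c) ` Hom C U1 Z"
  proof (intro equalityI image_subsetI)
    fix g assume g: "g \<in> Hom C U1 Z"
    have e: "g \<cdot> (- c) = (- g) \<cdot> c" "g \<cdot> c = (- g) \<cdot> (- c)"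
      using Cmp_minus_right[OF c(1) g] Cmp_minus_left[OF c(1) g] Cmp_minus_left[OF cc g] by simp_all
    show "g \<cdot> (- c) \<in> (\<lambda>g. g \<cdot> c) ` Hom C U1 Z" "g \<cdot> c \<in> (\<lambda>g. g \<cdot> (- c)) ` Hom C U1 Z"
      using e Hom_minus[OF g] by (blast, blast)
  qed
  then have co: "(\<lambda>g. g \<cdot> (- c)) ` Hom C U1 Z = coghost W Z"
    using coghost_eq[OF r[unfolded c(2)] c(1)] by simp
  have im: "(\<lambda>g. g \<cdot> (- c)) ` ?S = ghost W Z \<inter> coghost W Z"
  proof (intro equalityI subsetI)
    fix x assume "x \<in> (\<lambda>g. g \<cdot> (- c)) ` ?S"
    then obtain g where g: "g \<in> ?S" "x = g \<cdot> (- c)" by (rule imageE)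
    then have gH: "g \<in> Hom C U1 Z" by simp
    show "x \<in> ghost W Z \<inter> coghost W Z"
      unfolding co[symmetric] using S_ghost[OF gH] g gH by simp
  next
    fix x assume x: "x \<in> ghost W Z \<inter> coghost W Z"
    then obtain g where g: "g \<in> Hom C U1 Z" "x = g \<cdot> (- c)" unfolding co[symmetric] by blast
    then show "x \<in> (\<lambda>g. g \<cdot> (- c)) ` ?S" using S_ghost[OF g(1)] x by blast
  qed
  have "{g \<in> ?S. g \<cdot> (- c) = 0} = ?R" using pre RS by blast
  then have dimS: "hom.dim ?S = hom.dim ?R + hom.dim (ghost W Z \<inter> coghost W Z)"
    using rank_nullity_pre[OF cc hom.fin_dim_subset[OF Hom_finite S Collect_restrict] Collect_restrict] im by simp
  have val: "maps_dim Y (cocycles B P1 P2 Y ?d2) = hom.dim ?S" "maps_dim Y (coboundaries B P0 Y ?d1) = hom.dim ?R"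
    unfolding cyc cob using F_map_dim_image[OF r1 rY d(1) S] F_map_dim_image[OF r1 rY d(1) R] by auto
  \<comment> \<open>\<open>dim_Ext1_mod\<close> is a definite description over all resolutions;
    comparing an arbitrary one with the resolution above in both directions shows that all give the
    same number.\<close>
  have uniq: "maps_dim Y (cocycles B Q1 Q2 Y e2) - maps_dim Y (coboundaries B Q0 Y e1)
      = hom.dim (ghost W Z \<inter> coghost W Z)"
    if Q: "proj_resolution B X Q0 Q1 Q2 \<epsilon> e1 e2" for Q0 Q1 Q2 \<epsilon> e1 e2
  proof -
    obtain V \<theta>V where rV: "represents V Q1 \<theta>V" using represents_exists[OF proj_resolutionD(5)[OF Q]] .
    note fin = Hom_mod_fin_dim[OF rV rY] Hom_mod_fin_dim[OF r1 rY]
    show ?thesis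
      using Ext1_dim_le[OF X Y Q res fin] Ext1_dim_le[OF X Y res Q fin(2,1)] val dimS by linarith
  qed
  have "dim_Ext1_mod B X Y = hom.dim (ghost W Z \<inter> coghost W Z)"
    unfolding dim_Ext1_mod_def
  proof (rule the_equality)
    show "\<exists>P0 P1 P2 \<epsilon> d1 d2. proj_resolution B X P0 P1 P2 \<epsilon> d1 d2 \<and>
       hom.dim (ghost W Z \<inter> coghost W Z) = maps_dim Y (cocycles B P1 P2 Y d2) - maps_dim Y (coboundaries B P0 Y d1)"
      using res uniq[OF res, symmetric] by (intro exI conjI)
  next
    fix k assume "\<exists>P0 P1 P2 \<epsilon> d1 d2. proj_resolution B X P0 P1 P2 \<epsilon> d1 d2 \<and>
       k = maps_dim Y (cocycles B P1 P2 Y d2) - maps_dim Y (coboundaries B P0 Y d1)"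
    then show "k = hom.dim (ghost W Z \<inter> coghost W Z)" using uniq by (elim exE conjE) simp
  qed
  then show ?thesis by simp
qed

lemma antisym_euler_form:
  assumes "represents (susp C W) X \<theta>X" "represents (susp C V) Y \<theta>Y"
  shows "euler_form B X Y - euler_form B Y X = ev (susp C V) (susp C W) + ev (susp C V) W"
  unfolding euler_form_def
  using dim_Ext1_mod_eq[OF assms] dim_Ext1_mod_eq[OF assms(2,1)]
    dim_Hom_mod_eq[OF assms] dim_Hom_mod_eq[OF assms(2,1)] euler_ev[of W V] by linarith

end

section \<open>Grothendieck groups\<close>

definition frag_eval :: "('a \<Rightarrow>\<^sub>0 int) \<Rightarrow> ('a \<Rightarrow> int) \<Rightarrow> int"
  where "frag_eval u f = (\<Sum>x\<in>Poly_Mapping.keys u. Poly_Mapping.lookup u x * f x)"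

lemma frag_eval_superset:
  assumes "finite A" "Poly_Mapping.keys u \<subseteq> A"
  shows "frag_eval u f = (\<Sum>x\<in>A. Poly_Mapping.lookup u x * f x)"
  unfolding frag_eval_def
  by (rule sum.mono_neutral_left[OF assms]) (simp add: in_keys_iff)

lemma frag_eval_add: "frag_eval (u + v) f = frag_eval u f + frag_eval v f"
proof -
  let ?A = "Poly_Mapping.keys u \<union> Poly_Mapping.keys v"
  have "Poly_Mapping.keys (u + v) \<subseteq> ?A" by (rule keys_add)
  then show ?thesis
    by (simp add: frag_eval_superset[of ?A] lookup_add distrib_right sum.distrib)
qed

lemma frag_eval_minus: "frag_eval (- u) f = - frag_eval u f"
  by (simp add: frag_eval_def sum_negf)

lemma frag_eval_diff: "frag_eval (u - v) f = frag_eval u f - frag_eval v f"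
  using frag_eval_add[of u "- v"] frag_eval_minus[of v] by simp

lemma frag_eval_frag_of: "frag_eval (frag_of x) f = f x"
  by (simp add: frag_eval_def keys_frag_of)

lemma frag_eval_cong: "(\<And>x. x \<in> Poly_Mapping.keys u \<Longrightarrow> f x = g x) \<Longrightarrow> frag_eval u f = frag_eval u g"
  by (simp add: frag_eval_def)

lemma frag_eval_add_fun: "frag_eval u (\<lambda>x. f x + g x) = frag_eval u f + frag_eval u g"
  by (simp add: frag_eval_def distrib_left sum.distrib)

lemma frag_eval_diff_fun: "frag_eval u (\<lambda>x. f x - g x) = frag_eval u f - frag_eval u g"
  by (simp add: frag_eval_def right_diff_distrib sum_subtractf)

lemma biadditive_left: "biadditive \<phi> u v = frag_eval u (\<lambda>x. frag_eval v (\<phi> x))"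
  by (simp add: biadditive_def frag_eval_def sum_distrib_left mult.assoc)

lemma biadditive_right: "biadditive \<phi> u v = frag_eval v (\<lambda>y. frag_eval u (\<lambda>x. \<phi> x y))"
  unfolding biadditive_def frag_eval_def
  by (subst sum.swap) (simp add: sum_distrib_left mult_ac)

lemma groth_relations_normal:
  assumes "R \<subseteq> S \<times> S \<times> S"
  shows "normal (groth_relations S R) (free_Abelian_group S)"
proof -
  interpret comm_group "free_Abelian_group S" by (rule abelian_free_Abelian_group)
  have "{frag_of y - frag_of x - frag_of z | x y z. (x, y, z) \<in> R} \<subseteq> carrier (free_Abelian_group S)"
  proof safe
    fix x y z assume "(x, y, z) \<in> R"
    then have "Poly_Mapping.keys (frag_of y) \<subseteq> S" "Poly_Mapping.keys (frag_of x) \<subseteq> S" "Poly_Mapping.keys (frag_of z) \<subseteq> S"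
      using assms by (auto simp: keys_frag_of)
    then show "frag_of y - frag_of x - frag_of z \<in> carrier (free_Abelian_group S)"
      using keys_diff[of "frag_of y - frag_of x" "frag_of z"] keys_diff[of "frag_of y" "frag_of x"] by auto
  qed
  then show ?thesis
    unfolding groth_relations_def by (intro subgroup_imp_normal generate_is_subgroup)
qed

lemma frag_eval_groth_relations:
  assumes R: "R \<subseteq> S \<times> S \<times> S" and f: "\<And>x y z. (x, y, z) \<in> R \<Longrightarrow> f y = f x + f z"
    and r: "r \<in> groth_relations S R"
  shows "frag_eval r f = 0"
proof -
  interpret N: normal "groth_relations S R" "free_Abelian_group S" by (rule groth_relations_normal[OF R])
  let ?X = "{frag_of y - frag_of x - frag_of z | x y z. (x, y, z) \<in> R}"
  have X: "frag_eval h f = 0 \<and> Poly_Mapping.keys h \<subseteq> S" if h: "h \<in> ?X" for h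
  proof -
    have "h \<in> groth_relations S R" unfolding groth_relations_def by (rule generate.incl[OF h])
    then have "h \<in> carrier (free_Abelian_group S)" using N.subset by (rule subsetD[rotated])
    moreover obtain x y z where "h = frag_of y - frag_of x - frag_of z" "(x, y, z) \<in> R" using h by blast
    ultimately show ?thesis using f by (simp add: frag_eval_diff frag_eval_frag_of)
  qed
  show ?thesis
    using r unfolding groth_relations_def
  proof (induction rule: generate.induct)
    case one
    show ?case by (simp add: frag_eval_def)
  next
    case (incl h)
    then show ?case using X by blast
  next
    case (inv h)
    then show ?case using X[OF inv] by (simp add: frag_eval_minus)
  next
    case (eng h1 h2)
    then show ?case by (simp add: frag_eval_add)
  qed
qed

lemma groth_groupE:
  assumes "c \<in> carrier (groth_group S R)"
  obtains a where "Poly_Mapping.keys a \<subseteq> S" "c = groth_relations S R #>\<^bsub>free_Abelian_group S\<^esub> a"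
  using assms unfolding groth_group_def FactGroup_def RCOSETS_def by auto

lemma groth_class_in_carrier:
  assumes "x \<in> S"
  shows "groth_class S R x \<in> carrier (groth_group S R)"
  using assms by (auto simp: groth_class_def groth_group_def FactGroup_def RCOSETS_def keys_frag_of)

lemma groth_coset_memD:
  assumes R: "R \<subseteq> S \<times> S \<times> S" and a: "Poly_Mapping.keys a \<subseteq> S"
    and u: "u \<in> groth_relations S R #>\<^bsub>free_Abelian_group S\<^esub> a"
  shows "Poly_Mapping.keys u \<subseteq> S"
    and "(\<And>x y z. (x, y, z) \<in> R \<Longrightarrow> f y = f x + f z) \<Longrightarrow> frag_eval u f = frag_eval a f"
proof -
  interpret N: normal "groth_relations S R" "free_Abelian_group S" by (rule groth_relations_normal[OF R])
  obtain r where r: "r \<in> groth_relations S R" "u = r + a" using u by (auto simp: r_coset_def)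
  have "Poly_Mapping.keys r \<subseteq> S" using subsetD[OF N.subset r(1)] by simp
  then show "Poly_Mapping.keys u \<subseteq> S" using r(2) a keys_add[of r a] by blast
  show "frag_eval u f = frag_eval a f" if "\<And>x y z. (x, y, z) \<in> R \<Longrightarrow> f y = f x + f z"
    using frag_eval_groth_relations[OF R that r(1)] r(2) by (simp add: frag_eval_add)
qed

lemma groth_class_mem:
  assumes R: "R \<subseteq> S \<times> S \<times> S" and a: "Poly_Mapping.keys a \<subseteq> S"
  shows "a \<in> groth_relations S R #>\<^bsub>free_Abelian_group S\<^esub> a"
proof -
  interpret N: normal "groth_relations S R" "free_Abelian_group S" by (rule groth_relations_normal[OF R])
  show ?thesis using N.rcos_self a N.subgroup_axioms by simp
qed

text \<open>\<open>the_elem\<close> requires a single value. Representatives are changed one side at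
  a time: with the other side fixed, the pairing is an additive function respecting the
  relations.\<close>

lemma groth_pairing_eq:
  assumes R: "R \<subseteq> S \<times> S \<times> S" and R': "R' \<subseteq> S' \<times> S' \<times> S'"
    and c: "c \<in> carrier (groth_group S R)" and d: "d \<in> carrier (groth_group S' R')"
    and l: "\<And>x y z w. (x, y, z) \<in> R \<Longrightarrow> w \<in> S' \<Longrightarrow> \<phi> y w = \<phi> x w + \<phi> z w"
    and r: "\<And>x y z w. (x, y, z) \<in> R' \<Longrightarrow> w \<in> S \<Longrightarrow> \<phi> w y = \<phi> w x + \<phi> w z"
    and u: "u \<in> c" and v: "v \<in> d"
  shows "groth_pairing \<phi> c d = biadditive \<phi> u v"
proof -
  obtain a where a: "Poly_Mapping.keys a \<subseteq> S" "c = groth_relations S R #>\<^bsub>free_Abelian_group S\<^esub> a"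
    using groth_groupE[OF c] .
  obtain b where b: "Poly_Mapping.keys b \<subseteq> S'" "d = groth_relations S' R' #>\<^bsub>free_Abelian_group S'\<^esub> b"
    using groth_groupE[OF d] .
  have e: "biadditive \<phi> u v = biadditive \<phi> a b" if "u \<in> c" "v \<in> d" for u v
  proof -
    have k: "Poly_Mapping.keys v \<subseteq> S'"
      using that b groth_coset_memD(1)[OF R' b(1)] by blast
    have 1: "biadditive \<phi> u v = biadditive \<phi> a v"
      unfolding biadditive_left
    proof (rule groth_coset_memD(2)[OF R a(1) that(1)[unfolded a(2)]])
      fix x y z assume "(x, y, z) \<in> R"
      then have "frag_eval v (\<phi> y) = frag_eval v (\<lambda>w. \<phi> x w + \<phi> z w)"
        using l k by (intro frag_eval_cong) auto
      then show "frag_eval v (\<phi> y) = frag_eval v (\<phi> x) + frag_eval v (\<phi> z)"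
        by (simp add: frag_eval_add_fun)
    qed
    have 2: "biadditive \<phi> a v = biadditive \<phi> a b"
      unfolding biadditive_right
    proof (rule groth_coset_memD(2)[OF R' b(1) that(2)[unfolded b(2)]])
      fix x y z assume "(x, y, z) \<in> R'"
      then have "frag_eval a (\<lambda>w. \<phi> w y) = frag_eval a (\<lambda>w. \<phi> w x + \<phi> w z)"
        using r a(1) by (intro frag_eval_cong) auto
      then show "frag_eval a (\<lambda>w. \<phi> w y) = frag_eval a (\<lambda>w. \<phi> w x) + frag_eval a (\<lambda>w. \<phi> w z)"
        by (simp add: frag_eval_add_fun)
    qed
    show ?thesis using 1 2 by simp
  qed
  have "{biadditive \<phi> u v | u v. u \<in> c \<and> v \<in> d} = {biadditive \<phi> a b}"
  proof (intro equalityI subsetI)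
    fix k assume "k \<in> {biadditive \<phi> u v | u v. u \<in> c \<and> v \<in> d}"
    then show "k \<in> {biadditive \<phi> a b}" using e by blast
  next
    fix k assume "k \<in> {biadditive \<phi> a b}"
    then have "k = biadditive \<phi> u v" using e[OF u v] by simp
    then show "k \<in> {biadditive \<phi> u v | u v. u \<in> c \<and> v \<in> d}" using u v by blast
  qed
  then show ?thesis unfolding groth_pairing_def using e[OF u v] by simp
qed

lemma groth_class_diff:
  assumes R: "R \<subseteq> S \<times> S \<times> S" and "x \<in> S" "y \<in> S"
  shows "groth_class S R x \<otimes>\<^bsub>groth_group S R\<^esub> inv\<^bsub>groth_group S R\<^esub> groth_class S R y
    = groth_relations S R #>\<^bsub>free_Abelian_group S\<^esub> (frag_of x - frag_of y)"
proof -
  interpret N: normal "groth_relations S R" "free_Abelian_group S" by (rule groth_relations_normal[OF R])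
  let ?G = "free_Abelian_group S"
  have x: "frag_of x \<in> carrier ?G" "frag_of y \<in> carrier ?G" using assms by (auto simp: keys_frag_of)
  then have k: "Poly_Mapping.keys (frag_of y) \<subseteq> S" by simp
  have "inv\<^bsub>groth_group S R\<^esub> groth_class S R y = groth_relations S R #>\<^bsub>?G\<^esub> (- frag_of y)"
    using N.inv_FactGroup[OF groth_class_in_carrier[OF assms(3), of R, unfolded groth_group_def]]
      N.rcos_inv[OF x(2)] inv_free_Abelian_group[OF k]
    by (simp add: groth_group_def groth_class_def)
  moreover have "(- frag_of y) \<in> carrier ?G" using k by simp
  ultimately show ?thesis
    using N.rcos_sum[OF x(1)] by (simp add: groth_group_def groth_class_def FactGroup_def)
qed

lemma mod_ses_subset: "mod_ses B \<subseteq> Collect (fd_module B) \<times> Collect (fd_module B) \<times> Collect (fd_module B)"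
  by (auto simp: mod_ses_def)

section \<open>The index, the frieze function and the antisymmetrised form on
  representatives\<close>

context cluster_tilted
begin

lemma add_split_subset: "add_split C T \<subseteq> Collect (in_add C T) \<times> Collect (in_add C T) \<times> Collect (in_add C T)"
  by (auto simp: add_split_def)

text \<open>By \<open>add_resolution_unique\<close> two triangles for X give an object Q that is a
  biproduct of U1 and V0 and also of V1 and U0. The difference of the two relations for Q identifies
  [V0] - [V1] with [U0] - [U1], which justifies the definite description.\<close>

lemma index_eq:
  assumes r: "add_resolution X U1 U0 u v w"
  shows "index C T X = groth_relations (Collect (in_add C T)) (add_split C T)
    #>\<^bsub>free_Abelian_group (Collect (in_add C T))\<^esub> (frag_of U0 - frag_of U1)"
proof -
  let ?S = "Collect (in_add C T)" and ?R = "add_split C T"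
  let ?N = "groth_relations ?S ?R" and ?G = "free_Abelian_group ?S"
  interpret N: normal ?N ?G by (rule groth_relations_normal[OF add_split_subset])
  have cls: "K0_add_class C T V0 \<otimes>\<^bsub>K0_add C T\<^esub> inv\<^bsub>K0_add C T\<^esub> K0_add_class C T V1 = ?N #>\<^bsub>?G\<^esub> (frag_of V0 - frag_of V1)"
    if "in_add C T V0" "in_add C T V1" for V0 V1
    using groth_class_diff[OF add_split_subset, of V0 V1] that by (simp add: K0_add_class_def K0_add_def)
  have uniq: "?N #>\<^bsub>?G\<^esub> (frag_of V0 - frag_of V1) = ?N #>\<^bsub>?G\<^esub> (frag_of U0 - frag_of U1)"
    if r': "add_resolution X V1 V0 u' v' w'" for V1 V0 u' v' w'
  proof -
    note d = add_resolutionD[OF r] and d' = add_resolutionD[OF r']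
    obtain Q where Q: "is_biproduct C U1 V0 Q" "is_biproduct C V1 U0 Q" using add_resolution_unique[OF r r'] .
    have Qadd: "in_add C T Q" using in_add_biproduct[OF d(1) d'(2) Q(1)] .
    have rel: "frag_of Q - frag_of U1 - frag_of V0 \<in> ?N" "frag_of Q - frag_of V1 - frag_of U0 \<in> ?N"
      unfolding groth_relations_def using Q Qadd d(1,2) d'(1,2)
      by (auto intro!: generate.incl simp: add_split_def)
    have "(frag_of Q - frag_of V1 - frag_of U0) \<otimes>\<^bsub>?G\<^esub> inv\<^bsub>?G\<^esub> (frag_of Q - frag_of U1 - frag_of V0) \<in> ?N"
      using subgroup.m_closed[OF N.subgroup_axioms rel(2) subgroup.m_inv_closed[OF N.subgroup_axioms rel(1)]] .
    moreover have "Poly_Mapping.keys (frag_of Q - frag_of U1 - frag_of V0) \<subseteq> ?S" using subsetD[OF N.subset rel(1)] by simp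
    ultimately have n: "(frag_of V0 - frag_of V1) - (frag_of U0 - frag_of U1) \<in> ?N"
      by (simp add: algebra_simps)
    have c: "frag_of U0 - frag_of U1 \<in> carrier ?G" "frag_of V0 - frag_of V1 \<in> carrier ?G"
      using keys_diff[of "frag_of U0" "frag_of U1"] keys_diff[of "frag_of V0" "frag_of V1"] d(1,2) d'(1,2)
      by (auto simp: keys_frag_of)
    have "frag_of V0 - frag_of V1 \<in> ?N #>\<^bsub>?G\<^esub> (frag_of U0 - frag_of U1)"
      using n by (auto simp: r_coset_def intro!: bexI[of _ "(frag_of V0 - frag_of V1) - (frag_of U0 - frag_of U1)"])
    then show ?thesis using N.repr_independence[OF _ c(1) N.subgroup_axioms] by simp
  qed
  show ?thesis
    unfolding index_def
  proof (rule the_equality)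
    show "\<exists>T1 T0 u v w. in_add C T T1 \<and> in_add C T T0 \<and> Tri C T1 T0 X u v w \<and>
       ?N #>\<^bsub>?G\<^esub> (frag_of U0 - frag_of U1) = K0_add_class C T T0 \<otimes>\<^bsub>K0_add C T\<^esub> inv\<^bsub>K0_add C T\<^esub> K0_add_class C T T1"
      using add_resolutionD(1-3)[OF r] cls by metis
  next
    fix g assume "\<exists>T1 T0 u v w. in_add C T T1 \<and> in_add C T T0 \<and> Tri C T1 T0 X u v w \<and>
       g = K0_add_class C T T0 \<otimes>\<^bsub>K0_add C T\<^esub> inv\<^bsub>K0_add C T\<^esub> K0_add_class C T T1"
    then obtain V1 V0 u' v' w' where "in_add C T V1" "in_add C T V0" "Tri C V1 V0 X u' v' w'"
      "g = K0_add_class C T V0 \<otimes>\<^bsub>K0_add C T\<^esub> inv\<^bsub>K0_add C T\<^esub> K0_add_class C T V1" by (elim exE conjE)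
    then show "g = ?N #>\<^bsub>?G\<^esub> (frag_of U0 - frag_of U1)"
      using cls uniq by (simp add: add_resolution_def)
  qed
qed

text \<open>The object is chosen so that its suspension represents M, to fit
  \<open>antisym_euler_form\<close>, where both modules have the form F \<Sigma>V.\<close>

definition obj_of :: "('k, 'm) fmod \<Rightarrow> 'o"
  where "obj_of M = (SOME V. \<exists>\<theta>. represents (susp C V) M \<theta>)"

lemma obj_ofE:
  assumes "fd_module B M"
  obtains \<theta> where "represents (susp C (obj_of M)) M \<theta>"
proof -
  have "\<exists>V \<theta>. represents (susp C V) M \<theta>" using represents_susp_exists[OF assms] by metis
  then have "\<exists>\<theta>. represents (susp C (obj_of M)) M \<theta>" unfolding obj_of_def by (rule someI_ex)
  then show ?thesis using that by blast
qed

lemma K0_mod_keys: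
  assumes "m \<in> carrier (K0_mod B)" "v \<in> m" "M \<in> Poly_Mapping.keys v"
  shows "fd_module B M"
proof -
  obtain a where a: "Poly_Mapping.keys a \<subseteq> Collect (fd_module B)"
    "m = groth_relations (Collect (fd_module B)) (mod_ses B) #>\<^bsub>free_Abelian_group (Collect (fd_module B))\<^esub> a"
    using groth_groupE[OF assms(1)[unfolded K0_mod_def]] .
  then show ?thesis using groth_coset_memD(1)[OF mod_ses_subset a(1)] assms(2,3) by blast
qed

text \<open>Passes from Grothendieck classes to \<open>ev\<close>. The pairing may be computed on
  any representatives, since its values are additive on biproducts in add T and on short exact
  sequences; with U0 - U1 for the index, \<open>ev_add_resolution\<close> evaluates each
  term.\<close>

lemma frieze_fun_eq:
  assumes m: "m \<in> carrier (K0_mod B)" and v: "v \<in> m"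
  shows "frieze_fun C T m X = frag_eval v (\<lambda>M. ev (susp C (obj_of M)) X)"
proof -
  obtain U1 U0 a b c where r: "add_resolution X U1 U0 a b c" by (rule add_resolution_exists)
  note d = add_resolutionD[OF r]
  let ?\<phi> = "\<lambda>U M :: ('k, 'm) fmod. int (dim_Hom_mod B (F_mod C T U) M)"
  let ?S = "Collect (in_add C T)"
  have dim: "?\<phi> U M = dHom U (susp C (obj_of M))" if U: "in_add C T U" and M: "fd_module B M" for U M
  proof -
    obtain \<theta> where "represents (susp C (obj_of M)) M \<theta>" using obj_ofE[OF M] .
    then show ?thesis using dim_Hom_mod_eq[OF represents_F[of U]] ghost_in_add[OF U] by simp
  qed
  have k: "Poly_Mapping.keys (frag_of U0 - frag_of U1) \<subseteq> ?S"
    using keys_diff[of "frag_of U0" "frag_of U1"] d(1,2) by (auto simp: keys_frag_of)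
  have "index C T X \<in> carrier (groth_group ?S (add_split C T))"
    unfolding index_eq[OF r] using k by (auto simp: groth_group_def FactGroup_def RCOSETS_def)
  moreover have "frag_of U0 - frag_of U1 \<in> index C T X"
    unfolding index_eq[OF r] by (rule groth_class_mem[OF add_split_subset k])
  ultimately have "frieze_fun C T m X = biadditive ?\<phi> (frag_of U0 - frag_of U1) v"
    unfolding frieze_fun_def
  proof (intro groth_pairing_eq[OF add_split_subset mod_ses_subset _ m[unfolded K0_mod_def] _ _ _ v])
    fix X Z Y and M :: "('k, 'm) fmod" assume xyz: "(X, Z, Y) \<in> add_split C T" and M: "M \<in> Collect (fd_module B)"
    then have "dHom Z (susp C (obj_of M)) = dHom X (susp C (obj_of M)) + dHom Y (susp C (obj_of M))"
      using dim_biproduct[of X Y Z "\<lambda>A. Hom C A (susp C (obj_of M))" "susp C (obj_of M)"] Hom_finite Cmp_in_Hom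
      by (auto simp: add_split_def)
    then show "?\<phi> Z M = ?\<phi> X M + ?\<phi> Y M" using dim xyz M by (auto simp: add_split_def)
  next
    fix L M N :: "('k, 'm) fmod" and U assume ses: "(L, M, N) \<in> mod_ses B" and U: "U \<in> ?S"
    then have fd: "fd_module B L" "fd_module B M" "fd_module B N" "short_exact B L M N" by (auto simp: mod_ses_def)
    obtain \<theta>L where rL: "represents (susp C (obj_of L)) L \<theta>L" using obj_ofE[OF fd(1)] .
    obtain \<theta>M where rM: "represents (susp C (obj_of M)) M \<theta>M" using obj_ofE[OF fd(2)] .
    obtain \<theta>N where rN: "represents (susp C (obj_of N)) N \<theta>N" using obj_ofE[OF fd(3)] .
    show "?\<phi> U M = ?\<phi> U L + ?\<phi> U N"
      using dHom_short_exact[OF _ fd rL rM rN] U dim fd by simp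
  qed
  also have "\<dots> = frag_eval v (\<lambda>M. ?\<phi> U0 M - ?\<phi> U1 M)"
    by (simp add: biadditive_right frag_eval_diff frag_eval_frag_of)
  also have "\<dots> = frag_eval v (\<lambda>M. ev (susp C (obj_of M)) X)"
    using dim d(1,2) K0_mod_keys[OF m v] ev_add_resolution[OF r] by (intro frag_eval_cong) simp
  finally show ?thesis .
qed

text \<open>Palu's theorem that the antisymmetrised Euler form descends to \<open>K\<^sub>0(mod B)\<close>: for \<open>X = F \<Sigma>W\<close> it
  is \<open>M \<mapsto> ev M \<Sigma>W + ev M W\<close>, a combination of dimensions of \<open>Hom\<^sub>B(P, M)\<close> with \<open>P\<close> projective.\<close>

lemma antisym_euler_additive:
  assumes "(L, M, N) \<in> mod_ses B" "fd_module B X"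
  shows "euler_form B X M - euler_form B M X =
    (euler_form B X L - euler_form B L X) + (euler_form B X N - euler_form B N X)"
proof -
  have fd: "fd_module B L" "fd_module B M" "fd_module B N" "short_exact B L M N"
    using assms(1) by (auto simp: mod_ses_def)
  obtain \<theta>L where rL: "represents (susp C (obj_of L)) L \<theta>L" using obj_ofE[OF fd(1)] .
  obtain \<theta>M where rM: "represents (susp C (obj_of M)) M \<theta>M" using obj_ofE[OF fd(2)] .
  obtain \<theta>N where rN: "represents (susp C (obj_of N)) N \<theta>N" using obj_ofE[OF fd(3)] .
  obtain \<theta>X where rX: "represents (susp C (obj_of X)) X \<theta>X" using obj_ofE[OF assms(2)] .
  show ?thesis
    using antisym_euler_form[OF rX rL] antisym_euler_form[OF rX rM] antisym_euler_form[OF rX rN]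
      ev_short_exact[OF fd rL rM rN] by simp
qed

lemma antisym_form_eq:
  assumes m: "m \<in> carrier (K0_mod B)" and v: "v \<in> m" and N: "fd_module B N"
  shows "antisym_form B (K0_mod_class B N) m = frag_eval v (\<lambda>M. euler_form B N M - euler_form B M N)"
proof -
  let ?\<phi> = "\<lambda>X Y :: ('k, 'm) fmod. euler_form B X Y - euler_form B Y X"
  let ?S = "Collect (fd_module B :: ('k, 'm) fmod \<Rightarrow> bool)"
  have "antisym_form B (K0_mod_class B N) m = biadditive ?\<phi> (frag_of N) v"
    unfolding antisym_form_def
  proof (rule groth_pairing_eq[OF mod_ses_subset mod_ses_subset _ m[unfolded K0_mod_def] _ _ _ v])
    show "K0_mod_class B N \<in> carrier (groth_group ?S (mod_ses B))"
      unfolding K0_mod_class_def by (rule groth_class_in_carrier) (simp add: N)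
    show "frag_of N \<in> K0_mod_class B N"
      unfolding K0_mod_class_def groth_class_def
      by (rule groth_class_mem[OF mod_ses_subset]) (simp add: keys_frag_of N)
  qed (use antisym_euler_additive in fastforce)+
  then show ?thesis by (simp add: biadditive_left frag_eval_frag_of)
qed

text \<open>Here the antisymmetrised form meets the defect of additivity found in
  \<open>ev_triangle\<close>. The right-hand side depends only on W, so modules represented by the
  same object get the same value.\<close>

lemma antisym_form_represents:
  assumes m: "m \<in> carrier (K0_mod B)" and r: "represents (susp C W) N \<theta>"
  shows "antisym_form B (K0_mod_class B N) m = frieze_fun C T m (susp C W) + frieze_fun C T m W"
proof -
  obtain v where v: "v \<in> m"
    using groth_groupE[OF m[unfolded K0_mod_def]] groth_class_mem[OF mod_ses_subset] by metis
  have "antisym_form B (K0_mod_class B N) m =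
      frag_eval v (\<lambda>M. ev (susp C (obj_of M)) (susp C W) + ev (susp C (obj_of M)) W)"
    unfolding antisym_form_eq[OF m v represents_fd_module[OF r]]
  proof (rule frag_eval_cong)
    fix M assume "M \<in> Poly_Mapping.keys v"
    then obtain \<theta>' where "represents (susp C (obj_of M)) M \<theta>'" using obj_ofE K0_mod_keys[OF m v] by metis
    then show "euler_form B N M - euler_form B M N = ev (susp C (obj_of M)) (susp C W) + ev (susp C (obj_of M)) W"
      by (rule antisym_euler_form[OF r])
  qed
  then show ?thesis by (simp add: frag_eval_add_fun frieze_fun_eq[OF m v])
qed

lemma antisym_form_additive:
  assumes m: "m \<in> carrier (K0_mod B)" and s: "(L, M, N) \<in> mod_ses B"
  shows "antisym_form B (K0_mod_class B M) m = antisym_form B (K0_mod_class B L) m + antisym_form B (K0_mod_class B N) m"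
proof -
  obtain v where v: "v \<in> m"
    using groth_groupE[OF m[unfolded K0_mod_def]] groth_class_mem[OF mod_ses_subset] by metis
  have fd: "fd_module B L" "fd_module B M" "fd_module B N" using s by (auto simp: mod_ses_def)
  have "frag_eval v (\<lambda>X. euler_form B M X - euler_form B X M) =
    frag_eval v (\<lambda>X. (euler_form B L X - euler_form B X L) + (euler_form B N X - euler_form B X N))"
    using antisym_euler_additive[OF s] K0_mod_keys[OF m v] by (intro frag_eval_cong) fastforce
  then show ?thesis
    by (simp add: antisym_form_eq[OF m v] fd frag_eval_add_fun)
qed

section \<open>Simple modules\<close>

text \<open>Splitting e and 1 - e exhibits X as a biproduct of their images, one of which must be
  zero.\<close>

lemma indecomposable_idempotent:
  assumes X: "indecomposable C X" and e: "e \<in> Hom C X X" "e \<cdot> e = e"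
  shows "e = 0 \<or> e = Id C X"
proof -
  have split: "\<exists>Y p i. p \<in> Hom C X Y \<and> i \<in> Hom C Y X \<and> p \<cdot> i = Id C Y \<and> i \<cdot> p = e"
    if "e \<in> Hom C X X" "e \<cdot> e = e" for e
    using idempotents that unfolding idempotents_split_def by metis
  let ?f = "Id C X - e"
  have f: "?f \<in> Hom C X X" using Hom_diff[OF Id_in_Hom e(1)] .
  have fe: "?f \<cdot> e = 0" "e \<cdot> ?f = 0"
    using Cmp_diff_left[OF e(1) Id_in_Hom e(1)] Cmp_diff_right[OF Id_in_Hom e(1) e(1)] e
      Cmp_Id_left[OF e(1)] Cmp_Id_right[OF e(1)] by simp_all
  have ff: "?f \<cdot> ?f = ?f"
    using Cmp_diff_right[OF Id_in_Hom e(1) f] Cmp_Id_right[OF f] fe by simp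
  obtain Y p i where Y: "p \<in> Hom C X Y" "i \<in> Hom C Y X" "p \<cdot> i = Id C Y" "i \<cdot> p = e" using split[OF e] by blast
  obtain Z q j where Z: "q \<in> Hom C X Z" "j \<in> Hom C Z X" "q \<cdot> j = Id C Z" "j \<cdot> q = ?f" using split[OF f ff] by blast
  \<comment> \<open>Since \<open>s \<cdot> k = s \<cdot> (t \<cdot> s) \<cdot> (k \<cdot> l) \<cdot>
    k\<close>, orthogonality of the two idempotents in the middle is enough.\<close>
  have orth: "s \<cdot> k = 0"
    if "s \<in> Hom C X A" "t \<in> Hom C A X" "s \<cdot> t = Id C A" "k \<in> Hom C A' X" "l \<in> Hom C X A'" "l \<cdot> k = Id C A'"
      "(t \<cdot> s) \<cdot> (k \<cdot> l) = 0" for A A' s t k l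
  proof -
    have ts: "t \<cdot> s \<in> Hom C X X" and kl: "k \<cdot> l \<in> Hom C X X" using Cmp_in_Hom that by blast+
    have "s \<cdot> k = (s \<cdot> (t \<cdot> s)) \<cdot> ((k \<cdot> l) \<cdot> k)"
      using Cmp_assoc[OF that(1,2,1)] Cmp_assoc[OF that(4,5,4)] that(3,6) Cmp_Id_left[OF that(1)] Cmp_Id_right[OF that(4)]
      by simp
    also have "\<dots> = (s \<cdot> ((t \<cdot> s) \<cdot> (k \<cdot> l))) \<cdot> k"
      using Cmp_assoc[OF that(4) kl Cmp_in_Hom[OF ts that(1)]] Cmp_assoc[OF kl ts that(1)] by simp
    finally show ?thesis using that(7) Cmp_0_right[OF that(1)] Cmp_0_left[OF that(4)] by simp
  qed
  have "is_biproduct C Y Z X"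
  proof (rule is_biproductI[OF Y(2) Z(2) Y(1) Z(1) Y(3) Z(3)])
    show "q \<cdot> i = 0" using orth[OF Z(1,2,3) Y(2,1,3)] Y(4) Z(4) fe by simp
    show "p \<cdot> j = 0" using orth[OF Y(1,2,3) Z(2,1,3)] Y(4) Z(4) fe by simp
    show "i \<cdot> p + j \<cdot> q = Id C X" using Y(4) Z(4) by simp
  qed
  then have "is_zero C Y \<or> is_zero C Z" using X by (simp add: indecomposable_def)
  then show ?thesis
  proof
    assume "is_zero C Y"
    then have "p = 0" using Hom_zero_target Y(1) by blast
    then show ?thesis using Y(4) Cmp_0_right[OF Y(2)] by simp
  next
    assume "is_zero C Z"
    then have "q = 0" using Hom_zero_target Z(1) by blast
    then show ?thesis using Z(4) Cmp_0_right[OF Z(2)] by simp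
  qed
qed

text \<open>Fitting's lemma: the right ideals \<open>x\<^sup>k End(X)\<close> stabilise, and for \<open>y = x\<^sup>k\<close> with \<open>y End(X) = y\<^sup>2 End(X)\<close>
  the solution \<open>e\<close> of \<open>y e = y\<close> in \<open>y End(X)\<close> is idempotent.\<close>

lemma indecomposable_local:
  assumes X: "indecomposable C X" and x: "x \<in> Hom C X X"
  shows "\<exists>c\<in>Hom C X X. x \<cdot> c = Id C X \<or> (Id C X - x) \<cdot> c = Id C X"
proof -
  define pw where "pw k = ((\<lambda>y. x \<cdot> y) ^^ k) (Id C X)" for k :: nat
  have pw0: "pw 0 = Id C X" and pwS: "pw (Suc k) = x \<cdot> pw k" for k by (simp_all add: pw_def)
  have pw: "pw k \<in> Hom C X X" for k
    by (induction k) (simp_all add: pw0 pwS Id_in_Hom Cmp_in_Hom[OF _ x])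
  have pw_add: "pw (k + l) = pw k \<cdot> pw l" for k l
    by (induction k) (simp_all add: pw0 pwS Cmp_Id_left[OF pw] Cmp_assoc[OF pw pw x])
  let ?I = "\<lambda>y. (\<lambda>c. y \<cdot> c) ` Hom C X X"
  have I: "hom.subspace (?I y)" "?I y \<subseteq> Hom C X X" "fin_dim_subspace (smul C) (?I y)" if y: "y \<in> Hom C X X" for y
    using rank_nullity(1)[OF ambient_vector_space ambient_vector_space lin_on_post[OF y] Hom_finite] Cmp_in_Hom[OF _ y]
    by (auto simp: fin_dim_subspace_def)
  \<comment> \<open>Only exponents at least 1 are compared, so that y is a multiple of x.\<close>
  obtain n where n: "\<And>k. hom.dim (?I (pw (Suc n))) \<le> hom.dim (?I (pw (Suc k)))"
    using ex_has_least_nat[of "\<lambda>_. True" 0 "\<lambda>k. hom.dim (?I (pw (Suc k)))"] by auto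
  define y where "y = pw (Suc n)"
  have y: "y \<in> Hom C X X" unfolding y_def by (rule pw)
  have yy: "y \<cdot> y \<in> Hom C X X" using Cmp_in_Hom[OF y y] .
  have yyI: "?I (y \<cdot> y) \<subseteq> ?I y"
    using Cmp_assoc[OF _ y y, symmetric] Cmp_in_Hom[OF _ y] by auto
  \<comment> \<open>\<open>y \<cdot> y\<close> is the power of x with exponent
    \<open>Suc (Suc (n + n))\<close>, to which minimality applies.\<close>
  have "hom.dim (?I y) \<le> hom.dim (?I (y \<cdot> y))"
    unfolding y_def using n[of "Suc (n + n)"] by (simp flip: pw_add)
  then have Iyy: "?I (y \<cdot> y) = ?I y" by (rule hom.dim_eq_imp_eq[OF I(3)[OF y] I(1)[OF yy] yyI])
  have "(\<lambda>z. y \<cdot> z) ` ?I y = ?I (y \<cdot> y)"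
    unfolding image_image using Cmp_assoc[OF _ y y] by (intro image_cong) auto
  then have img: "(\<lambda>z. y \<cdot> z) ` ?I y = ?I y" using Iyy by simp
  have "hom.dim {z \<in> ?I y. y \<cdot> z = 0} = 0"
    using rank_nullity(2)[OF ambient_vector_space ambient_vector_space lin_on_mono[OF lin_on_post[OF y] I(2)[OF y]] I(3)[OF y]] img
    by simp
  then have kernel: "{z \<in> ?I y. y \<cdot> z = 0} = {0}"
    using subspace_kernel_on[OF ambient_vector_space lin_on_mono[OF lin_on_post[OF y] I(2)[OF y]] I(1)[OF y] ambient_vector_space]
    by (intro hom.dim_eq_0_imp hom.fin_dim_subset[OF I(3)[OF y]]) auto
  have "y \<in> ?I y" using Cmp_Id_right[OF y] Id_in_Hom by (metis image_eqI)
  then obtain c where c: "c \<in> Hom C X X" "y = y \<cdot> y \<cdot> c" unfolding Iyy[symmetric] by blast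
  let ?e = "y \<cdot> c"
  have e: "?e \<in> Hom C X X" "?e \<in> ?I y" using Cmp_in_Hom[OF c(1) y] c(1) by auto
  have ye: "y \<cdot> ?e = y" using Cmp_assoc[OF c(1) y y] c(2) by simp
  have eI: "?e \<cdot> ?e \<in> ?I y" using Cmp_assoc[OF e(1) c(1) y, symmetric] Cmp_in_Hom[OF e(1) c(1)] by simp
  have "y \<cdot> (?e \<cdot> ?e - ?e) = 0"
    using Cmp_diff_right[OF Cmp_in_Hom[OF e(1) e(1)] e(1) y] Cmp_assoc[OF e(1) e(1) y] ye by simp
  then have "?e \<cdot> ?e - ?e \<in> {z \<in> ?I y. y \<cdot> z = 0}"
    using hom.subspace_diff[OF I(1)[OF y] eI e(2)] by simp
  then have "?e \<cdot> ?e = ?e" unfolding kernel by simp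
  then have "?e = 0 \<or> ?e = Id C X" by (rule indecomposable_idempotent[OF X e(1)])
  then show ?thesis
  proof
    assume "?e = Id C X"
    then have "x \<cdot> (pw n \<cdot> c) = Id C X" using Cmp_assoc[OF c(1) pw x] by (simp add: y_def pwS)
    then show ?thesis using Cmp_in_Hom[OF c(1) pw] by blast
  next
    assume "?e = 0"
    then have "pw (Suc n) = 0" using ye Cmp_0_right[OF y] by (simp add: y_def)
    \<comment> \<open>A geometric sum: s is 1 + x + ... + x^(k-1), and the power of x vanishes for k
      = Suc n.\<close>
    moreover have "\<exists>s\<in>Hom C X X. (Id C X - x) \<cdot> s = Id C X - pw k" for k
    proof (induction k)
      case 0
      show ?case using Cmp_0_right[OF Hom_diff[OF Id_in_Hom x]] by (intro bexI[of _ 0]) (simp_all add: pw0)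
    next
      case (Suc k)
      then obtain s where s: "s \<in> Hom C X X" "(Id C X - x) \<cdot> s = Id C X - pw k" by blast
      have "(Id C X - x) \<cdot> (s + pw k) = Id C X - pw (Suc k)"
        using Cmp_add_right[OF s(1) pw Hom_diff[OF Id_in_Hom x], of k] s(2)
          Cmp_diff_left[OF pw Id_in_Hom x, of k] Cmp_Id_left[OF pw, of k] by (simp add: pwS)
      then show ?case using Hom_add[OF s(1) pw] by blast
    qed
    ultimately show ?thesis by (metis diff_zero)
  qed
qed

text \<open>If N' is not inside N, then N + N' is everything and p = a + a' with a in N and a' in
  N'. As \<open>a \<cdot> i\<close> and \<open>a' \<cdot> i\<close> add up to the identity and
  End(X) is local, one of them is right invertible; then a or a' generates F X, and N or N' is not
  proper.\<close>

lemma maximal_submodule_unique: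
  assumes X: "indecomposable C X" and i: "i \<in> Hom C X T" "p \<in> Hom C T X" "p \<cdot> i = Id C X"
    and N: "maximal_submodule B (F_mod C T X) N" and N': "maximal_submodule B (F_mod C T X) N'"
  shows "N' \<subseteq> N"
proof (rule ccontr)
  assume ne: "\<not> N' \<subseteq> N"
  have F: "mcarr (F_mod C T X) = Hom C T X" "mscale (F_mod C T X) = smul C" "mact (F_mod C T X) = Cmp C"
    by (simp_all add: F_mod_def)
  have sub: "hom.subspace N" "N \<subseteq> Hom C T X" "\<And>x b. x \<in> N \<Longrightarrow> b \<in> Hom C T T \<Longrightarrow> x \<cdot> b \<in> N" "N \<noteq> Hom C T X"
    "hom.subspace N'" "N' \<subseteq> Hom C T X" "\<And>x b. x \<in> N' \<Longrightarrow> b \<in> Hom C T T \<Longrightarrow> x \<cdot> b \<in> N'" "N' \<noteq> Hom C T X"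
    using N N' by (auto simp: maximal_submodule_def submodule_of_def F)
  define S where "S = {x + y |x y. x \<in> N \<and> y \<in> N'}"
  have S: "submodule_of B (F_mod C T X) S"
    unfolding submodule_of_def F B_simps
  proof (intro conjI ballI)
    show "S \<subseteq> Hom C T X" unfolding S_def using sub(2,6) Hom_add by blast
    show "hom.subspace S" unfolding S_def by (rule hom.subspace_sums[OF sub(1,5)])
    fix z b assume "z \<in> S" and b: "b \<in> Hom C T T"
    then obtain x y where xy: "z = x + y" "x \<in> N" "y \<in> N'" unfolding S_def by blast
    then have "z \<cdot> b = x \<cdot> b + y \<cdot> b" using Cmp_add_left[OF b, of x X y] sub(2,6) by auto
    then show "z \<cdot> b \<in> S" unfolding S_def using sub(3)[OF xy(2) b] sub(7)[OF xy(3) b] by blast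
  qed
  have "N \<subseteq> S" "N' \<subseteq> S"
    unfolding S_def using hom.subspace_0[OF sub(5)] hom.subspace_0[OF sub(1)] by force+
  moreover have "N \<subseteq> S \<Longrightarrow> S = N \<or> S = Hom C T X"
    using N S unfolding maximal_submodule_def F by blast
  ultimately have "S = Hom C T X" using ne by blast
  then obtain a a' where a: "p = a + a'" "a \<in> N" "a' \<in> N'" using i(2) unfolding S_def by blast
  have aH: "a \<in> Hom C T X" "a' \<in> Hom C T X" using a sub(2,6) by auto
  \<comment> \<open>Every h equals \<open>k \<cdot> (i \<cdot> (c \<cdot> h))\<close>, and
    \<open>i \<cdot> (c \<cdot> h)\<close> lies in End(T).\<close>
  have full: "K = Hom C T X"
    if K: "K \<subseteq> Hom C T X" "\<And>x b. x \<in> K \<Longrightarrow> b \<in> Hom C T T \<Longrightarrow> x \<cdot> b \<in> K" and k: "k \<in> K"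
      and c: "c \<in> Hom C X X" "(k \<cdot> i) \<cdot> c = Id C X" for K k c
  proof
    have kH: "k \<in> Hom C T X" using k K(1) by blast
    show "Hom C T X \<subseteq> K"
    proof
      fix h assume h: "h \<in> Hom C T X"
      have ch: "c \<cdot> h \<in> Hom C T X" using Cmp_in_Hom[OF h c(1)] .
      have "k \<cdot> (i \<cdot> (c \<cdot> h)) = h"
        using Cmp_assoc[OF ch i(1) kH] Cmp_assoc[OF h c(1) Cmp_in_Hom[OF i(1) kH]] c(2) Cmp_Id_left[OF h] by simp
      then show "h \<in> K" using K(2)[OF k Cmp_in_Hom[OF ch i(1)]] by simp
    qed
  qed (rule that(1))
  have "Id C X = (a + a') \<cdot> i" by (subst a(1)[symmetric]) (rule i(3)[symmetric])
  also have "\<dots> = a \<cdot> i + a' \<cdot> i" by (rule Cmp_add_left[OF i(1) aH])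
  finally have "Id C X - a \<cdot> i = a' \<cdot> i" by (simp only: add_diff_cancel_left')
  then obtain c where "c \<in> Hom C X X" "a \<cdot> i \<cdot> c = Id C X \<or> a' \<cdot> i \<cdot> c = Id C X"
    using indecomposable_local[OF X Cmp_in_Hom[OF i(1) aH(1)]] by auto
  then show False using full[OF sub(2,3) a(2)] full[OF sub(6,7) a(3)] sub(4,8) by blast
qed

text \<open>A submodule containing the kernel is the full preimage of its image, and that image is a
  submodule of the simple module S.\<close>

lemma kernel_maximal:
  assumes M: "fd_module B M" and S: "simple_mod B S" and p: "p \<in> Hom_mod B M S" "p ` mcarr M = mcarr S"
  shows "maximal_submodule B M (map_kernel M p)"
proof -
  have fS: "fd_module B S" and ne: "mcarr S \<noteq> {0}"
    and simp: "\<And>N. submodule_of B S N \<Longrightarrow> N = {0} \<or> N = mcarr S"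
    using S by (auto simp: simple_mod_def)
  have "K = map_kernel M p \<or> K = mcarr M" if K: "submodule_of B M K" "map_kernel M p \<subseteq> K" for K
  proof -
    have KM: "K \<subseteq> mcarr M" using K(1) by (auto simp: submodule_of_def)
    have fK: "fd_module B (M\<lparr>mcarr := K\<rparr>)" by (rule fd_module_sub[OF M K(1)])
    \<comment> \<open>The restriction of p to K, set to 0 outside K as \<open>Hom_mod\<close>
      demands.\<close>
    define q where "q x = (if x \<in> K then p x else 0)" for x
    have q: "q \<in> Hom_mod B (M\<lparr>mcarr := K\<rparr>) S"
      using Hom_modD[OF p(1)] KM fd_module_closed[OF fK] fd_moduleD(4)[OF fK]
      by (intro Hom_modI lin_onI) (auto simp: q_def subset_iff)
    have "submodule_of B S (q ` K)" using submodule_image[OF fK fS q] by simp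
    moreover have "q ` K = p ` K" by (auto simp: q_def)
    ultimately have "p ` K = {0} \<or> p ` K = mcarr S" using simp by auto
    then show ?thesis
    proof
      assume "p ` K = {0}"
      then have "K \<subseteq> map_kernel M p" using KM by (auto simp: map_kernel_def)
      then show ?thesis using K(2) by blast
    next
      assume e: "p ` K = mcarr S"
      have "x \<in> K" if x: "x \<in> mcarr M" for x
      proof -
        obtain k where k: "k \<in> K" "p x = p k" using e Hom_modD(1)[OF p(1) x] by (metis imageE)
        have "x - k \<in> map_kernel M p"
          using Hom_mod_diff_arg[OF M p(1) x] k KM fd_module_closed(3)[OF M x] by (auto simp: map_kernel_def)
        then have "x - k \<in> K" using K(2) by blast
        then show ?thesis using fd_module_closed(2)[OF fK, of "x - k" k] k(1) by simp
      qed
      then show ?thesis using KM by blast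
    qed
  qed
  moreover have "map_kernel M p \<noteq> mcarr M"
  proof
    assume e: "map_kernel M p = mcarr M"
    then have "p x = 0" if "x \<in> mcarr M" for x using that unfolding map_kernel_def by blast
    then have "y = 0" if "y \<in> mcarr S" for y using that unfolding p(2)[symmetric] by blast
    then show False using ne fd_module_closed(1)[OF fS] by blast
  qed
  ultimately show ?thesis using submodule_kernel[OF M fS p(1)] by (auto simp: maximal_submodule_def)
qed

text \<open>Quotients of M with the same kernel are isomorphic. This is expressed through a common
  representing object, from which \<open>antisym_form_represents\<close> computes the form.\<close>

lemma represents_same_kernel:
  fixes Q S :: "('k, 'm) fmod" and M :: "('k, 'v::ab_group_add, 'm) rmod"
  assumes M: "fd_module B M" and Q: "fd_module B Q" and S: "fd_module B S"
    and p: "p \<in> Hom_mod B M Q" "p ` mcarr M = mcarr Q"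
    and p': "p' \<in> Hom_mod B M S" "p' ` mcarr M = mcarr S" and ker: "map_kernel M p = map_kernel M p'"
    and r: "represents Z Q \<theta>"
  obtains \<theta>' where "represents Z S \<theta>'"
proof -
  note d = representsD[OF r]
  have eq: "p x = p y \<longleftrightarrow> p' x = p' y" if x: "x \<in> mcarr M" "y \<in> mcarr M" for x y
  proof -
    have "p x = p y \<longleftrightarrow> x - y \<in> map_kernel M p"
      using Hom_mod_diff_arg[OF M p(1) x] fd_module_closed(3)[OF M x] by (auto simp: map_kernel_def)
    also have "\<dots> \<longleftrightarrow> p' x = p' y"
      unfolding ker using Hom_mod_diff_arg[OF M p'(1) x] fd_module_closed(3)[OF M x] by (auto simp: map_kernel_def)
    finally show ?thesis .
  qed
  define \<theta>' where "\<theta>' h = p' (inv_into (mcarr M) p (\<theta> h))" for h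
  have lift: "\<exists>x\<in>mcarr M. \<theta> h = p x" if "h \<in> Hom C T Z" for h using that d(4) p(2) by (metis image_eqI imageE)
  have \<theta>': "\<theta>' h = p' x" if "h \<in> Hom C T Z" "x \<in> mcarr M" "\<theta> h = p x" for h x
  proof -
    have "\<theta> h \<in> p ` mcarr M" using that by simp
    then have "inv_into (mcarr M) p (\<theta> h) \<in> mcarr M" "p (inv_into (mcarr M) p (\<theta> h)) = p x"
      using that(3) by (auto simp: inv_into_into f_inv_into_f)
    then show ?thesis unfolding \<theta>'_def using eq that(2) by blast
  qed
  have l: "lin_on (smul C) (mscale S) (Hom C T Z) \<theta>'"
  proof (rule lin_onI)
    fix h h' assume h: "h \<in> Hom C T Z" "h' \<in> Hom C T Z"
    obtain x x' where x: "x \<in> mcarr M" "\<theta> h = p x" "x' \<in> mcarr M" "\<theta> h' = p x'" using lift h by metis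
    have "\<theta> (h + h') = p (x + x')" using lin_on_add[OF d(2) h] x Hom_modD(4)[OF p(1)] by simp
    then show "\<theta>' (h + h') = \<theta>' h + \<theta>' h'"
      using \<theta>'[OF Hom_add[OF h] fd_module_closed(2)[OF M x(1,3)]] \<theta>'[OF h(1) x(1,2)] \<theta>'[OF h(2) x(3,4)]
        Hom_modD(4)[OF p'(1) x(1,3)] by simp
  next
    fix c h assume h: "h \<in> Hom C T Z"
    obtain x where x: "x \<in> mcarr M" "\<theta> h = p x" using lift h by metis
    have "\<theta> (smul C c h) = p (mscale M c x)" using lin_on_scale[OF d(2) h] x Hom_modD(5)[OF p(1)] by simp
    then show "\<theta>' (smul C c h) = mscale S c (\<theta>' h)"
      using \<theta>'[OF Hom_smul[OF h] fd_module_closed(4)[OF M x(1)]] \<theta>'[OF h x] Hom_modD(5)[OF p'(1) x(1)] by simp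
  qed
  have "inj_on \<theta>' (Hom C T Z)"
  proof (rule inj_onI)
    fix h h' assume h: "h \<in> Hom C T Z" "h' \<in> Hom C T Z" and e: "\<theta>' h = \<theta>' h'"
    obtain x x' where x: "x \<in> mcarr M" "\<theta> h = p x" "x' \<in> mcarr M" "\<theta> h' = p x'" using lift h by metis
    then have "\<theta> h = \<theta> h'" using e \<theta>'[OF h(1) x(1,2)] \<theta>'[OF h(2) x(3,4)] eq by simp
    then show "h = h'" using inj_onD[OF d(3)] h by blast
  qed
  moreover have "\<theta>' ` Hom C T Z = mcarr S"
  proof
    show "\<theta>' ` Hom C T Z \<subseteq> mcarr S" using \<theta>' lift Hom_modD(1)[OF p'(1)] by fastforce
    show "mcarr S \<subseteq> \<theta>' ` Hom C T Z"
    proof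
      fix s assume "s \<in> mcarr S"
      then obtain x where x: "x \<in> mcarr M" "s = p' x" using p'(2) by blast
      then obtain h where "h \<in> Hom C T Z" "p x = \<theta> h" using d(4) p(2) by (metis image_eqI imageE)
      then show "s \<in> \<theta>' ` Hom C T Z" using \<theta>' x by (metis image_eqI)
    qed
  qed
  moreover have "\<theta>' (h \<cdot> b) = mact S (\<theta>' h) b" if h: "h \<in> Hom C T Z" and b: "b \<in> Hom C T T" for h b
  proof -
    obtain x where x: "x \<in> mcarr M" "\<theta> h = p x" using lift h by metis
    have b': "b \<in> acarr B" using b by simp
    have "\<theta> (h \<cdot> b) = p (mact M x b)" using d(5)[OF h b] x Hom_modD(6)[OF p(1) x(1) b'] by simp
    then show ?thesis
      using \<theta>'[OF Cmp_in_Hom[OF b h] fd_moduleD(4)[OF M x(1) b']] \<theta>'[OF h x] Hom_modD(6)[OF p'(1) x(1) b'] by simp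
  qed
  ultimately have "represents Z S \<theta>'"
    using fd_moduleD(1)[OF S] l by (auto simp: represents_def bij_betw_def)
  then show ?thesis by (rule that)
qed

text \<open>The \<open>i a \<cdot> p a\<close> sum to the identity, so one of them does not kill a
  given nonzero y in S. Then h |-> \<open>mact S y (i a \<cdot> h)\<close> is a nonzero, hence
  surjective map from \<open>F_mod C T (Ti a)\<close> to S. Its kernel is maximal, so it is the
  radical by \<open>maximal_submodule_unique\<close>.\<close>

lemma simple_is_simple_top:
  fixes S :: "('k, 'm) fmod"
  assumes sum: "is_direct_sum C {1..n} Ti T" and ind: "\<forall>a\<in>{1..n}. indecomposable C (Ti a)"
    and S: "simple_mod B S"
  obtains a where "a \<in> {1..n}" "\<And>Z \<theta>. represents Z S \<theta> \<Longrightarrow> \<exists>\<theta>'. represents Z (simple_top B (F_mod C T (Ti a))) \<theta>'"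
proof -
  have fS: "fd_module B S" and ne: "mcarr S \<noteq> {0}" and simp: "\<And>N. submodule_of B S N \<Longrightarrow> N = {0} \<or> N = mcarr S"
    using S by (auto simp: simple_mod_def)
  note m = fd_moduleD[OF fS, unfolded B_simps]
  interpret s: vector_space "mscale S" by (rule m(1))
  obtain y where y: "y \<in> mcarr S" "y \<noteq> 0" using ne fd_module_closed(1)[OF fS] by blast
  obtain i p where ip: "\<forall>a\<in>{1..n}. i a \<in> Hom C (Ti a) T \<and> p a \<in> Hom C T (Ti a)"
    "\<forall>a\<in>{1..n}. \<forall>b\<in>{1..n}. p a \<cdot> i b = (if a = b then Id C (Ti a) else 0)"
    "(\<Sum>a\<in>{1..n}. i a \<cdot> p a) = Id C T"
    using sum unfolding is_direct_sum_def by blast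
  have ipT: "i a \<cdot> p a \<in> Hom C T T" if "a \<in> {1..n}" for a using ip(1) that Cmp_in_Hom by blast
  have "\<exists>a\<in>{1..n}. mact S y (i a \<cdot> p a) \<noteq> 0"
  proof (rule ccontr)
    assume "\<not> ?thesis"
    then have "(\<Sum>a\<in>{1..n}. mact S y (i a \<cdot> p a)) = 0" by simp
    moreover have "mact S y (\<Sum>a\<in>{1..n}. i a \<cdot> p a) = (\<Sum>a\<in>{1..n}. mact S y (i a \<cdot> p a))"
      using ipT y m(6,8)
      by (intro hom.lin_on_sum[of "mscale S" "Hom C T T" "\<lambda>b. mact S y b", OF _ Hom_subspace] lin_onI) auto
    ultimately show False using ip(3) m(10)[OF y(1)] y(2) by simp
  qed
  then obtain a where a: "a \<in> {1..n}" "mact S y (i a \<cdot> p a) \<noteq> 0" by blast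
  let ?X = "Ti a" and ?i = "i a" and ?p = "p a"
  have ia: "?i \<in> Hom C ?X T" "?p \<in> Hom C T ?X" "?p \<cdot> ?i = Id C ?X" using ip a(1) by auto
  let ?F = "F_mod C T ?X"
  have F: "mcarr ?F = Hom C T ?X" "mscale ?F = smul C" "mact ?F = Cmp C" by (simp_all add: F_mod_def)
  have fF: "fd_module B ?F" by (rule represents_fd_module[OF represents_F])
  define q where "q h = (if h \<in> Hom C T ?X then mact S y (?i \<cdot> h) else 0)" for h
  have ih: "?i \<cdot> h \<in> Hom C T T" if "h \<in> Hom C T ?X" for h using Cmp_in_Hom[OF that ia(1)] .
  have q: "q \<in> Hom_mod B ?F S"
  proof (rule Hom_modI)
    show "lin_on (mscale ?F) (mscale S) (mcarr ?F) q"
      unfolding F using y m(6,8) ih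
      by (intro lin_onI) (simp_all add: q_def Hom_add Hom_smul Cmp_add_right[OF _ _ ia(1)] Cmp_smul_right[OF _ ia(1)])
    fix h b assume "h \<in> mcarr ?F" and "b \<in> acarr B"
    then have h: "h \<in> Hom C T ?X" and b: "b \<in> Hom C T T" by (simp_all add: F)
    show "q (mact ?F h b) = mact S (q h) b"
      unfolding F using h b Cmp_in_Hom[OF b h] Cmp_assoc[OF b h ia(1)] m(9)[OF y(1) ih[OF h] b] by (simp add: q_def)
  qed (use y m(4) ih in \<open>auto simp: q_def F\<close>)
  have "q ?p \<noteq> 0" using a(2) ia(2) by (simp add: q_def)
  moreover have "q ?p \<in> q ` mcarr ?F" using ia(2) F by simp
  ultimately have onto: "q ` mcarr ?F = mcarr S"
    using simp[OF submodule_image[OF fF fS q]] by (metis singletonD)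
  have unique: "rad B ?F = K" if "maximal_submodule B ?F K" for K
  proof -
    have "K' = K" if "maximal_submodule B ?F K'" for K'
      using maximal_submodule_unique[OF _ ia that \<open>maximal_submodule B ?F K\<close>]
        maximal_submodule_unique[OF _ ia \<open>maximal_submodule B ?F K\<close> that] ind a(1) by blast
    then have "{N. maximal_submodule B ?F N} = {K}" using that by blast
    moreover have "K \<subseteq> mcarr ?F" using that by (auto simp: maximal_submodule_def submodule_of_def)
    ultimately show ?thesis by (auto simp: rad_def)
  qed
  have kerq: "map_kernel ?F q = rad B ?F" using unique[OF kernel_maximal[OF fF S q onto]] by simp
  have "is_simple_top B ?F S" unfolding is_simple_top_def using S q onto kerq by blast
  \<comment> \<open>S witnesses that a simple top exists, so the choice made by
    \<open>simple_top\<close> is one; the kernels of both projections are the radical, hence S and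
    the chosen top share their representing objects.\<close>
  then have "is_simple_top B ?F (simple_top B ?F)" unfolding simple_top_def by (rule someI)
  then obtain q' where st: "simple_mod B (simple_top B ?F)" "q' \<in> Hom_mod B ?F (simple_top B ?F)"
    "q' ` mcarr ?F = mcarr (simple_top B ?F)" "map_kernel ?F q' = rad B ?F"
    by (auto simp: is_simple_top_def)
  have "fd_module B (simple_top B ?F)" using st(1) by (simp add: simple_mod_def)
  then show ?thesis
    using that[OF a(1)] represents_same_kernel[OF fF fS _ q onto st(2,3)] kerq st(4) by metis
qed

text \<open>The quotient must again live on polynomials, so it is realised on the image of a linear
  projection p with kernel K, and p is applied after the action of N.\<close>

lemma quotient_by_maximal:
  fixes N :: "('k, 'm) fmod"
  assumes N: "fd_module B N" and K: "maximal_submodule B N K"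
  obtains Q :: "('k, 'm) fmod" where "simple_mod B Q" "(N\<lparr>mcarr := K\<rparr>, N, Q) \<in> mod_ses B"
proof -
  note m = fd_moduleD[OF N, unfolded B_simps] and cl = fd_module_closed[OF N]
  interpret s: vector_space "mscale N" by (rule m(1))
  have sK: "submodule_of B N K" and nK: "K \<noteq> mcarr N"
    and mx: "\<And>K'. submodule_of B N K' \<Longrightarrow> K \<subseteq> K' \<Longrightarrow> K' = K \<or> K' = mcarr N"
    using K by (auto simp: maximal_submodule_def)
  have KN: "K \<subseteq> mcarr N" "s.subspace K" "\<And>x b. x \<in> K \<Longrightarrow> b \<in> Hom C T T \<Longrightarrow> mact N x b \<in> K"
    using sK by (auto simp: submodule_of_def)
  have "\<exists>p. lin_on (mscale N) (mscale N) (mcarr N) p \<and>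
    (\<forall>x\<in>mcarr N. p x \<in> mcarr N \<and> x - p x \<in> K \<and> (p x = 0 \<longleftrightarrow> x \<in> K) \<and> p (p x) = p x)"
    by (rule s.projection_exists[OF m(2) KN(2,1)]) blast
  then obtain p where p0: "lin_on (mscale N) (mscale N) (mcarr N) p"
    "\<forall>x\<in>mcarr N. p x \<in> mcarr N \<and> x - p x \<in> K \<and> (p x = 0 \<longleftrightarrow> x \<in> K) \<and> p (p x) = p x" by blast
  then have p: "lin_on (mscale N) (mscale N) (mcarr N) p" "x \<in> mcarr N \<Longrightarrow> p x \<in> mcarr N"
    "x \<in> mcarr N \<Longrightarrow> x - p x \<in> K" "x \<in> mcarr N \<Longrightarrow> p x = 0 \<longleftrightarrow> x \<in> K"
    "x \<in> mcarr N \<Longrightarrow> p (p x) = p x" for x by auto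
  define Q :: "('k, 'm) fmod"
    where "Q = \<lparr>mcarr = p ` mcarr N, mscale = mscale N, mact = (\<lambda>x b. p (mact N x b))\<rparr>"
  have Qs: "mcarr Q = p ` mcarr N" "mscale Q = mscale N" "mact Q = (\<lambda>x b. p (mact N x b))" by (simp_all add: Q_def)
  have pK: "p x = p x'" if x: "x \<in> mcarr N" "x' \<in> mcarr N" "x - x' \<in> K" for x x'
    using s.lin_on_diff[OF p(1) m(3) x(1,2)] p(4)[OF cl(3)[OF x(1,2)]] x(3) by simp
  \<comment> \<open>x - p x lies in K, K is stable under B, and p kills K; so the new action does
    not depend on the representative.\<close>
  have pact: "p (mact N (p x) b) = p (mact N x b)" if x: "x \<in> mcarr N" and b: "b \<in> Hom C T T" for x b
  proof -
    have "mact N (x - p x) b = mact N x b - mact N (p x) b"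
      using m(5)[OF cl(3)[OF x p(2)[OF x]] p(2)[OF x] b] by (simp add: eq_diff_eq)
    then show ?thesis using pK[OF m(4)[OF x b] m(4)[OF p(2)[OF x] b]] KN(3)[OF p(3)[OF x] b] by simp
  qed
  have pact2: "p (mact N (mact N (p x) b) b') = p (mact N (mact N x b) b')"
    if x: "x \<in> mcarr N" and b: "b \<in> Hom C T T" "b' \<in> Hom C T T" for x b b'
    using pact[OF x Cmp_in_Hom[OF b(2,1)]] m(9)[OF x b] m(9)[OF p(2)[OF x] b] by simp
  have fQ: "fd_module B Q"
    unfolding fd_module_def Qs B_simps
    using m(1) rank_nullity(1)[OF m(1,1) p(1) m(2)]
    by (auto simp: pact pact2 p(2) m(4-10) p(5) Cmp_in_Hom lin_on_add[OF p(1)] lin_on_scale[OF p(1)] cl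
        intro!: imageI)
  define p' where "p' x = (if x \<in> mcarr N then p x else 0)" for x
  have p': "p' \<in> Hom_mod B N Q"
    by (rule Hom_modI)
      (auto simp: p'_def Qs lin_on_def lin_on_add[OF p(1)] lin_on_scale[OF p(1)] cl m(4) pact)
  have p'onto: "p' ` mcarr N = mcarr Q" by (auto simp: p'_def Qs)
  have ker: "map_kernel N p' = K" using p(4) KN(1) by (auto simp: map_kernel_def p'_def)
  have "simple_mod B Q"
    unfolding simple_mod_def
  proof (intro conjI allI impI)
    show "fd_module B Q" by (rule fQ)
    show "mcarr Q \<noteq> {0}" using nK KN(1) p(4) by (auto simp: Qs)
    fix L assume L: "submodule_of B Q L"
    then have LQ: "L \<subseteq> p ` mcarr N" "s.subspace L" "\<And>x b. x \<in> L \<Longrightarrow> b \<in> Hom C T T \<Longrightarrow> p (mact N x b) \<in> L"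
      by (auto simp: submodule_of_def Qs)
    let ?L = "{x \<in> mcarr N. p x \<in> L}"
    have "submodule_of B N ?L"
      unfolding submodule_of_def B_simps
      using subspace_preimage_on[OF m(1) p(1) m(3,1) LQ(2)] LQ(3) pact m(4) by fastforce
    moreover have "K \<subseteq> ?L"
    proof
      fix x assume x: "x \<in> K"
      then have "x \<in> mcarr N" using KN(1) by blast
      moreover from this have "p x = 0" using p(4) x by simp
      ultimately show "x \<in> ?L" using s.subspace_0[OF LQ(2)] by simp
    qed
    ultimately have "?L = K \<or> ?L = mcarr N" by (rule mx)
    then show "L = {0} \<or> L = mcarr Q"
    proof
      assume e: "?L = K"
      have "x = 0" if x: "x \<in> L" for x
      proof -
        obtain z where z: "z \<in> mcarr N" "x = p z" using x LQ(1) by blast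
        then have "z \<in> K" using x e by blast
        then show ?thesis using z p(4) by simp
      qed
      then show ?thesis using s.subspace_0[OF LQ(2)] by blast
    next
      assume "?L = mcarr N"
      then show ?thesis using LQ(1) by (auto simp: Qs)
    qed
  qed
  moreover have fK: "fd_module B (N\<lparr>mcarr := K\<rparr>)" by (rule fd_module_sub[OF N sK])
  define i where "i x = (if x \<in> K then x else 0)" for x :: "'k poly"
  have "i \<in> Hom_mod B (N\<lparr>mcarr := K\<rparr>) N"
    using KN fd_module_closed[OF fK] by (intro Hom_modI lin_onI) (auto simp: i_def)
  moreover have "inj_on i K" "i ` K = K" by (auto simp: i_def inj_on_def)
  ultimately have "short_exact B (N\<lparr>mcarr := K\<rparr>) N Q"
    unfolding short_exact_def using p' p'onto ker by (intro bexI[of _ i] bexI[of _ p']) auto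
  then show ?thesis using that \<open>simple_mod B Q\<close> N fQ fK by (auto simp: mod_ses_def)
qed

text \<open>A proper submodule of largest dimension is maximal.\<close>

lemma maximal_submodule_exists:
  fixes N :: "('k, 'm) fmod"
  assumes N: "fd_module B N" and "mcarr N \<noteq> {0}"
  obtains K where "maximal_submodule B N K" "vector_space.dim (mscale N) K < vector_space.dim (mscale N) (mcarr N)"
proof -
  note m = fd_moduleD[OF N]
  interpret s: vector_space "mscale N" by (rule m(1))
  let ?P = "\<lambda>K. submodule_of B N K \<and> K \<noteq> mcarr N"
  have P0: "?P {0}" using assms(2) fd_module_closed(1)[OF N] mact_0[OF N] by (auto simp: submodule_of_def)
  have bd: "s.dim K \<le> s.dim (mcarr N)" if "?P K" for K
    using s.dim_mono_fin[OF m(2)] that by (auto simp: submodule_of_def)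
  obtain K where K: "?P K" "\<And>K'. ?P K' \<Longrightarrow> s.dim K' \<le> s.dim K"
    using ex_has_greatest_nat[of ?P "{0}" s.dim "s.dim (mcarr N) + 1"] P0 bd by (auto simp: less_Suc_eq_le)
  have max: "K' = K \<or> K' = mcarr N" if K': "submodule_of B N K'" "K \<subseteq> K'" for K'
  proof (cases "K' = mcarr N")
    case False
    have "K = K'"
    proof (rule s.dim_eq_imp_eq)
      show "fin_dim_subspace (mscale N) K'"
        using s.fin_dim_subset[OF m(2)] K'(1) by (auto simp: submodule_of_def)
      show "s.subspace K" using K(1) by (auto simp: submodule_of_def)
    qed (use K' K(2) False in auto)
    then show ?thesis by simp
  qed simp
  have "s.dim K < s.dim (mcarr N)"
    using s.dim_eq_imp_eq[OF m(2), of K] K(1) by (force simp: submodule_of_def not_le[symmetric])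
  then show ?thesis using that K(1) max by (auto simp: maximal_submodule_def)
qed

text \<open>Induction on the dimension, splitting off a simple quotient by a maximal submodule. The
  assumption applies to that quotient because every simple module is the top of some
  \<open>F_mod C T (Ti a)\<close>.\<close>

lemma antisym_form_nonneg:
  fixes N :: "('k, 'm) fmod"
  assumes sum: "is_direct_sum C {1..n} Ti T" and ind: "\<forall>a\<in>{1..n}. indecomposable C (Ti a)"
    and m: "m \<in> carrier (K0_mod B)"
    and pos: "\<forall>a\<in>{1..n}. antisym_form B (K0_mod_class B (simple_top B (F_mod C T (Ti a)))) m \<ge> 0"
    and N: "fd_module B N"
  shows "antisym_form B (K0_mod_class B N) m \<ge> 0"
  using N
proof (induction "vector_space.dim (mscale N) (mcarr N)" arbitrary: N rule: less_induct)
  case less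
  show ?case
  proof (cases "mcarr N = {0}")
    case True
    \<comment> \<open>For N = 0 the sequence 0 -> N -> N -> N -> 0 is exact, so the value a of the
      form satisfies a = a + a.\<close>
    have "0 \<in> Hom_mod B N N" by (rule zero_in_Hom_mod[OF less(2)])
    moreover have "map_kernel N (0 :: 'k poly \<Rightarrow> 'k poly) = {0}" using True by (simp add: map_kernel_def)
    ultimately have "short_exact B N N N"
      unfolding short_exact_def True by (intro bexI[of _ 0] conjI) simp_all
    then have "(N, N, N) \<in> mod_ses B" using less(2) by (simp add: mod_ses_def)
    then show ?thesis using antisym_form_additive[OF m, of N N N] by simp
  next
    case False
    obtain K where K: "maximal_submodule B N K" "vector_space.dim (mscale N) K < vector_space.dim (mscale N) (mcarr N)"
      using maximal_submodule_exists[OF less(2) False] .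
    obtain Q where Q: "simple_mod B Q" "(N\<lparr>mcarr := K\<rparr>, N, Q) \<in> mod_ses B"
      using quotient_by_maximal[OF less(2) K(1)] .
    have "antisym_form B (K0_mod_class B (N\<lparr>mcarr := K\<rparr>)) m \<ge> 0"
      using less(1)[of "N\<lparr>mcarr := K\<rparr>"] K(2) Q(2) by (simp add: mod_ses_def)
    moreover have "antisym_form B (K0_mod_class B Q) m \<ge> 0"
    proof -
      obtain a where a: "a \<in> {1..n}"
        "\<And>Z \<theta>. represents Z Q \<theta> \<Longrightarrow> \<exists>\<theta>'. represents Z (simple_top B (F_mod C T (Ti a))) \<theta>'"
        using simple_is_simple_top[OF sum ind Q(1)] by metis
      obtain V \<theta> where V: "represents (susp C V) Q \<theta>" using represents_susp_exists Q(1) by (metis simple_mod_def)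
      obtain \<theta>' where "represents (susp C V) (simple_top B (F_mod C T (Ti a))) \<theta>'" using a(2)[OF V] by blast
      \<comment> \<open>Q and the simple top are represented by the same object, so the form takes
        the same value on both.\<close>
      then show ?thesis
        using antisym_form_represents[OF m V] antisym_form_represents[OF m] pos a(1) by metis
    qed
    ultimately show ?thesis using antisym_form_additive[OF m Q(2)] by simp
  qed
qed

lemma frieze_fun_tropical:
  assumes m: "m \<in> carrier (K0_mod B)"
    and pos: "\<And>N :: ('k, 'm) fmod. fd_module B N \<Longrightarrow> antisym_form B (K0_mod_class B N) m \<ge> 0"
  shows "tropical_frieze C (frieze_fun C T m)"
proof -
  obtain v where v: "v \<in> m"
    using groth_groupE[OF m[unfolded K0_mod_def]] groth_class_mem[OF mod_ses_subset] by metis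
  note f = frieze_fun_eq[OF m v]
  let ?f = "frieze_fun C T m"
  have ge: "?f E \<le> ?f L + ?f M" if t: "Tri C L E M a b e" for L E M a b e
  proof -
    obtain W where W: "\<And>Z. ev Z L + ev Z M - ev Z E = ev Z (susp C W) + ev Z W" using ev_triangle[OF t] by metis
    obtain N :: "('k, 'm) fmod" and \<theta> where N: "represents (susp C W) N \<theta>" using represents_poly_exists .
    \<comment> \<open>The identity holds for each Z with the same W, so it may be summed over the
      terms of v.\<close>
    have "?f L + ?f M - ?f E = ?f (susp C W) + ?f W"
      unfolding f frag_eval_add_fun[symmetric] frag_eval_diff_fun[symmetric] W ..
    then show ?thesis
      using antisym_form_represents[OF m N] pos[OF represents_fd_module[OF N]] by simp
  qed
  have eq: "?f E = ?f L + ?f M" if "Tri C L E M a b e" "e \<in> ghost M (susp C L)" for L E M a b e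
    unfolding f frag_eval_add_fun[symmetric] using ev_additive[OF that] by simp
  show ?thesis
    unfolding tropical_frieze_def
  proof (intro conjI allI impI)
    fix X Y assume "isomorphic C X Y"
    then show "?f X = ?f Y" unfolding f using ev_iso by (intro frag_eval_cong) blast
  next
    fix X Y Z assume "is_biproduct C X Y Z"
    then show "?f Z = ?f X + ?f Y" unfolding f frag_eval_add_fun[symmetric] using ev_biproduct by simp
  next
    fix L M E E' u v w u' v' w'
    assume d: "dim_Ext1 C L M = 1" and "non_split_Tri C L E M u v w" "non_split_Tri C M E' L u' v' w'"
    then have t: "Tri C L E M u v w" "Tri C M E' L u' v' w'" by (auto simp: non_split_Tri_def)
    have w: "w \<in> Hom C M (susp C L)" "w' \<in> Hom C L (susp C M)" using Tri_in_Hom[OF t(1)] Tri_in_Hom[OF t(2)] by auto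
    show "?f L + ?f M = max (?f E) (?f E')"
      using ghost_dichotomy[OF d[unfolded dim_Ext1_def] w] eq[OF t(1)] eq[OF t(2)] ge[OF t(1)] ge[OF t(2)] by auto
  qed
qed

end

theorem theorem3p1:
  fixes C :: "('k::alg_closed_field, 'o, 'm::ab_group_add) tri_cat"
    and T :: 'o and n :: nat and Ti :: "nat \<Rightarrow> 'o"
    and B :: "('k, 'm) kalgebra"
    and m :: "(('k, 'm) fmod \<Rightarrow>\<^sub>0 int) set"
  assumes "two_CY_category C"
    and "cluster_tilting C T"
    and "is_direct_sum C {1..n} Ti T"
    and "\<forall>i\<in>{1..n}. indecomposable C (Ti i)"
    and "\<forall>i\<in>{1..n}. \<forall>j\<in>{1..n}. i \<noteq> j \<longrightarrow> \<not> isomorphic C (Ti i) (Ti j)"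
    and "B = End_alg C T"
    and "m \<in> carrier (K0_mod B)"
    and "\<forall>i\<in>{1..n}. antisym_form B (K0_mod_class B (simple_top B (F_mod C T (Ti i)))) m \<ge> 0"
  shows "tropical_frieze C (frieze_fun C T m)"
proof -
  interpret cluster_tilted C T
    using assms(1,2) by (simp add: cluster_tilted_def cluster_tilted_axioms_def)
  show ?thesis
    using frieze_fun_tropical antisym_form_nonneg[OF assms(3,4)] assms(6,7,8) by simp
qed

end
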